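(* Let $n\ge 3$ and suppose $M$ is a closed $n$-manifold. If $M$ has an even triangulation with one vertex and $\operatorname{im}(\rho_{k\mid n-k+1})$ is trivial for some $k$ with $1<k\le\frac{n+1}{2}$, then $H_1(M;\mathbb{Z}_2)$ has rank at least $k$. In particular, $\pi_1(M)$ is non-cyclic.
   Context: Triangulations. Let $\widetilde{\Delta}$ be a finite union of pairwise disjoint, oriented Euclidean $n$-simplices, with each facet ($(n-1)$-simplex) $\tau$ the domain of a unique face pairing $\varphi_\tau\in\Phi$, where $\Phi$ is a family, closed under inverses, of orientation-reversing affine isomorphisms between facets. A (singular) triangulation of a closed (connected, orientable) $n$-manifold $M$ is an identification of $M$ with such a quotient $\widetilde{\Delta}/\Phi$. The images of $k$-simplices are $k$-singlices; the degree of a $k$-singlex is the number of $k$-simplices of $\widetilde\Delta$ mapped onto it. The triangulation is even if every $(n-2)$-singlex has even degree; it has one vertex if all corners are identified to one point. Standing convention: $\pi_1$ (based at the barycentre $x_0$ of a base $n$-simplex $\sigma_0$) is presented with generators represented by loops in the dual 1-skeleton (one vertex per $n$-singlex, one edge per $(n-1)$-singlex) and relators arising from the cells of the dual 2-skeleton (one 2-cell per $(n-2)$-singlex). Representations. For a facet $\tau$ of an $n$-simplex $\sigma_\tau$, the perspectivity $p_\tau\colon\sigma_\tau\to\sigma_{\varphi_\tau(\tau)}$ is the bijection of vertex sets that agrees with $\varphi_\tau$ on $\tau$ and sends the vertex opposite $\tau$ to the vertex opposite $\varphi_\tau(\tau)$. A loop $\gamma$ in the dual 1-skeleton based at $x_0$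 crossing successively the facets $\tau_0,\dots,\tau_m$ has projectivity $p_\gamma=p_{\tau_m}\circ\cdots\circ p_{\tau_0}\in\mathrm{Sym}(\sigma_0)$. For an even triangulation, $\rho\colon[\gamma]\mapsto p_\gamma$ is a homomorphism to $\mathrm{Sym}(\sigma_0)\cong\mathrm{Sym}(n+1)$, the canonical symmetric representation. The induced action of $\rho$ on the set of unordered partitions of the $n+1$ vertices of $\sigma_0$ into two sets of sizes $k$ and $n-k+1$ is denoted $\rho_{k\mid n-k+1}\colon\pi_1(M)\to\mathrm{Sym}(N)$, where $N$ is the number of such partitions. *)

theory Defs
  imports "HOL-Analysis.Analysis" "HOL-Homology.Homology" "HOL-Algebra.Bij" "HOL-Combinatorics.Permutations"
    "HOL-Library.Extended_Nat"
begin

section \<open>Closed manifolds\<close>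

text \<open>An orientation of an \<open>n\<close>-manifold is a choice of generators of the local homology groups
  \<open>H\<^sub>n(M, M - x)\<close> that is locally induced by a single relative class.\<close>

definition orientable :: "nat \<Rightarrow> 'm topology \<Rightarrow> bool" where
  "orientable n M \<longleftrightarrow>
    (\<exists>\<mu>. \<forall>x\<in>topspace M.
       \<mu> x \<in> carrier (relative_homology_group (int n) M (topspace M - {x})) \<and>
       subgroup_generated (relative_homology_group (int n) M (topspace M - {x})) {\<mu> x}
         = relative_homology_group (int n) M (topspace M - {x}) \<and>
       (\<exists>U. openin M U \<and> x \<in> U \<and>
         (\<exists>b \<in> carrier (relative_homology_group (int n) M (topspace M - U)).
            \<forall>y\<in>U. hom_induced (int n) M (topspace M - U) M (topspace M - {y}) id b = \<mu> y)))"

definition locally_Euclidean :: "nat \<Rightarrow> 'm topology \<Rightarrow> bool" where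
  "locally_Euclidean n M \<longleftrightarrow>
    (\<forall>x\<in>topspace M. \<exists>U V. openin M U \<and> x \<in> U \<and> openin (Euclidean_space n) V \<and>
       subtopology M U homeomorphic_space subtopology (Euclidean_space n) V)"

text \<open>Closed manifolds are understood to be connected and orientable.\<close>

definition closed_manifold :: "nat \<Rightarrow> 'm topology \<Rightarrow> bool" where
  "closed_manifold n M \<longleftrightarrow>
     Hausdorff_space M \<and> second_countable M \<and> locally_Euclidean n M \<and>
     compact_space M \<and> connected_space M \<and> orientable n M"


section \<open>The fundamental group\<close>

definition loop_at :: "'m topology \<Rightarrow> 'm \<Rightarrow> (real \<Rightarrow> 'm) \<Rightarrow> bool" where
  "loop_at X x g \<longleftrightarrow> pathin X g \<and> g 0 = x \<and> g 1 = x"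

definition loop_homotopic :: "'m topology \<Rightarrow> 'm \<Rightarrow> (real \<Rightarrow> 'm) \<Rightarrow> (real \<Rightarrow> 'm) \<Rightarrow> bool" where
  "loop_homotopic X x =
     homotopic_with (\<lambda>h. h 0 = x \<and> h 1 = x) (top_of_set {0..1}) X"

text \<open>This is \<open>joinpaths\<close> without its type class constraint on the codomain.\<close>

definition path_concat :: "(real \<Rightarrow> 'm) \<Rightarrow> (real \<Rightarrow> 'm) \<Rightarrow> real \<Rightarrow> 'm" where
  "path_concat f g = (\<lambda>t. if t \<le> 1/2 then f (2 * t) else g (2 * t - 1))"

definition loop_class :: "'m topology \<Rightarrow> 'm \<Rightarrow> (real \<Rightarrow> 'm) \<Rightarrow> (real \<Rightarrow> 'm) set" where
  "loop_class X x g = {h. loop_at X x h \<and> loop_homotopic X x g h}"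

definition fundamental_group :: "'m topology \<Rightarrow> 'm \<Rightarrow> (real \<Rightarrow> 'm) set monoid" where
  "fundamental_group X x =
     \<lparr>carrier = {loop_class X x g | g. loop_at X x g},
      mult = (\<lambda>A B. {h. loop_at X x h \<and> (\<exists>f\<in>A. \<exists>g\<in>B. loop_homotopic X x (path_concat f g) h)}),
      one = loop_class X x (\<lambda>_. x)\<rparr>"


section \<open>Homology with coefficients in the field with two elements\<close>

text \<open>The chain complex with coefficients in \<open>\<int>/2\<close> is \<open>C/2C\<close>, where \<open>C\<close> is the integral
  singular chain complex. Chains are represented by their integral lifts: a lift is a cycle if its
  boundary lies in \<open>2C\<close>, and a boundary if it lies in \<open>\<partial>C + 2C\<close>.\<close>

definition mod2_cycles :: "nat \<Rightarrow> 'm topology \<Rightarrow> 'm chain set" where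
  "mod2_cycles p X = {c. singular_chain p X c \<and> (\<exists>d. chain_boundary p c = frag_cmul 2 d)}"

definition mod2_boundaries :: "nat \<Rightarrow> 'm topology \<Rightarrow> 'm chain set" where
  "mod2_boundaries p X =
     {chain_boundary (Suc p) e + frag_cmul 2 d | e d. singular_chain (Suc p) X e \<and> singular_chain p X d}"

definition mod2_homology_group :: "nat \<Rightarrow> 'm topology \<Rightarrow> 'm chain set monoid" where
  "mod2_homology_group p X =
     subgroup_generated (chain_group p X) (mod2_cycles p X) Mod mod2_boundaries p X"

text \<open>For an abelian group of exponent two, written multiplicatively, the linear combinations of a
  finite set \<open>B\<close> over the field with two elements are the products over the subsets of \<open>B\<close>.\<close>

definition mod2_independent :: "('g, 'b) monoid_scheme \<Rightarrow> 'g set \<Rightarrow> bool" where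
  "mod2_independent G B \<longleftrightarrow>
     finite B \<and> B \<subseteq> carrier G \<and> (\<forall>A\<subseteq>B. A \<noteq> {} \<longrightarrow> finprod G (\<lambda>x. x) A \<noteq> \<one>\<^bsub>G\<^esub>)"

definition mod2_rank :: "('g, 'b) monoid_scheme \<Rightarrow> enat" where
  "mod2_rank G = (SUP B\<in>{B. mod2_independent G B}. enat (card B))"


section \<open>Singular triangulations\<close>

definition faces_of_dim :: "'a::euclidean_space set set \<Rightarrow> int \<Rightarrow> 'a set set" where
  "faces_of_dim S d = {F. \<exists>\<sigma>\<in>S. F face_of \<sigma> \<and> aff_dim F = d}"

definition vertices :: "'a::euclidean_space set \<Rightarrow> 'a set" where
  "vertices F = {v. v extreme_point_of F}"

definition barycentre :: "'a::euclidean_space set \<Rightarrow> 'a" where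
  "barycentre F = (1 / real (card (vertices F))) *\<^sub>R (\<Sum>v\<in>vertices F. v)"

text \<open>The orientation of a simplex is given by one positively ordered list of its vertices. The map
  \<open>pairing \<tau>\<close> is only relevant on the facet \<open>\<tau>\<close>.\<close>

record 'a gluing =
  simplices :: "'a set set"
  orient :: "'a set \<Rightarrow> 'a list"
  pairing :: "'a set \<Rightarrow> 'a \<Rightarrow> 'a"

definition facets :: "'a::euclidean_space gluing \<Rightarrow> 'a set set" where
  "facets D = {\<tau>. \<exists>\<sigma>\<in>simplices D. \<tau> facet_of \<sigma>}"

definition simplex_at :: "'a::euclidean_space gluing \<Rightarrow> 'a set \<Rightarrow> 'a set" where
  "simplex_at D \<tau> = (THE \<sigma>. \<sigma> \<in> simplices D \<and> \<tau> facet_of \<sigma>)"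

definition opposite :: "'a::euclidean_space gluing \<Rightarrow> 'a set \<Rightarrow> 'a" where
  "opposite D \<tau> = (THE v. v \<in> vertices (simplex_at D \<tau>) \<and> v \<notin> \<tau>)"

definition partner :: "'a::euclidean_space gluing \<Rightarrow> 'a set \<Rightarrow> 'a set" where
  "partner D \<tau> = pairing D \<tau> ` \<tau>"

definition positive :: "'a gluing \<Rightarrow> 'a set \<Rightarrow> 'a list \<Rightarrow> bool" where
  "positive D \<sigma> vs \<longleftrightarrow>
     (\<exists>p. p permutes {..<length vs} \<and> evenperm p \<and> permute_list p vs = orient D \<sigma>)"

text \<open>The induced (outward) orientation of the facet opposite \<open>v\<^sub>0\<close> in the oriented simplex
  \<open>[v\<^sub>0, \<dots>, v\<^sub>n]\<close> is \<open>[v\<^sub>1, \<dots>, v\<^sub>n]\<close>.\<close>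

definition positive_facet :: "'a::euclidean_space gluing \<Rightarrow> 'a set \<Rightarrow> 'a list \<Rightarrow> bool" where
  "positive_facet D \<tau> vs \<longleftrightarrow> positive D (simplex_at D \<tau>) (opposite D \<tau> # vs)"

definition orientation_reversing :: "'a::euclidean_space gluing \<Rightarrow> 'a set \<Rightarrow> bool" where
  "orientation_reversing D \<tau> \<longleftrightarrow>
     (\<forall>vs. distinct vs \<and> set vs = vertices \<tau> \<and> positive_facet D \<tau> vs \<longrightarrow>
        \<not> positive_facet D (partner D \<tau>) (map (pairing D \<tau>) vs))"

definition affine_map_on :: "'a::real_vector set \<Rightarrow> ('a \<Rightarrow> 'a) \<Rightarrow> bool" where
  "affine_map_on \<tau> f \<longleftrightarrow>
     (\<forall>x\<in>\<tau>. \<forall>y\<in>\<tau>. \<forall>u\<in>{0..1}. f ((1 - u) *\<^sub>R x + u *\<^sub>R y) = (1 - u) *\<^sub>R f x + u *\<^sub>R f y)"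

definition is_gluing :: "nat \<Rightarrow> 'a::euclidean_space gluing \<Rightarrow> bool" where
  "is_gluing n D \<longleftrightarrow>
     finite (simplices D) \<and> pairwise disjnt (simplices D) \<and>
     (\<forall>\<sigma>\<in>simplices D. int n simplex \<sigma> \<and> distinct (orient D \<sigma>) \<and> set (orient D \<sigma>) = vertices \<sigma>) \<and>
     (\<forall>\<tau>\<in>facets D. partner D \<tau> \<in> facets D \<and>
        inj_on (pairing D \<tau>) \<tau> \<and> affine_map_on \<tau> (pairing D \<tau>) \<and>
        (\<forall>x\<in>\<tau>. pairing D (partner D \<tau>) (pairing D \<tau> x) = x) \<and>
        orientation_reversing D \<tau>)"

text \<open>As the pairings are closed under inverses, the reflexive transitive closure is an equivalence
  relation.\<close>

definition glued :: "'a::euclidean_space gluing \<Rightarrow> ('a \<times> 'a) set" where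
  "glued D = {(x, pairing D \<tau> x) | x \<tau>. \<tau> \<in> facets D \<and> x \<in> \<tau>}\<^sup>*"

text \<open>A triangulation is an identification of \<open>M\<close> with the quotient space; it is recorded by the
  composite \<open>q\<close> of the quotient projection with this identification.\<close>

definition is_triangulation ::
    "nat \<Rightarrow> 'm topology \<Rightarrow> 'a::euclidean_space gluing \<Rightarrow> ('a \<Rightarrow> 'm) \<Rightarrow> bool" where
  "is_triangulation n M D q \<longleftrightarrow>
     is_gluing n D \<and>
     quotient_map (top_of_set (\<Union>(simplices D))) M q \<and>
     (\<forall>x\<in>\<Union>(simplices D). \<forall>y\<in>\<Union>(simplices D). q x = q y \<longleftrightarrow> (x, y) \<in> glued D)"

definition singlices :: "'a::euclidean_space gluing \<Rightarrow> ('a \<Rightarrow> 'm) \<Rightarrow> int \<Rightarrow> 'm set set" where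
  "singlices D q d = (\<lambda>F. q ` F) ` faces_of_dim (simplices D) d"

definition singlex_degree ::
    "'a::euclidean_space gluing \<Rightarrow> ('a \<Rightarrow> 'm) \<Rightarrow> int \<Rightarrow> 'm set \<Rightarrow> nat" where
  "singlex_degree D q d s = card {F \<in> faces_of_dim (simplices D) d. q ` F = s}"

definition even_triangulation :: "nat \<Rightarrow> 'a::euclidean_space gluing \<Rightarrow> ('a \<Rightarrow> 'm) \<Rightarrow> bool" where
  "even_triangulation n D q \<longleftrightarrow>
     (\<forall>s\<in>singlices D q (int n - 2). even (singlex_degree D q (int n - 2) s))"

definition one_vertex :: "'a::euclidean_space gluing \<Rightarrow> ('a \<Rightarrow> 'm) \<Rightarrow> bool" where
  "one_vertex D q \<longleftrightarrow> card (singlices D q 0) = 1"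


section \<open>Projectivities and the canonical symmetric representation\<close>

definition perspectivity :: "'a::euclidean_space gluing \<Rightarrow> 'a set \<Rightarrow> 'a \<Rightarrow> 'a" where
  "perspectivity D \<tau> v = (if v \<in> \<tau> then pairing D \<tau> v else opposite D (partner D \<tau>))"

text \<open>Paths in the dual 1-skeleton are given by the list of facets through which they leave the
  successive simplices.\<close>

fun dual_walk :: "'a::euclidean_space gluing \<Rightarrow> 'a set \<Rightarrow> 'a set list \<Rightarrow> 'a set \<Rightarrow> bool" where
  "dual_walk D \<sigma> [] \<sigma>' \<longleftrightarrow> \<sigma> = \<sigma>'"
| "dual_walk D \<sigma> (\<tau> # \<tau>s) \<sigma>' \<longleftrightarrow>
     \<tau> facet_of \<sigma> \<and> dual_walk D (simplex_at D (partner D \<tau>)) \<tau>s \<sigma>'"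

fun walk_projectivity :: "'a::euclidean_space gluing \<Rightarrow> 'a set list \<Rightarrow> 'a \<Rightarrow> 'a" where
  "walk_projectivity D [] = id"
| "walk_projectivity D (\<tau> # \<tau>s) = walk_projectivity D \<tau>s \<circ> perspectivity D \<tau>"

definition dual_edge :: "'a::euclidean_space gluing \<Rightarrow> ('a \<Rightarrow> 'm) \<Rightarrow> 'a set \<Rightarrow> real \<Rightarrow> 'm" where
  "dual_edge D q \<tau> =
     path_concat
       (q \<circ> linepath (barycentre (simplex_at D \<tau>)) (barycentre \<tau>))
       (q \<circ> linepath (barycentre (partner D \<tau>)) (barycentre (simplex_at D (partner D \<tau>))))"

fun dual_curve ::
    "'a::euclidean_space gluing \<Rightarrow> ('a \<Rightarrow> 'm) \<Rightarrow> 'a set \<Rightarrow> 'a set list \<Rightarrow> real \<Rightarrow> 'm" where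
  "dual_curve D q \<sigma> [] = (\<lambda>_. q (barycentre \<sigma>))"
| "dual_curve D q \<sigma> (\<tau> # \<tau>s) =
     path_concat (dual_edge D q \<tau>) (dual_curve D q (simplex_at D (partner D \<tau>)) \<tau>s)"

abbreviation pi1 ::
    "'m topology \<Rightarrow> ('a::euclidean_space \<Rightarrow> 'm) \<Rightarrow> 'a set \<Rightarrow> (real \<Rightarrow> 'm) set monoid" where
  "pi1 M q \<sigma>\<^sub>0 \<equiv> fundamental_group M (q (barycentre \<sigma>\<^sub>0))"

text \<open>The representation is given by its graph, the set of all pairs \<open>([\<gamma>], p\<^sub>\<gamma>)\<close>, where \<open>\<gamma>\<close> is a loop
  in the dual 1-skeleton.\<close>

definition symmetric_rep ::
    "'m topology \<Rightarrow> 'a::euclidean_space gluing \<Rightarrow> ('a \<Rightarrow> 'm) \<Rightarrow> 'a set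
      \<Rightarrow> ((real \<Rightarrow> 'm) set \<times> ('a \<Rightarrow> 'a)) set" where
  "symmetric_rep M D q \<sigma>\<^sub>0 =
     {(loop_class M (q (barycentre \<sigma>\<^sub>0)) (dual_curve D q \<sigma>\<^sub>0 \<tau>s),
       restrict (walk_projectivity D \<tau>s) (vertices \<sigma>\<^sub>0)) | \<tau>s. dual_walk D \<sigma>\<^sub>0 \<tau>s \<sigma>\<^sub>0}"

definition vertex_partitions :: "'a::euclidean_space set \<Rightarrow> nat \<Rightarrow> 'a set set set" where
  "vertex_partitions \<sigma> k = {{A, vertices \<sigma> - A} | A. A \<subseteq> vertices \<sigma> \<and> card A = k}"

definition partition_action :: "'a::euclidean_space set \<Rightarrow> nat \<Rightarrow> ('a \<Rightarrow> 'a) \<Rightarrow> 'a set set \<Rightarrow> 'a set set" where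
  "partition_action \<sigma> k p = (\<lambda>P\<in>vertex_partitions \<sigma> k. (\<lambda>A. p ` A) ` P)"

definition partition_rep ::
    "'m topology \<Rightarrow> 'a::euclidean_space gluing \<Rightarrow> ('a \<Rightarrow> 'm) \<Rightarrow> 'a set \<Rightarrow> nat
      \<Rightarrow> ((real \<Rightarrow> 'm) set \<times> ('a set set \<Rightarrow> 'a set set)) set" where
  "partition_rep M D q \<sigma>\<^sub>0 k =
     {(c, partition_action \<sigma>\<^sub>0 k p) | c p. (c, p) \<in> symmetric_rep M D q \<sigma>\<^sub>0}"

end

theory Submission
  imports Defs
begin

text \<open>
  Since all vertices are identified, the projectivities act transitively on the vertices of
  \<open>\<sigma>\<^sub>0\<close>. A permutation of \<open>n + 1\<close> points that fixes all unordered partitions into sets of sizes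
  \<open>k\<close> and \<open>n + 1 - k\<close> is trivial unless \<open>n = 3\<close> and \<open>k = 2\<close>, so this is the only possible case, and
  each of the three partitions of the vertices of \<open>\<sigma>\<^sub>0\<close> into two pairs is transported consistently to
  all tetrahedra. For such a partition, let \<open>\<zeta>\<close> be \<open>1\<close> on one of the two pairs in each tetrahedron
  and \<open>- 1\<close> on the other; it is invariant under the perspectivities up to a sign.

  In terms of barycentric coordinates \<open>b\<^sub>v\<close>, the functions \<open>\<Sum>\<^sub>v \<zeta>(v) b\<^sub>v\<close>, \<open>\<Sum> \<zeta>(v) b\<^sub>v b\<^sub>w\<close> (over the
  consistently oriented edges \<open>vw\<close>), \<open>\<Sum>\<^sub>c \<zeta>(c) \<Prod>\<^sub>v b\<^sub>v\<close> (with \<open>v \<noteq> c\<close>) and \<open>\<Prod>\<^sub>v b\<^sub>v\<close> have a common sign ambiguity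
  and no common zero. They define a map from \<open>M\<close> to the real projective space of dimension \<open>3\<close>;
  lifting paths to the double cover yields a homomorphism to \<open>\<int>/2\<close> that is defined both on
  \<open>\<pi>\<^sub>1(M)\<close> and on \<open>H\<^sub>1(M; \<int>/2)\<close>. The loop from the barycentre of \<open>\<sigma>\<^sub>0\<close> to its vertex \<open>a\<close> and back from its
  vertex \<open>b\<close> is mapped to \<open>0\<close> if and only if \<open>\<zeta>(a) = \<zeta>(b)\<close>. Hence two partitions and two such
  loops show that the rank of \<open>H\<^sub>1(M; \<int>/2)\<close> is at least \<open>2\<close> and that \<open>\<pi>\<^sub>1(M)\<close> is not cyclic.\<close>

section \<open>Lifting paths from projective space\<close>

text \<open>The first of the four functions vanishes on a surface that meets each tetrahedron in a
  quadrilateral separating the two pairs. The fourth, third and second functions are nonzero on its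
  parts inside tetrahedra, facets and edges, respectively.

  The delicate one is the second. If the gluings carried an edge with ends of different signs onto
  its own reverse, the sign would change on the way, the midpoint would be glued to itself with sign
  -1, and every function with this sign ambiguity would vanish there. So such a reversal must be
  excluded. The signs show that it would also exchange the other two vertices, which is an even
  permutation. The tetrahedra around an edge are passed through two alternating kinds of facets,
  each passage reversing the orientation; a symmetry that exchanges the two kinds but keeps the
  orientation is a reflection with a fixed position, whereas the double transposition fixes none.

  A vector up to sign is encoded by the matrix w w^T, so that the quotient by +-1 becomes an
  explicit covering of a subset of a Euclidean space.\<close>

definition outer :: "real^'n::finite \<Rightarrow> real^'n^'n" where
  "outer w = (\<chi> i j. w $ i * w $ j)"

text \<open>Evaluating the rank one matrix w w^T at a vector not orthogonal to \<open>w\<close>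
  recovers the line through \<open>w\<close>; the sign lemma below and the local sections of the
  covering both rest on this.\<close>

lemma outer_mult: "outer w *v u = (w \<bullet> u) *\<^sub>R w"
  by (simp add: outer_def matrix_vector_mult_def inner_vec_def vec_eq_iff sum_distrib_left mult_ac)

lemma outer_uminus [simp]: "outer (- w) = outer w"
  by (simp add: outer_def)

text \<open>Evaluating both matrices at \<open>w\<close> shows that \<open>w\<close> is a multiple
  \<open>c\<close> of \<open>w'\<close>, and a further inner product with \<open>w\<close> gives c^2
  = 1.\<close>

lemma outer_eq_iff: "outer w = outer w' \<longleftrightarrow> w = w' \<or> w = - w'"
proof
  assume eq: "outer w = outer w'"
  show "w = w' \<or> w = - w'"
  proof (cases "w = 0")
    case True
    then have "(w' \<bullet> w') *\<^sub>R w' = 0"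
      using eq by (metis inner_zero_left outer_mult scale_zero_left)
    then show ?thesis
      using True by simp
  next
    case False
    define c where "c = (w' \<bullet> w) / (w \<bullet> w)"
    have "(w \<bullet> w) *\<^sub>R w = (w' \<bullet> w) *\<^sub>R w'"
      using eq by (metis outer_mult)
    then have "w = c *\<^sub>R w'"
      using False by (metis c_def divide_inverse_commute inner_eq_zero_iff inverse_eq_divide scaleR_scaleR
          left_inverse scaleR_one)
    have "(w \<bullet> w) * (w \<bullet> w) = (w' \<bullet> w) * (w' \<bullet> w)"
      using \<open>(w \<bullet> w) *\<^sub>R w = (w' \<bullet> w) *\<^sub>R w'\<close> by (metis inner_scaleR_left)
    moreover have "c * c = ((w' \<bullet> w) * (w' \<bullet> w)) / ((w \<bullet> w) * (w \<bullet> w))"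
      by (simp add: c_def)
    ultimately have "c * c = 1"
      using False by (metis divide_self_if inner_eq_zero_iff mult_eq_0_iff)
    then have "c = 1 \<or> c = - 1"
      by (simp add: square_eq_1_iff)
    then show ?thesis
      using \<open>w = c *\<^sub>R w'\<close> by auto
  qed
qed auto

lemma continuous_on_outer: "continuous_on S outer"
  unfolding outer_def by (intro continuous_intros)

text \<open>Near \<open>outer u\<close> the two preimages of a matrix are told apart by the sign of
  their inner product with \<open>u\<close>: these are the sheets \<open>H 1\<close> and
  \<open>H (-1)\<close>. The local inverse \<open>g e\<close> divides m u = (w \<bullet> u) w by the
  square root of u \<bullet> (m u) = (w \<bullet> u)^2, with \<open>e\<close> as the sign.\<close>

lemma covering_space_outer: "covering_space (- {0}) outer (outer ` (- {0} :: (real^'n::finite) set))"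
proof
  show "continuous_on (- {0}) (outer :: real^'n \<Rightarrow> _)"
    by (rule continuous_on_outer)
  show "outer ` (- {0}) = outer ` (- {0} :: (real^'n) set)" ..
  fix x :: "real^'n^'n"
  assume "x \<in> outer ` (- {0})"
  then obtain u where u: "u \<noteq> 0" "x = outer u"
    by auto
  define S where "S = outer ` (- {0} :: (real^'n) set)"
  define T where "T = {m \<in> S. u \<bullet> (m *v u) > 0}"
  define H where "H e = {w. (e *\<^sub>R w) \<bullet> u > 0}" for e :: real
  define g where "g e m = (e / sqrt (u \<bullet> (m *v u))) *\<^sub>R (m *v u)" for e :: real and m :: "real^'n^'n"
  have mu: "u \<bullet> (outer w *v u) = (w \<bullet> u)\<^sup>2" for w
    by (simp add: outer_mult power2_eq_square inner_commute)
  have contT: "continuous_on A (\<lambda>m::real^'n^'n. m *v u)" for A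
    by (simp add: matrix_vector_mult_def continuous_intros)
  have "openin (top_of_set S) T"
  proof -
    have "T = S \<inter> (\<lambda>m. u \<bullet> (m *v u)) -` {0<..}"
      by (auto simp: T_def)
    moreover have "continuous_on S (\<lambda>m. u \<bullet> (m *v u))"
      by (intro continuous_intros contT)
    ultimately show ?thesis
      using continuous_openin_preimage_gen[OF _ open_greaterThan] by metis
  qed
  moreover have "x \<in> T"
    using u by (auto simp: T_def S_def mu)
  moreover have "\<Union> {H 1, H (-1)} = (- {0}) \<inter> outer -` T"
  proof
    show "\<Union> {H 1, H (-1)} \<subseteq> (- {0}) \<inter> outer -` T"
      by (auto simp: H_def T_def S_def mu)
    show "(- {0}) \<inter> outer -` T \<subseteq> \<Union> {H 1, H (-1)}"
      by (auto simp: H_def T_def S_def mu)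
  qed
  moreover have "\<forall>v\<in>{H 1, H (-1)}. openin (top_of_set (- {0})) v"
  proof -
    have "open (H e)" for e
      unfolding H_def by (intro open_Collect_less continuous_intros)
    moreover have "H e \<subseteq> - {0}" for e
      by (auto simp: H_def)
    ultimately show ?thesis
      by (simp add: open_openin_trans open_delete open_Compl)
  qed
  moreover have "pairwise disjnt {H 1, H (-1)}"
    by (auto simp: pairwise_def disjnt_def H_def)
  moreover have hom: "homeomorphism (H e) T outer (g e)" if "e \<in> {1, -1}" for e
  proof
    show "continuous_on (H e) outer"
      by (rule continuous_on_outer)
    show "continuous_on T (g e)"
      unfolding g_def by (intro continuous_intros contT) (auto simp: T_def)
    show "outer ` H e \<subseteq> T"
      by (auto simp: H_def T_def S_def mu)
    have gouter: "g e (outer w) = w" if "w \<in> H e" for w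
    proof -
      have pos: "e * (w \<bullet> u) > 0"
        using that by (simp add: H_def)
      have "sqrt ((w \<bullet> u)\<^sup>2) = e * (w \<bullet> u)"
        using pos \<open>e \<in> {1, -1}\<close> by auto
      then have "g e (outer w) = (e / (e * (w \<bullet> u))) *\<^sub>R ((w \<bullet> u) *\<^sub>R w)"
        unfolding g_def mu unfolding outer_mult by simp
      also have "\<dots> = w"
        using pos by (auto simp: zero_less_mult_iff)
      finally show ?thesis .
    qed
    then show "g e (outer w) = w" if "w \<in> H e" for w
      using that .
    have ex: "\<exists>w\<in>H e. m = outer w" if m: "m \<in> T" for m
    proof -
      obtain w where w: "m = outer w" "w \<noteq> 0"
        using m by (auto simp: T_def S_def)
      then have "w \<bullet> u \<noteq> 0"
        using m by (auto simp: T_def mu)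
      then have "w \<in> H e \<or> - w \<in> H e"
        using \<open>e \<in> {1, -1}\<close> by (auto simp: H_def)
      then show ?thesis
        using w by (metis outer_uminus)
    qed
    show "g e ` T \<subseteq> H e"
      using ex gouter by fastforce
    show "outer (g e m) = m" if "m \<in> T" for m
      using ex[OF that] gouter by fastforce
  qed
  ultimately show "\<exists>T. x \<in> T \<and> openin (top_of_set (outer ` (- {0}))) T \<and>
      (\<exists>v. \<Union> v = (- {0}) \<inter> outer -` T \<and> (\<forall>u\<in>v. openin (top_of_set (- {0})) u) \<and>
        pairwise disjnt v \<and> (\<forall>u\<in>v. \<exists>q. homeomorphism u T outer q))"
    unfolding S_def by (intro exI[of _ T] conjI exI[of _ "{H 1, H (-1)}"]) (use hom in auto)
qed

lemma pathin_path_concat: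
  assumes "pathin X f" "pathin X g" "f 1 = g 0"
  shows "pathin X (path_concat f g)"
proof -
  have "continuous_map (top_of_set {0..1}) X (\<lambda>t. if t \<le> 1/2 then (f \<circ> (\<lambda>t. 2 * t)) t else (g \<circ> (\<lambda>t. 2 * t - 1)) t)"
  proof (rule continuous_map_cases_le)
    show "continuous_map (subtopology (top_of_set {0..1}) {x \<in> topspace (top_of_set {0..1}). x \<le> 1 / 2}) X (f \<circ> (\<lambda>t. 2 * t))"
      using assms(1) unfolding pathin_def
      by (rule continuous_map_compose[rotated])
        (auto simp: continuous_map_in_subtopology subtopology_subtopology intro!: continuous_intros)
    show "continuous_map (subtopology (top_of_set {0..1}) {x \<in> topspace (top_of_set {0..1}). 1 / 2 \<le> x}) X (g \<circ> (\<lambda>t. 2 * t - 1))"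
      using assms(2) unfolding pathin_def
      by (rule continuous_map_compose[rotated])
        (auto simp: continuous_map_in_subtopology subtopology_subtopology intro!: continuous_intros)
    show "(f \<circ> (\<lambda>t. 2 * t)) t = (g \<circ> (\<lambda>t. 2 * t - 1)) t" if "t = 1 / 2" for t
      unfolding that using assms(3) by simp
  qed (auto intro!: continuous_intros)
  then show ?thesis
    unfolding pathin_def path_concat_def comp_apply .
qed

text \<open>As \<open>w\<close> is determined by \<open>outer w\<close> up to sign, \<open>F\<close> is a map to a projective space, given by
  nonzero vectors up to sign.\<close>

locale line_field =
  fixes M :: "'m topology" and F :: "'m \<Rightarrow> real^'n^'n"
  assumes cont: "continuous_map M euclidean F"
    and nonzero: "x \<in> topspace M \<Longrightarrow> \<exists>w. w \<noteq> 0 \<and> outer w = F x"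
begin

definition lifts :: "'c::real_normed_vector set \<Rightarrow> ('c \<Rightarrow> 'm) \<Rightarrow> ('c \<Rightarrow> real^'n) \<Rightarrow> bool" where
  "lifts S \<gamma> l \<longleftrightarrow> continuous_on S l \<and> (\<forall>t\<in>S. outer (l t) = F (\<gamma> t))"

text \<open>An arbitrary choice of one of the two vectors over each point, with no continuity.
  Measuring lifts against it gives a parity to all paths, not only to loops, and makes parity
  additive under concatenation and around triangles; for a loop the choice cancels.\<close>

definition ref :: "'m \<Rightarrow> real^'n" where
  "ref x = (SOME w. outer w = F x)"

definition parity :: "(real \<Rightarrow> 'm) \<Rightarrow> bool" where
  "parity \<gamma> \<longleftrightarrow> (\<exists>l. lifts {0..1} \<gamma> l \<and> l 0 = ref (\<gamma> 0) \<and> l 1 \<noteq> ref (\<gamma> 1))"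

lemma outer_ref: "x \<in> topspace M \<Longrightarrow> outer (ref x) = F x"
  unfolding ref_def by (rule someI_ex) (use nonzero in blast)

lemma outer_nonzero:
  assumes "x \<in> topspace M" "outer w = F x"
  shows "w \<noteq> 0"
  using nonzero[OF assms(1)] assms(2) by (metis minus_zero outer_eq_iff)

lemma lift_exists:
  assumes "convex S" and "continuous_map (top_of_set S) M \<gamma>"
  obtains l where "lifts S \<gamma> l"
proof -
  have "continuous_on S (F \<circ> \<gamma>)"
    using continuous_map_compose[OF assms(2) cont] by simp
  moreover have "F \<circ> \<gamma> \<in> S \<rightarrow> outer ` (- {0})"
  proof
    fix t assume "t \<in> S"
    then have "\<gamma> t \<in> topspace M"
      using assms(2) by (auto simp: continuous_map_def)
    from nonzero[OF this] show "(F \<circ> \<gamma>) t \<in> outer ` (- {0})"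
      by force
  qed
  ultimately obtain l where "continuous_on S l" "\<And>t. t \<in> S \<Longrightarrow> outer (l t) = (F \<circ> \<gamma>) t"
    using covering_space_lift[OF covering_space_outer convex_imp_simply_connected[OF assms(1)]
        convex_imp_locally_path_connected[OF assms(1)]]
    by metis
  then show ?thesis
    by (intro that) (auto simp: lifts_def)
qed

lemma lifts_compose:
  assumes "lifts S \<gamma> l" "continuous_on T r" "r \<in> T \<rightarrow> S"
  shows "lifts T (\<gamma> \<circ> r) (l \<circ> r)"
proof -
  have "continuous_on T (l \<circ> r)"
    using assms by (intro continuous_on_compose) (auto simp: lifts_def elim!: continuous_on_subset)
  then show ?thesis
    using assms by (auto simp: lifts_def)
qed

lemma lifts_uminus: "lifts S \<gamma> l \<Longrightarrow> lifts S \<gamma> (\<lambda>t. - l t)"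
  by (auto simp: lifts_def intro: continuous_intros)

lemma lift_unique:
  assumes "connected S" "continuous_map (top_of_set S) M \<gamma>" "lifts S \<gamma> l" "lifts S \<gamma> l'"
    and "a \<in> S" "l a = l' a" "t \<in> S"
  shows "l t = l' t"
proof (rule covering_space_lift_unique[OF covering_space_outer _ _ _ _ _ _ _ _ _ assms(1,5,7)])
  have top: "\<gamma> t \<in> topspace M" if "t \<in> S" for t
    using assms(2) that by (auto simp: continuous_map_def)
  show "continuous_on S (F \<circ> \<gamma>)"
    using continuous_map_compose[OF assms(2) cont] by simp
  show "F \<circ> \<gamma> \<in> S \<rightarrow> outer ` (- {0})"
    using nonzero[OF top] by force
  show "l \<in> S \<rightarrow> - {0}" "l' \<in> S \<rightarrow> - {0}"
    using assms(3,4) outer_nonzero[OF top] by (auto simp: lifts_def)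
qed (use assms in \<open>auto simp: lifts_def\<close>)

text \<open>Any lift will do, not only one that starts at \<open>ref\<close>: the vectors over a
  point are nonzero and are exactly plus and minus \<open>ref\<close>, so negating a lift flips both
  truth values on the right.\<close>

lemma parity_lift:
  assumes "pathin M \<gamma>" "lifts {0..1} \<gamma> l"
  shows "parity \<gamma> \<longleftrightarrow> (l 0 = ref (\<gamma> 0)) \<noteq> (l 1 = ref (\<gamma> 1))"
proof -
  have path: "continuous_map (top_of_set {0..1}) M \<gamma>"
    using assms(1) by (simp add: pathin_def)
  have top: "\<gamma> t \<in> topspace M" if "t \<in> {0..1}" for t
    using path that by (auto simp: continuous_map_def)
  have nz: "ref (\<gamma> t) \<noteq> - ref (\<gamma> t)" if "t \<in> {0..1}" for t
    using outer_nonzero[OF top[OF that] outer_ref[OF top[OF that]]]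
    by (auto simp: vec_eq_iff)
  have pm: "m t = ref (\<gamma> t) \<or> m t = - ref (\<gamma> t)" if "lifts {0..1} \<gamma> m" "t \<in> {0..1}" for m t
  proof -
    have "outer (m t) = outer (ref (\<gamma> t))"
      using that outer_ref[OF top[OF that(2)]] by (simp add: lifts_def)
    then show ?thesis
      by (simp only: outer_eq_iff)
  qed
  have uniq: "m 1 = m' 1" if "lifts {0..1} \<gamma> m" "lifts {0..1} \<gamma> m'" "m 0 = m' 0" for m m'
    using lift_unique[OF _ path that(1,2), of 0 1] that by simp
  have normed: "parity \<gamma> \<longleftrightarrow> m 1 \<noteq> ref (\<gamma> 1)" if m: "lifts {0..1} \<gamma> m" "m 0 = ref (\<gamma> 0)" for m
  proof
    assume "parity \<gamma>"
    then obtain m' where m': "lifts {0..1} \<gamma> m'" "m' 0 = ref (\<gamma> 0)" "m' 1 \<noteq> ref (\<gamma> 1)"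
      by (auto simp: parity_def)
    then show "m 1 \<noteq> ref (\<gamma> 1)"
      using uniq[OF m(1) m'(1)] m(2) by simp
  next
    assume "m 1 \<noteq> ref (\<gamma> 1)"
    then show "parity \<gamma>"
      unfolding parity_def using m by blast
  qed
  show ?thesis
  proof (cases "l 0 = ref (\<gamma> 0)")
    case True
    then show ?thesis
      using normed[OF assms(2)] by simp
  next
    case False
    then have "- l 0 = ref (\<gamma> 0)"
      using pm[OF assms(2), of 0] by auto
    then have "parity \<gamma> \<longleftrightarrow> - l 1 \<noteq> ref (\<gamma> 1)"
      by (rule normed[OF lifts_uminus[OF assms(2)]])
    also have "\<dots> \<longleftrightarrow> l 1 = ref (\<gamma> 1)"
      using pm[OF assms(2), of 1] nz[of 1] by auto
    finally show ?thesis
      using False by simp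
  qed
qed

lemma parity_cong:
  assumes "\<And>t. t \<in> {0..1} \<Longrightarrow> f t = g t"
  shows "parity f = parity g"
proof -
  have "lifts {0..1} f = lifts {0..1} g"
    using assms by (auto simp: lifts_def fun_eq_iff)
  then show ?thesis
    unfolding parity_def using assms[of 0] assms[of 1] by simp
qed

text \<open>The homotopy lifts to the whole square. On the two sides where it stays at
  \<open>x\<close>, uniqueness makes the lift constant, so the lifts of \<open>f\<close> and
  \<open>g\<close> have the same ends.\<close>

lemma parity_homotopic:
  assumes "loop_homotopic M x f g"
  shows "parity f = parity g"
proof -
  obtain h :: "real \<times> real \<Rightarrow> 'm" where h: "continuous_map (prod_topology (top_of_set {0..1}) (top_of_set {0..1})) M h"
      "\<And>t. h (0, t) = f t" "\<And>t. h (1, t) = g t" "\<And>s. s \<in> {0..1} \<Longrightarrow> h (s, 0) = x \<and> h (s, 1) = x"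
    using assms by (auto simp: loop_homotopic_def homotopic_with_def)
  have "prod_topology (top_of_set {0..1}) (top_of_set {0..1}) = top_of_set ({0..1::real} \<times> {0..1::real})"
    by (simp add: subtopology_Times[symmetric] euclidean_product_topology)
  then have cont: "continuous_map (top_of_set ({0..1} \<times> {0..1})) M h"
    using h(1) by simp
  obtain l where l: "lifts ({0..1} \<times> {0..1}) h l"
    using lift_exists[OF _ cont] by (metis convex_Times convex_real_interval(5))
  have sub: "lifts T (h \<circ> r) (l \<circ> r) \<and> continuous_map (top_of_set T) M (h \<circ> r)"
    if "continuous_on T r" "r \<in> T \<rightarrow> {0..1} \<times> {0..1}" for T :: "real set" and r
  proof
    show "lifts T (h \<circ> r) (l \<circ> r)"
      by (rule lifts_compose[OF l that])
    show "continuous_map (top_of_set T) M (h \<circ> r)"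
      using that by (intro continuous_map_compose[OF _ cont]) (auto simp: continuous_map_in_subtopology)
  qed
  have const: "l (0, b) = l (1, b)" if b: "b \<in> {0,1}" for b
  proof -
    let ?r = "\<lambda>s::real. (s, b)"
    have s: "lifts {0..1} (h \<circ> ?r) (l \<circ> ?r) \<and> continuous_map (top_of_set {0..1}) M (h \<circ> ?r)"
      using b by (intro sub) (auto intro!: continuous_intros)
    have "lifts {0..1} (h \<circ> ?r) (\<lambda>_. l (0, b))"
      using l b h(4) by (auto simp: lifts_def)
    then show ?thesis
      using lift_unique[OF _ conjunct2[OF s] conjunct1[OF s], of "\<lambda>_. l (0, b)" 0 1] by simp
  qed
  have par: "parity (h \<circ> Pair s) \<longleftrightarrow> (l (s, 0) = ref x) \<noteq> (l (s, 1) = ref x)" if "s \<in> {0..1}" for s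
  proof -
    have "lifts {0..1} (h \<circ> Pair s) (l \<circ> Pair s) \<and> continuous_map (top_of_set {0..1}) M (h \<circ> Pair s)"
      using that by (intro sub) (auto intro!: continuous_intros)
    then show ?thesis
      using parity_lift[of "h \<circ> Pair s" "l \<circ> Pair s"] h(4)[OF that] by (simp add: pathin_def)
  qed
  have "h \<circ> Pair 0 = f" "h \<circ> Pair 1 = g"
    using h by auto
  then show ?thesis
    using par[of 0] par[of 1] const[of 0] const[of 1] by simp
qed

lemma parity_path_concat:
  assumes "pathin M f" "pathin M g" "f 1 = g 0"
  shows "parity (path_concat f g) \<longleftrightarrow> parity f \<noteq> parity g"
proof -
  obtain lf lg where lf: "lifts {0..1} f lf" and lg: "lifts {0..1} g lg"
    using lift_exists assms(1,2) unfolding pathin_def by (metis convex_real_interval(5))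
  have "f 1 \<in> topspace M"
    using assms(1) by (auto simp: pathin_def continuous_map_def)
  have "outer (lf 1) = outer (lg 0)"
    using lf lg assms(3) by (simp add: lifts_def)
  \<comment> \<open>The two vectors agree up to sign; negating the second lift if necessary makes it
    start where the first one ends.\<close>
  then obtain lg where lg: "lifts {0..1} g lg" "lf 1 = lg 0"
    using lg lifts_uminus[OF lg] by (metis outer_eq_iff)
  define l where "l = path_concat lf lg"
  have l: "l = lf +++ lg"
    by (auto simp: l_def path_concat_def joinpaths_def)
  have lift: "lifts {0..1} (path_concat f g) l"
    unfolding lifts_def
  proof
    show "continuous_on {0..1} l"
      unfolding l using lf lg by (simp flip: path_def add: lifts_def pathfinish_def pathstart_def)
    show "\<forall>t\<in>{0..1}. outer (l t) = F (path_concat f g t)"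
      using lf lg by (auto simp: l_def path_concat_def lifts_def)
  qed
  moreover have "pathin M (path_concat f g)"
    by (rule pathin_path_concat[OF assms])
  ultimately show ?thesis
    using parity_lift[of "path_concat f g" l] parity_lift[OF assms(1) lf] parity_lift[OF assms(2) lg(1)]
      assms(3) lg(2) by (auto simp: l_def path_concat_def)
qed

end

section \<open>The fundamental group\<close>

lemma loop_homotopic_sym: "loop_homotopic X x f g \<Longrightarrow> loop_homotopic X x g f"
  unfolding loop_homotopic_def by (rule homotopic_with_symD)

lemma loop_homotopic_trans:
  "loop_homotopic X x f g \<Longrightarrow> loop_homotopic X x g h \<Longrightarrow> loop_homotopic X x f h"
  unfolding loop_homotopic_def by (rule homotopic_with_trans)

lemma loop_homotopic_refl: "loop_at X x f \<Longrightarrow> loop_homotopic X x f f"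
  by (simp add: loop_homotopic_def loop_at_def pathin_def)

text \<open>The homotopy is the straight line between the two parameter changes. Associativity, left
  unit and left inverse of the fundamental group are all instances.\<close>

lemma loop_homotopic_reparametrize:
  assumes "pathin X f" "continuous_on {0..1} \<phi>" "continuous_on {0..1} \<psi>"
    and "\<phi> \<in> {0..1} \<rightarrow> {0..1}" "\<psi> \<in> {0..1} \<rightarrow> {0..1::real}"
    and "\<phi> 0 = \<psi> 0" "\<phi> 1 = \<psi> 1" "f (\<phi> 0) = x" "f (\<phi> 1) = x"
  shows "loop_homotopic X x (f \<circ> \<phi>) (f \<circ> \<psi>)"
  unfolding loop_homotopic_def homotopic_with_def
proof (intro exI conjI allI ballI)
  let ?r = "\<lambda>(s, t). (1 - s) * \<phi> t + s * \<psi> t"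
  have prod: "prod_topology (top_of_set {0..1}) (top_of_set {0..1}) = top_of_set ({0..1::real} \<times> {0..1::real})"
    by (simp add: subtopology_Times[symmetric] euclidean_product_topology)
  show "continuous_map (prod_topology (top_of_set {0..1}) (top_of_set {0..1})) X (f \<circ> ?r)"
  proof (rule continuous_map_compose)
    show "continuous_map (top_of_set {0..1}) X f"
      using assms(1) by (simp add: pathin_def)
    have "continuous_on ({0..1} \<times> {0..1}) ?r"
      unfolding case_prod_beta
      by (intro continuous_intros continuous_on_compose2[OF assms(2) continuous_on_snd]
          continuous_on_compose2[OF assms(3) continuous_on_snd]) auto
    moreover have "?r \<in> {0..1} \<times> {0..1} \<rightarrow> {0..1}"
    proof
      fix z :: "real \<times> real" assume "z \<in> {0..1} \<times> {0..1}"
      then obtain s t where z: "z = (s, t)" "s \<in> {0..1}" "t \<in> {0..1}"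
        by auto
      have "\<phi> t \<in> {0..1}" "\<psi> t \<in> {0..1}"
        using assms(4,5) z by auto
      then show "?r z \<in> {0..1}"
        using z convexD[OF convex_real_interval(5), of "\<phi> t" 0 1 "\<psi> t" "1 - s" s] by simp
    qed
    ultimately show "continuous_map (prod_topology (top_of_set {0..1}) (top_of_set {0..1})) (top_of_set {0..1}) ?r"
      unfolding prod by (simp add: continuous_map_in_subtopology image_subset_iff_funcset)
  qed
  show "(f \<circ> ?r) (s, 0) = x" "(f \<circ> ?r) (s, 1) = x" for s
    using assms(6-9) by (simp_all add: algebra_simps)
qed auto

lemma loop_homotopic_path_concat:
  assumes "loop_homotopic X x f f'" "loop_homotopic X x g g'"
  shows "loop_homotopic X x (path_concat f g) (path_concat f' g')"
proof -
  let ?I = "top_of_set {0..1::real}"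
  obtain h :: "real \<times> real \<Rightarrow> 'a" where h: "continuous_map (prod_topology ?I ?I) X h"
      "\<And>t. h (0, t) = f t" "\<And>t. h (1, t) = f' t" "\<And>s. s \<in> {0..1} \<Longrightarrow> h (s, 0) = x \<and> h (s, 1) = x"
    using assms(1) by (auto simp: loop_homotopic_def homotopic_with_def)
  obtain k :: "real \<times> real \<Rightarrow> 'a" where k: "continuous_map (prod_topology ?I ?I) X k"
      "\<And>t. k (0, t) = g t" "\<And>t. k (1, t) = g' t" "\<And>s. s \<in> {0..1} \<Longrightarrow> k (s, 0) = x \<and> k (s, 1) = x"
    using assms(2) by (auto simp: loop_homotopic_def homotopic_with_def)
  have prod: "prod_topology ?I ?I = top_of_set ({0..1::real} \<times> {0..1::real})"
    by (simp add: subtopology_Times[symmetric] euclidean_product_topology)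
  let ?h = "\<lambda>z. (h \<circ> (\<lambda>z. (fst z, 2 * snd z))) z" and ?k = "\<lambda>z. (k \<circ> (\<lambda>z. (fst z, 2 * snd z - 1))) z"
  let ?H = "\<lambda>z. if snd z \<le> 1 / 2 then ?h z else ?k z"
  show ?thesis
    unfolding loop_homotopic_def homotopic_with_def
  proof (intro exI[of _ ?H] conjI allI ballI)
    show "continuous_map (prod_topology ?I ?I) X ?H"
      unfolding prod
    proof (rule continuous_map_cases_le)
      show "continuous_map (subtopology (top_of_set ({0..1} \<times> {0..1}))
          {z \<in> topspace (top_of_set ({0..1} \<times> {0..1})). snd z \<le> 1 / 2}) X ?h"
        using h(1) unfolding prod
        by (rule continuous_map_compose[rotated])
          (auto simp: continuous_map_in_subtopology subtopology_subtopology intro!: continuous_intros)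
      show "continuous_map (subtopology (top_of_set ({0..1} \<times> {0..1}))
          {z \<in> topspace (top_of_set ({0..1} \<times> {0..1})). 1 / 2 \<le> snd z}) X ?k"
        using k(1) unfolding prod
        by (rule continuous_map_compose[rotated])
          (auto simp: continuous_map_in_subtopology subtopology_subtopology intro!: continuous_intros)
      show "?h z = ?k z" if "z \<in> topspace (top_of_set ({0..1} \<times> {0..1}))" "snd z = 1 / 2" for z
        unfolding comp_apply that(2) using that(1) h(4)[of "fst z"] k(4)[of "fst z"] by auto
    qed (auto intro!: continuous_intros)
  qed (use h k in \<open>auto simp: path_concat_def\<close>)
qed

lemma loop_at_path_concat: "loop_at X x f \<Longrightarrow> loop_at X x g \<Longrightarrow> loop_at X x (path_concat f g)"
  by (simp add: loop_at_def pathin_path_concat) (simp add: path_concat_def)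

lemma loop_class_eq_iff:
  assumes "loop_at X x f" "loop_at X x g"
  shows "loop_class X x f = loop_class X x g \<longleftrightarrow> loop_homotopic X x f g"
proof
  assume "loop_class X x f = loop_class X x g"
  moreover have "g \<in> loop_class X x g"
    using assms(2) by (simp add: loop_class_def loop_homotopic_refl)
  ultimately show "loop_homotopic X x f g"
    by (auto simp: loop_class_def)
next
  assume fg: "loop_homotopic X x f g"
  then have "loop_homotopic X x f h \<longleftrightarrow> loop_homotopic X x g h" for h
    using loop_homotopic_trans[OF fg] loop_homotopic_trans[OF loop_homotopic_sym[OF fg]] by metis
  then show "loop_class X x f = loop_class X x g"
    by (simp add: loop_class_def)
qed

lemma mult_fundamental_group:
  assumes "loop_at X x f" "loop_at X x g"
  shows "loop_class X x f \<otimes>\<^bsub>fundamental_group X x\<^esub> loop_class X x g = loop_class X x (path_concat f g)"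
proof -
  have "(\<exists>f'\<in>loop_class X x f. \<exists>g'\<in>loop_class X x g. loop_homotopic X x (path_concat f' g') h)
    \<longleftrightarrow> loop_homotopic X x (path_concat f g) h" (is "?L \<longleftrightarrow> ?R") for h
  proof
    assume ?L
    then obtain f' g' where "loop_homotopic X x f f'" "loop_homotopic X x g g'"
        "loop_homotopic X x (path_concat f' g') h"
      by (auto simp: loop_class_def)
    then show ?R
      using loop_homotopic_trans[OF loop_homotopic_path_concat] by metis
  next
    assume ?R
    moreover have "f \<in> loop_class X x f" "g \<in> loop_class X x g"
      using assms by (simp_all add: loop_class_def loop_homotopic_refl)
    ultimately show ?L
      by blast
  qed
  then show ?thesis
    unfolding fundamental_group_def by (simp add: loop_class_def)
qed

lemma carrier_fundamental_group: "carrier (fundamental_group X x) = {loop_class X x g | g. loop_at X x g}"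
  and one_fundamental_group: "\<one>\<^bsub>fundamental_group X x\<^esub> = loop_class X x (\<lambda>_. x)"
  by (simp_all add: fundamental_group_def)

lemma group_fundamental_group:
  assumes "x \<in> topspace X"
  shows "group (fundamental_group X x)"
proof (rule groupI)
  let ?G = "fundamental_group X x"
  have const: "loop_at X x (\<lambda>_. x)"
    using assms by (simp add: loop_at_def pathin_def)
  show "\<one>\<^bsub>?G\<^esub> \<in> carrier ?G"
    using const by (auto simp: carrier_fundamental_group one_fundamental_group)
  show "A \<otimes>\<^bsub>?G\<^esub> B \<in> carrier ?G" if "A \<in> carrier ?G" "B \<in> carrier ?G" for A B
  proof -
    obtain f g where "loop_at X x f" "A = loop_class X x f" "loop_at X x g" "B = loop_class X x g"
      using \<open>A \<in> carrier ?G\<close> \<open>B \<in> carrier ?G\<close> by (auto simp: carrier_fundamental_group)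
    then show ?thesis
      using loop_at_path_concat mult_fundamental_group by (fastforce simp: carrier_fundamental_group)
  qed
  show "A \<otimes>\<^bsub>?G\<^esub> B \<otimes>\<^bsub>?G\<^esub> C = A \<otimes>\<^bsub>?G\<^esub> (B \<otimes>\<^bsub>?G\<^esub> C)"
    if ABC: "A \<in> carrier ?G" "B \<in> carrier ?G" "C \<in> carrier ?G" for A B C
  proof -
    obtain f g h where A: "loop_at X x f" "A = loop_class X x f"
      and B: "loop_at X x g" "B = loop_class X x g" and C: "loop_at X x h" "C = loop_class X x h"
      using ABC by (auto simp: carrier_fundamental_group)
    \<comment> \<open>Piecewise linear, taking the intervals [0, 1/4], [1/4, 1/2] and [1/2, 1] to
      [0, 1/2], [1/2, 3/4] and [3/4, 1].\<close>
    define \<phi> where "\<phi> t = (if t \<le> 1/2 then min (2 * t) (t + 1/4) else t / 2 + 1 / 2)" for t :: real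
    have gh: "loop_at X x (path_concat g h)" "loop_at X x (path_concat f (path_concat g h))"
      "loop_at X x (path_concat f g)" "loop_at X x (path_concat (path_concat f g) h)"
      using A B C by (auto intro: loop_at_path_concat)
    have "path_concat (path_concat f g) h t = path_concat f (path_concat g h) (\<phi> t)" for t
    proof -
      consider "t \<le> 1/4" | "1/4 < t" "t \<le> 1/2" | "1/2 < t"
        by linarith
      then show ?thesis
        by cases (simp_all add: path_concat_def \<phi>_def min_def algebra_simps)
    qed
    then have "path_concat (path_concat f g) h = path_concat f (path_concat g h) \<circ> \<phi>"
      by (simp add: fun_eq_iff)
    moreover have "loop_homotopic X x (path_concat f (path_concat g h) \<circ> \<phi>) (path_concat f (path_concat g h) \<circ> (\<lambda>t. t))"
    proof (rule loop_homotopic_reparametrize)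
      show "continuous_on {0..1} \<phi>"
        unfolding \<phi>_def by (rule continuous_on_cases_le) (auto intro!: continuous_intros)
    qed (use gh in \<open>auto simp: \<phi>_def loop_at_def\<close>)
    ultimately show ?thesis
      using A B C gh by (simp add: mult_fundamental_group loop_class_eq_iff o_def)
  qed
  show "\<one>\<^bsub>?G\<^esub> \<otimes>\<^bsub>?G\<^esub> A = A" if A_in: "A \<in> carrier ?G" for A
  proof -
    obtain f where A: "loop_at X x f" "A = loop_class X x f"
      using A_in by (auto simp: carrier_fundamental_group)
    have "path_concat (\<lambda>_. x) f t = f (max 0 (2 * t - 1))" for t
      using A by (cases "t \<le> 1/2") (simp_all add: path_concat_def loop_at_def max_absorb1 max_absorb2)
    then have "path_concat (\<lambda>_. x) f = f \<circ> (\<lambda>t. max 0 (2 * t - 1))"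
      by (simp add: fun_eq_iff)
    moreover have "loop_homotopic X x (f \<circ> (\<lambda>t. max 0 (2 * t - 1))) (f \<circ> (\<lambda>t. t))"
      by (rule loop_homotopic_reparametrize) (use A in \<open>auto simp: loop_at_def intro!: continuous_intros\<close>)
    moreover have "f \<circ> (\<lambda>t. t) = f"
      by auto
    ultimately have "loop_homotopic X x (path_concat (\<lambda>_. x) f) f"
      by simp
    then show ?thesis
      using loop_class_eq_iff[OF loop_at_path_concat[OF const A(1)] A(1)] mult_fundamental_group[OF const A(1)]
      by (simp add: A(2) one_fundamental_group)
  qed
  show "\<exists>B\<in>carrier ?G. B \<otimes>\<^bsub>?G\<^esub> A = \<one>\<^bsub>?G\<^esub>" if A_in: "A \<in> carrier ?G" for A
  proof -
    obtain f where A: "loop_at X x f" "A = loop_class X x f"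
      using A_in by (auto simp: carrier_fundamental_group)
    define g where "g = f \<circ> (\<lambda>t. 1 - t)"
    have g: "loop_at X x g"
    proof -
      have "continuous_map (top_of_set {0..1}) (top_of_set {0..1}) (\<lambda>t::real. 1 - t)"
        by (auto simp: continuous_map_in_subtopology intro!: continuous_intros)
      from continuous_map_compose[OF this, of X f] show ?thesis
        using A by (simp add: loop_at_def g_def pathin_def)
    qed
    \<comment> \<open>The reversed loop followed by the loop is \<open>f\<close> along a parameter
      that runs from 1 to 0 and back, which contracts to the constant parameter 1.\<close>
    have "path_concat g f t = f \<bar>1 - 2 * t\<bar>" for t
      by (auto simp: path_concat_def g_def abs_if)
    then have "path_concat g f = f \<circ> (\<lambda>t. \<bar>1 - 2 * t\<bar>)"
      by (simp add: fun_eq_iff)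
    moreover have "loop_homotopic X x (f \<circ> (\<lambda>t. \<bar>1 - 2 * t\<bar>)) (f \<circ> (\<lambda>t. 1))"
      by (rule loop_homotopic_reparametrize) (use A in \<open>auto simp: loop_at_def intro!: continuous_intros\<close>)
    moreover have "f \<circ> (\<lambda>t::real. 1) = (\<lambda>_. x)"
      using A by (auto simp: loop_at_def)
    ultimately have "loop_homotopic X x (path_concat g f) (\<lambda>_. x)"
      by (simp only:)
    then have "loop_class X x g \<otimes>\<^bsub>?G\<^esub> A = \<one>\<^bsub>?G\<^esub>"
      using loop_class_eq_iff[OF loop_at_path_concat[OF g A(1)] const] mult_fundamental_group[OF g A(1)]
      by (simp add: A(2) one_fundamental_group)
    then show ?thesis
      using g by (auto simp: carrier_fundamental_group)
  qed
qed

text \<open>On a cyclic group a homomorphism to \<int>/2 is determined by its value at the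
  generator, so two nonzero ones coincide; the elements \<open>a\<close> and \<open>b\<close> show
  that \<open>c\<close> and \<open>d\<close> are nonzero and distinct.\<close>

lemma (in group) not_cyclic_group_of_two_parities:
  assumes c: "\<And>x y. x \<in> carrier G \<Longrightarrow> y \<in> carrier G \<Longrightarrow> c (x \<otimes> y) \<longleftrightarrow> c x \<noteq> c y"
    and d: "\<And>x y. x \<in> carrier G \<Longrightarrow> y \<in> carrier G \<Longrightarrow> d (x \<otimes> y) \<longleftrightarrow> d x \<noteq> d y"
    and "a \<in> carrier G" "c a" "\<not> d a" "b \<in> carrier G" "\<not> c b" "d b"
  shows "\<not> cyclic_group G"
proof
  assume "cyclic_group G"
  then obtain g where g: "g \<in> carrier G" "subgroup_generated G {g} = G"
    by (auto simp: cyclic_group_def)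
  have one: "\<not> c \<one>" "\<not> d \<one>"
    using c[OF one_closed one_closed] d[OF one_closed one_closed] by simp_all
  then have inv: "c (inv g) = c g" "d (inv g) = d g"
    using c[OF g(1) inv_closed[OF g(1)]] d[OF g(1) inv_closed[OF g(1)]] g(1) by simp_all
  \<comment> \<open>The conjunction of implications says that the pair of values of \<open>c\<close>
    and \<open>d\<close> at \<open>h\<close> is either (False, False) or the pair at
    \<open>g\<close>.\<close>
  have gen: "h \<in> carrier G \<and> (c h \<and> d h \<longleftrightarrow> c h \<and> c g \<and> d g) \<and> (d h \<longrightarrow> d g) \<and> (c h \<longrightarrow> c g) \<and> (d h \<and> c g \<longrightarrow> c h)"
    if "h \<in> generate G {g}" for h
    using that
  proof induction
    case (eng h1 h2)
    then have carr: "h1 \<in> carrier G" "h2 \<in> carrier G"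
      by simp_all
    show ?case
      using eng.IH unfolding c[OF carr] d[OF carr] using carr by blast
  qed (use g(1) one inv in simp_all)
  have "carrier G = generate G {g}"
    using arg_cong[OF g(2), of carrier] g(1) by (simp add: carrier_subgroup_generated)
  then show False
    using gen[of a] gen[of b] assms(3-) by blast
qed

context line_field
begin

text \<open>Elements of the fundamental group are sets of loops; the existential quantifier reads
  off the parity that all members share.\<close>

lemma parity_loop_class:
  assumes "loop_at M x f"
  shows "(\<exists>g\<in>loop_class M x f. parity g) \<longleftrightarrow> parity f"
proof -
  have "f \<in> loop_class M x f"
    using assms by (simp add: loop_class_def loop_homotopic_refl)
  moreover have "parity g = parity f" if "g \<in> loop_class M x f" for g
    using that parity_homotopic[of x f g] by (simp add: loop_class_def)
  ultimately show ?thesis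
    by blast
qed

lemma parity_mult:
  assumes "A \<in> carrier (fundamental_group M x)" "B \<in> carrier (fundamental_group M x)"
  shows "(\<exists>h \<in> A \<otimes>\<^bsub>fundamental_group M x\<^esub> B. parity h) \<longleftrightarrow> (\<exists>f\<in>A. parity f) \<noteq> (\<exists>g\<in>B. parity g)"
proof -
  obtain f g where fg: "loop_at M x f" "A = loop_class M x f" "loop_at M x g" "B = loop_class M x g"
    using assms by (auto simp: carrier_fundamental_group)
  then have "parity (path_concat f g) \<longleftrightarrow> parity f \<noteq> parity g"
    by (intro parity_path_concat) (auto simp: loop_at_def)
  with fg show ?thesis
    by (simp add: mult_fundamental_group parity_loop_class loop_at_path_concat)
qed

end

lemma not_cyclic_fundamental_group:
  assumes "line_field M F" "line_field M F'" "loop_at M x f" "loop_at M x g"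
    and "line_field.parity F f" "\<not> line_field.parity F' f" "\<not> line_field.parity F g" "line_field.parity F' g"
  shows "\<not> cyclic_group (fundamental_group M x)"
proof -
  interpret F: line_field M F by fact
  interpret F': line_field M F' by fact
  have "x \<in> topspace M"
    using assms(3) by (auto simp: loop_at_def pathin_def continuous_map_def)
  then interpret group "fundamental_group M x"
    by (rule group_fundamental_group)
  show ?thesis
  proof (rule not_cyclic_group_of_two_parities[where c = "\<lambda>A. \<exists>h\<in>A. F.parity h"
        and d = "\<lambda>A. \<exists>h\<in>A. F'.parity h" and a = "loop_class M x f" and b = "loop_class M x g"])
    show "loop_class M x f \<in> carrier (fundamental_group M x)" "loop_class M x g \<in> carrier (fundamental_group M x)"
      using assms(3,4) by (auto simp: carrier_fundamental_group)
    show "\<exists>h\<in>loop_class M x f. F.parity h" "\<not> (\<exists>h\<in>loop_class M x f. F'.parity h)"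
      "\<not> (\<exists>h\<in>loop_class M x g. F.parity h)" "\<exists>h\<in>loop_class M x g. F'.parity h"
      unfolding F.parity_loop_class[OF assms(3)] F'.parity_loop_class[OF assms(3)]
        F.parity_loop_class[OF assms(4)] F'.parity_loop_class[OF assms(4)] by fact+
  qed (rule F.parity_mult F'.parity_mult; assumption)+
qed

section \<open>Homology modulo two\<close>

text \<open>Standard simplices consist of functions on \<open>nat\<close>, while
  \<open>lifts\<close> expects parameters in a normed space. Hence edges and triangles are
  parametrized by [0, 1] and by a triangle in the plane.\<close>

definition segment_point :: "real \<Rightarrow> nat \<Rightarrow> real" where
  "segment_point t = (\<lambda>i. if i = 0 then 1 - t else if i = 1 then t else 0)"

definition triangle_point :: "real \<times> real \<Rightarrow> nat \<Rightarrow> real" where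
  "triangle_point z = (\<lambda>i. if i = 0 then 1 - fst z - snd z else if i = 1 then fst z else if i = 2 then snd z else 0)"

definition triangle :: "(real \<times> real) set" where
  "triangle = {z. 0 \<le> fst z \<and> 0 \<le> snd z \<and> fst z + snd z \<le> 1}"

text \<open>The coordinate with index 1 serves as the path parameter; the restriction provides the
  extensionality demanded of singular simplices.\<close>

definition path_simplex :: "(real \<Rightarrow> 'm) \<Rightarrow> (nat \<Rightarrow> real) \<Rightarrow> 'm" where
  "path_simplex \<gamma> = restrict (\<lambda>z. \<gamma> (z 1)) (standard_simplex 1)"

lemma continuous_map_powertop_realI:
  assumes "\<And>i. continuous_on S (\<lambda>z. f z i)" "f \<in> S \<rightarrow> T"
  shows "continuous_map (top_of_set S) (subtopology (powertop_real UNIV) T) f"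
  using assms by (auto simp: continuous_map_in_subtopology continuous_map_componentwise_UNIV)

lemma segment_point_in: "t \<in> {0..1} \<Longrightarrow> segment_point t \<in> standard_simplex 1"
  by (auto simp: segment_point_def standard_simplex_def)

lemma triangle_point_in: "z \<in> triangle \<Longrightarrow> triangle_point z \<in> standard_simplex 2"
  by (auto simp: triangle_point_def triangle_def standard_simplex_def numeral_2_eq_2)

lemma convex_triangle: "convex triangle"
proof -
  have "triangle = {z. 0 \<le> (1, 0) \<bullet> z} \<inter> {z. 0 \<le> (0, 1) \<bullet> z} \<inter> {z. (1, 1) \<bullet> z \<le> 1}"
    by (auto simp: triangle_def inner_prod_def)
  moreover have "convex \<dots>"
    by (intro convex_Int convex_halfspace_le convex_halfspace_ge)
  ultimately show ?thesis
    by simp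
qed

lemma continuous_map_triangle_point:
  assumes "singular_simplex 2 X f"
  shows "continuous_map (top_of_set triangle) X (f \<circ> triangle_point)"
proof (rule continuous_map_compose)
  show "continuous_map (top_of_set triangle) (subtopology (powertop_real UNIV) (standard_simplex 2)) triangle_point"
  proof (rule continuous_map_powertop_realI)
    show "continuous_on triangle (\<lambda>z. triangle_point z i)" for i
      by (cases "i = 0"; cases "i = 1"; cases "i = 2") (auto simp: triangle_point_def intro!: continuous_intros)
  qed (use triangle_point_in in auto)
qed (use assms in \<open>simp add: singular_simplex_def\<close>)

lemma singular_simplex_path_simplex:
  assumes "pathin X \<gamma>"
  shows "singular_simplex 1 X (path_simplex \<gamma>)"
proof -
  have "continuous_map (subtopology (powertop_real UNIV) (standard_simplex 1)) (top_of_set {0..1}) (\<lambda>z. z 1)"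
    by (auto simp: continuous_map_in_subtopology standard_simplex_def
        intro!: continuous_map_from_subtopology continuous_map_product_projection)
  then have "continuous_map (subtopology (powertop_real UNIV) (standard_simplex 1)) X (\<gamma> \<circ> (\<lambda>z. z 1))"
    using assms unfolding pathin_def by (rule continuous_map_compose)
  then have "continuous_map (subtopology (powertop_real UNIV) (standard_simplex 1)) X (path_simplex \<gamma>)"
    by (rule continuous_map_eq) (auto simp: path_simplex_def)
  then show ?thesis
    by (simp add: singular_simplex_def path_simplex_def)
qed

lemma chain_boundary_path_simplex:
  assumes "\<gamma> 0 = \<gamma> 1"
  shows "chain_boundary 1 (frag_of (path_simplex \<gamma>)) = 0"
proof -
  have "\<gamma> (z 0) = \<gamma> 1" if "z \<in> standard_simplex 0" for z
    using that by (simp add: standard_simplex_def)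
  then have "singular_face 1 0 (path_simplex \<gamma>) = singular_face 1 1 (path_simplex \<gamma>)"
    using assms simplical_face_in_standard_simplex[of 1 0] simplical_face_in_standard_simplex[of 1 1]
    by (auto simp: singular_face_def path_simplex_def simplical_face_def fun_eq_iff restrict_def)
  then show ?thesis
    by (simp add: chain_boundary_of)
qed

lemma path_simplex_segment: "t \<in> {0..1} \<Longrightarrow> (path_simplex \<gamma> \<circ> segment_point) t = \<gamma> t"
  using segment_point_in[of t] by (simp add: path_simplex_def) (simp add: segment_point_def)

text \<open>Face \<open>i\<close> omits vertex \<open>i\<close> and keeps the order of the others,
  which fixes the directions in which the three sides are traversed.\<close>

lemma singular_face_segment:
  assumes "t \<in> {0..1}"
  shows "(singular_face 2 0 f \<circ> segment_point) t = (f \<circ> triangle_point) (1 - t, t)"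
    and "(singular_face 2 1 f \<circ> segment_point) t = (f \<circ> triangle_point) (0, t)"
    and "(singular_face 2 2 f \<circ> segment_point) t = (f \<circ> triangle_point) (t, 0)"
proof -
  have "simplical_face 0 (segment_point t) = triangle_point (1 - t, t)"
    "simplical_face 1 (segment_point t) = triangle_point (0, t)"
    "simplical_face 2 (segment_point t) = triangle_point (t, 0)"
    by (auto simp: simplical_face_def segment_point_def triangle_point_def fun_eq_iff)
  then show "(singular_face 2 0 f \<circ> segment_point) t = (f \<circ> triangle_point) (1 - t, t)"
    "(singular_face 2 1 f \<circ> segment_point) t = (f \<circ> triangle_point) (0, t)"
    "(singular_face 2 2 f \<circ> segment_point) t = (f \<circ> triangle_point) (t, 0)"
    using segment_point_in[OF assms] by (simp_all add: singular_face_def)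
qed

context line_field
begin

text \<open>The singular 1-cochain given by the parity of edges, extended to integral chains. The
  extension takes values in the free abelian group on one element, and \<open>lookup\<close> at that
  element turns them into integers. Only the weight modulo two is meaningful.\<close>

definition chain_weight :: "'m chain \<Rightarrow> int" where
  "chain_weight c = Poly_Mapping.lookup
     (frag_extend (\<lambda>f. frag_cmul (of_bool (parity (f \<circ> segment_point))) (frag_of ())) c) ()"

lemma chain_weight_simps [simp]:
  "chain_weight 0 = 0"
  "chain_weight (a + b) = chain_weight a + chain_weight b"
  "chain_weight (a - b) = chain_weight a - chain_weight b"
  "chain_weight (frag_cmul k a) = k * chain_weight a"
  "chain_weight (frag_of f) = of_bool (parity (f \<circ> segment_point))"
  by (simp_all add: chain_weight_def frag_extend_add frag_extend_diff frag_extend_cmul lookup_add lookup_minus)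

lemma chain_weight_path_simplex: "chain_weight (frag_of (path_simplex \<gamma>)) = of_bool (parity \<gamma>)"
  using parity_cong[of "path_simplex \<gamma> \<circ> segment_point" \<gamma>, OF path_simplex_segment] by simp

text \<open>The cocycle condition: a lift over the whole triangle gives each corner one truth value
  \<open>s\<close>, the parity of a side compares the values at its ends, and around the triangle
  every corner is compared twice.\<close>

lemma even_chain_weight_boundary_simplex:
  assumes "singular_simplex 2 M f"
  shows "even (chain_weight (chain_boundary 2 (frag_of f)))"
proof -
  let ?g = "f \<circ> triangle_point"
  have cont: "continuous_map (top_of_set triangle) M ?g"
    by (rule continuous_map_triangle_point[OF assms])
  then obtain l where l: "lifts triangle ?g l"
    using lift_exists[OF convex_triangle] by blast
  define s where "s z \<longleftrightarrow> l z = ref (?g z)" for z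
  have face: "parity h \<longleftrightarrow> s (r 0) \<noteq> s (r 1)"
    if r: "continuous_on {0..1} r" "r \<in> {0..1} \<rightarrow> triangle" and h: "\<And>t. t \<in> {0..1} \<Longrightarrow> h t = ?g (r t)"
    for r :: "real \<Rightarrow> real \<times> real" and h
  proof -
    have "pathin M (?g \<circ> r)"
      unfolding pathin_def using r
      by (intro continuous_map_compose[OF _ cont]) (auto simp: continuous_map_in_subtopology)
    then have "parity (?g \<circ> r) \<longleftrightarrow> s (r 0) \<noteq> s (r 1)"
      using parity_lift[OF _ lifts_compose[OF l r]] by (simp add: s_def)
    then show ?thesis
      using parity_cong[of h "?g \<circ> r"] h by simp
  qed
  have "parity (singular_face 2 0 f \<circ> segment_point) \<longleftrightarrow> s (1, 0) \<noteq> s (0, 1)"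
    using face[of "\<lambda>t. (1 - t, t)" "singular_face 2 0 f \<circ> segment_point", OF _ _ singular_face_segment(1)]
    by (simp add: triangle_def continuous_on_Pair continuous_on_diff continuous_on_id)
  moreover have "parity (singular_face 2 1 f \<circ> segment_point) \<longleftrightarrow> s (0, 0) \<noteq> s (0, 1)"
    using face[of "\<lambda>t. (0, t)" "singular_face 2 1 f \<circ> segment_point", OF _ _ singular_face_segment(2)]
    by (simp add: triangle_def continuous_on_Pair continuous_on_diff continuous_on_id)
  moreover have "parity (singular_face 2 2 f \<circ> segment_point) \<longleftrightarrow> s (0, 0) \<noteq> s (1, 0)"
    using face[of "\<lambda>t. (t, 0)" "singular_face 2 2 f \<circ> segment_point", OF _ _ singular_face_segment(3)]
    by (simp add: triangle_def continuous_on_Pair continuous_on_diff continuous_on_id)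
  moreover have "chain_boundary 2 (frag_of f) = frag_of (singular_face 2 0 f)
      - frag_of (singular_face 2 1 f) + frag_of (singular_face 2 2 f)"
    by (simp add: chain_boundary_of numeral_2_eq_2)
  ultimately show ?thesis
    by simp
qed

lemma even_chain_weight_boundary:
  assumes "c \<in> mod2_boundaries 1 M"
  shows "even (chain_weight c)"
proof -
  obtain e d where c: "c = chain_boundary (Suc 1) e + frag_cmul 2 d" and e: "singular_chain (Suc 1) M e"
    using assms by (auto simp: mod2_boundaries_def)
  have "even (chain_weight (chain_boundary 2 e))"
  proof (rule frag_induction[of e "singular_simplex_set 2 M"])
    show "Poly_Mapping.keys e \<subseteq> singular_simplex_set 2 M"
      using e by (simp add: singular_chain_def numeral_2_eq_2)
  qed (use even_chain_weight_boundary_simplex in \<open>auto simp: chain_boundary_diff\<close>)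
  then show ?thesis
    by (simp add: c numeral_2_eq_2)
qed

end

section \<open>Cycles and boundaries modulo two\<close>

lemma frag_cmul_uminus: "frag_cmul k (- a) = - frag_cmul k a"
  by (simp flip: frag_cmul_minus_one)

lemma subgroup_mod2_cycles: "subgroup (mod2_cycles p X) (chain_group p X)"
proof
  show "mod2_cycles p X \<subseteq> carrier (chain_group p X)"
    by (auto simp: mod2_cycles_def)
  show "x \<otimes>\<^bsub>chain_group p X\<^esub> y \<in> mod2_cycles p X"
    if xy: "x \<in> mod2_cycles p X" "y \<in> mod2_cycles p X" for x y
  proof -
    obtain d e where "chain_boundary p x = frag_cmul 2 d" "chain_boundary p y = frag_cmul 2 e"
      using xy by (auto simp: mod2_cycles_def)
    then have "chain_boundary p (x + y) = frag_cmul 2 (d + e)"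
      by (simp add: chain_boundary_add frag_cmul_distrib2)
    then show ?thesis
      using xy by (auto simp: mod2_cycles_def singular_chain_add)
  qed
  show "\<one>\<^bsub>chain_group p X\<^esub> \<in> mod2_cycles p X"
    by (auto simp: mod2_cycles_def singular_chain_0 intro: exI[of _ 0])
  show "inv\<^bsub>chain_group p X\<^esub> x \<in> mod2_cycles p X" if x: "x \<in> mod2_cycles p X" for x
  proof -
    obtain d where "chain_boundary p x = frag_cmul 2 d"
      using x by (auto simp: mod2_cycles_def)
    then have "chain_boundary p (- x) = frag_cmul 2 (- d)"
      by (simp add: chain_boundary_minus frag_cmul_uminus)
    moreover have "Poly_Mapping.keys x \<subseteq> singular_simplex_set p X"
      using x by (simp add: mod2_cycles_def singular_chain_def)
    ultimately show ?thesis
      using x by (auto simp: mod2_cycles_def singular_chain_minus)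
  qed
qed

lemma mod2_boundaries_subset_cycles: "mod2_boundaries p X \<subseteq> mod2_cycles p X"
proof
  fix c assume "c \<in> mod2_boundaries p X"
  then obtain e d where c: "c = chain_boundary (Suc p) e + frag_cmul 2 d"
    "singular_chain (Suc p) X e" "singular_chain p X d"
    by (auto simp: mod2_boundaries_def)
  moreover have "chain_boundary p c = frag_cmul 2 (chain_boundary p d)"
    using chain_boundary_boundary_alt[OF c(2)] by (simp add: c chain_boundary_add chain_boundary_cmul)
  ultimately show "c \<in> mod2_cycles p X"
    by (auto simp: mod2_cycles_def singular_chain_add singular_chain_cmul singular_chain_boundary_alt)
qed

lemma subgroup_mod2_boundaries: "subgroup (mod2_boundaries p X) (chain_group p X)"
proof
  show "mod2_boundaries p X \<subseteq> carrier (chain_group p X)"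
    using mod2_boundaries_subset_cycles by (force simp: mod2_cycles_def)
  show "x \<otimes>\<^bsub>chain_group p X\<^esub> y \<in> mod2_boundaries p X"
    if xy: "x \<in> mod2_boundaries p X" "y \<in> mod2_boundaries p X" for x y
  proof -
    obtain e d e' d' where "x = chain_boundary (Suc p) e + frag_cmul 2 d" "y = chain_boundary (Suc p) e' + frag_cmul 2 d'"
      and sing: "singular_chain (Suc p) X e" "singular_chain p X d" "singular_chain (Suc p) X e'" "singular_chain p X d'"
      using xy by (auto simp: mod2_boundaries_def)
    then have "x + y = chain_boundary (Suc p) (e + e') + frag_cmul 2 (d + d')"
      by (simp add: chain_boundary_add frag_cmul_distrib2)
    then show ?thesis
      unfolding mod2_boundaries_def mult_chain_group using sing singular_chain_add by blast
  qed
  show "\<one>\<^bsub>chain_group p X\<^esub> \<in> mod2_boundaries p X"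
    unfolding mod2_boundaries_def one_chain_group
    by (intro CollectI exI[of _ 0]) (simp add: singular_chain_0)
  show "inv\<^bsub>chain_group p X\<^esub> x \<in> mod2_boundaries p X" if x: "x \<in> mod2_boundaries p X" for x
  proof -
    obtain e d where e: "x = chain_boundary (Suc p) e + frag_cmul 2 d"
      "singular_chain (Suc p) X e" "singular_chain p X d"
      using x by (auto simp: mod2_boundaries_def)
    then have "- x = chain_boundary (Suc p) (- e) + frag_cmul 2 (- d)"
      by (simp add: chain_boundary_minus frag_cmul_uminus)
    moreover have "inv\<^bsub>chain_group p X\<^esub> x = - x"
      using x mod2_boundaries_subset_cycles[of p X]
      by (intro m_inv_chain_group) (auto simp: mod2_cycles_def singular_chain_def)
    ultimately show ?thesis
      unfolding mod2_boundaries_def using e singular_chain_minus by (metis (mono_tags, lifting) mem_Collect_eq)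
  qed
qed

text \<open>The two cocycles evaluated on the two cycles form the identity matrix modulo two, so
  none of the cycles \<open>a\<close>, \<open>b\<close> and \<open>a + b\<close> is a
  boundary.\<close>

lemma mod2_rank_ge_2:
  assumes "line_field M F" "line_field M F'" "loop_at M x f" "loop_at M x g"
    and "line_field.parity F f" "\<not> line_field.parity F' f" "\<not> line_field.parity F g" "line_field.parity F' g"
  shows "enat 2 \<le> mod2_rank (mod2_homology_group 1 M)"
proof -
  interpret F: line_field M F by fact
  interpret F': line_field M F' by fact
  define G where "G = subgroup_generated (chain_group 1 M) (mod2_cycles 1 M)"
  define N where "N = mod2_boundaries 1 M"
  have carr: "carrier G = mod2_cycles 1 M"
    unfolding G_def by (simp add: subgroup.carrier_subgroup_generated_subgroup subgroup_mod2_cycles)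
  interpret G: comm_group G
    unfolding G_def
    by (rule group.abelian_subgroup_generated) (simp_all add: abelian_chain_group)
  have "subgroup N G"
    unfolding G_def N_def
    by (simp add: group.subgroup_subgroup_generated_iff subgroup_mod2_boundaries mod2_boundaries_subset_cycles
        subgroup.carrier_subgroup_generated_subgroup subgroup_mod2_cycles)
  then have comm: "comm_group (G Mod N)"
    by (rule G.abelian_FactGroup)
  then interpret H: comm_group "G Mod N" .
  have H: "mod2_homology_group 1 M = G Mod N"
    by (simp add: mod2_homology_group_def G_def N_def)
  define a where "a = frag_of (path_simplex f)"
  define b where "b = frag_of (path_simplex g)"
  have cycle: "frag_of (path_simplex \<gamma>) \<in> carrier G" if "loop_at M x \<gamma>" for \<gamma>
  proof -
    have "chain_boundary 1 (frag_of (path_simplex \<gamma>)) = frag_cmul 2 0"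
      using chain_boundary_path_simplex[of \<gamma>] that unfolding loop_at_def by simp
    moreover have "singular_chain 1 M (frag_of (path_simplex \<gamma>))"
      using singular_simplex_path_simplex[of M \<gamma>] that unfolding loop_at_def singular_chain_def by simp
    ultimately show ?thesis
      unfolding carr mod2_cycles_def by blast
  qed
  have ab: "a \<in> carrier G" "b \<in> carrier G"
    unfolding a_def b_def using cycle assms(3,4) by blast+
  have w: "odd (F.chain_weight a)" "even (F'.chain_weight a)" "even (F.chain_weight b)" "odd (F'.chain_weight b)"
    unfolding a_def b_def F.chain_weight_path_simplex F'.chain_weight_path_simplex
    using assms(5-8) by simp_all
  have notin: "c \<notin> N" if "odd (F.chain_weight c) \<or> odd (F'.chain_weight c)" for c
    using that F.even_chain_weight_boundary F'.even_chain_weight_boundary unfolding N_def by blast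
  have coset: "N #>\<^bsub>G\<^esub> c \<noteq> N" if "c \<in> carrier G" "c \<notin> N" for c
    using G.coset_join1[OF _ that(1) \<open>subgroup N G\<close>] that(2) by blast
  let ?A = "N #>\<^bsub>G\<^esub> a" and ?B = "N #>\<^bsub>G\<^esub> b"
  have "normal N G"
    by (rule G.normal_iff_subgroup[THEN iffD2]) fact
  then have prod: "?A \<otimes>\<^bsub>G Mod N\<^esub> ?B = N #>\<^bsub>G\<^esub> (a + b)"
    using normal.rcos_sum[OF _ ab] by (simp add: FactGroup_def G_def)
  have AB: "?A \<in> carrier (G Mod N)" "?B \<in> carrier (G Mod N)"
    using ab by (auto simp: carrier_FactGroup)
  have ab': "a + b \<in> carrier G"
    using G.m_closed[OF ab] by (simp add: G_def)
  have ne: "?A \<noteq> N" "?B \<noteq> N" "?A \<otimes>\<^bsub>G Mod N\<^esub> ?B \<noteq> N"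
    unfolding prod using w by (intro coset notin ab ab'; simp)+
  have one: "\<one>\<^bsub>G Mod N\<^esub> = N"
    by (simp add: FactGroup_def)
  have "?A \<noteq> ?B"
  proof
    assume "?A = ?B"
    then have "a \<in> ?B"
      using G.rcos_self[OF ab(1) \<open>subgroup N G\<close>] by simp
    then obtain c where c: "c \<in> N" "a = c + b"
      by (auto simp: r_coset_def G_def)
    then show False
      using w(1,3) notin[of c] by simp
  qed
  have "mod2_independent (G Mod N) {?A, ?B}"
    unfolding mod2_independent_def
  proof (intro conjI allI impI)
    fix S assume "S \<subseteq> {?A, ?B}" "S \<noteq> {}"
    then consider "S = {?A}" | "S = {?B}" | "S = {?A, ?B}"
      by blast
    then show "finprod (G Mod N) (\<lambda>x. x) S \<noteq> \<one>\<^bsub>G Mod N\<^esub>"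
      using ne AB \<open>?A \<noteq> ?B\<close> unfolding one
      by cases (simp_all add: H.finprod_insert del: mult_FactGroup one_FactGroup)
  qed (use AB in auto)
  moreover have "card {?A, ?B} = 2"
    using \<open>?A \<noteq> ?B\<close> by simp
  ultimately show ?thesis
    unfolding H mod2_rank_def by (metis (mono_tags, lifting) SUP_upper mem_Collect_eq)
qed

section \<open>Perspectivities in barycentric coordinates\<close>

text \<open>The definition of \<open>affine_map_on\<close> treats two points only. The induction
  splits off one point and rescales the remaining weights to sum 1; this fails if that point has
  weight 1, but then all other weights vanish.\<close>

lemma affine_map_on_sum:
  assumes "affine_map_on \<tau> f" "convex \<tau>" "finite T" "T \<subseteq> \<tau>"
    and "\<And>w. w \<in> T \<Longrightarrow> 0 \<le> u w" "sum u T = 1"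
  shows "f (\<Sum>w\<in>T. u w *\<^sub>R w) = (\<Sum>w\<in>T. u w *\<^sub>R f w)"
  using assms(3-)
proof (induction T arbitrary: u rule: finite_induct)
  case (insert a T)
  show ?case
  proof (cases "u a = 1")
    case True
    then have "sum u T = 0"
      using insert by simp
    then have "\<forall>w\<in>T. u w = 0"
      using insert sum_nonneg_eq_0_iff[of T u] by simp
    then show ?thesis
      using True insert by simp
  next
    case False
    have "sum u T = 1 - u a"
      using insert by simp
    moreover have "0 \<le> sum u T"
      using insert by (intro sum_nonneg) auto
    ultimately have ua: "0 < 1 - u a" "0 \<le> u a"
      using False insert by auto
    define y where "y = (\<Sum>w\<in>T. (u w / (1 - u a)) *\<^sub>R w)"
    have u': "(\<Sum>w\<in>T. u w / (1 - u a)) = 1" "\<And>w. w \<in> T \<Longrightarrow> 0 \<le> u w / (1 - u a)"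
      using \<open>sum u T = 1 - u a\<close> ua insert by (auto simp flip: sum_divide_distrib)
    have "y \<in> \<tau>"
      unfolding y_def using insert u' by (intro convex_sum assms(2)) auto
    have fy: "f y = (\<Sum>w\<in>T. (u w / (1 - u a)) *\<^sub>R f w)"
      unfolding y_def using insert u' by (intro insert.IH) auto
    have scale: "(1 - u a) *\<^sub>R (\<Sum>w\<in>T. (u w / (1 - u a)) *\<^sub>R g w) = (\<Sum>w\<in>T. u w *\<^sub>R g w)" for g :: "'a \<Rightarrow> 'a"
      using ua by (simp add: scaleR_sum_right)
    have "f ((1 - u a) *\<^sub>R y + u a *\<^sub>R a) = (1 - u a) *\<^sub>R f y + u a *\<^sub>R f a"
      using assms(1) \<open>y \<in> \<tau>\<close> insert ua unfolding affine_map_on_def by auto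
    then show ?thesis
      using insert.hyps scale[of "\<lambda>w. w", folded y_def] scale[of f, folded fy] by (simp add: fy add.commute)
  qed
qed simp

text \<open>Translating another point \<open>a\<close> of \<open>C\<close> to the origin makes the
  rest linearly independent, so some linear functional is 1 at \<open>v - a\<close> and 0 at the
  other differences. If there is no other point, the coordinate is the constant 1.\<close>

lemma coordinate_function_exists:
  fixes C :: "'a::euclidean_space set"
  assumes "\<not> affine_dependent C" "v \<in> C"
  shows "\<exists>f::'a \<Rightarrow> real. continuous_on UNIV f \<and>
    (\<forall>u. sum u C = 1 \<longrightarrow> f (\<Sum>w\<in>C. u w *\<^sub>R w) = u v)"
proof (cases "C = {v}")
  case True
  then show ?thesis
    by (intro exI[of _ "\<lambda>_. 1"]) auto
next
  case False
  then obtain a where a: "a \<in> C" "a \<noteq> v"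
    using assms(2) by blast
  have fin: "finite C"
    using assms(1) by (rule aff_independent_finite)
  have "independent ((\<lambda>x. - a + x) ` (C - {a}))"
    using assms(1) affine_dependent_iff_dependent2[OF a(1)] by simp
  then obtain g :: "'a \<Rightarrow> real" where g: "linear g"
      "\<forall>x\<in>(\<lambda>x. - a + x) ` (C - {a}). g x = of_bool (x = - a + v)"
    using linear_independent_extend[of "(\<lambda>x. - a + x) ` (C - {a})" "\<lambda>x. of_bool (x = - a + v)"] by auto
  have gw: "g (w - a) = of_bool (w = v)" if "w \<in> C" for w
  proof (cases "w = a")
    case True
    then show ?thesis
      using a linear_0[OF g(1)] by simp
  next
    case False
    then have "- a + w \<in> (\<lambda>x. - a + x) ` (C - {a})"
      using that by blast
    then have "g (- a + w) = of_bool (- a + w = - a + v)"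
      using g(2) by blast
    then show ?thesis
      by simp
  qed
  interpret linear g by (rule g(1))
  have "g ((\<Sum>w\<in>C. u w *\<^sub>R w) - a) = u v" if "sum u C = 1" for u
  proof -
    have "(\<Sum>w\<in>C. u w *\<^sub>R (w - a)) = (\<Sum>w\<in>C. u w *\<^sub>R w) - (\<Sum>w\<in>C. u w *\<^sub>R a)"
      by (simp add: scaleR_diff_right sum_subtractf)
    also have "(\<Sum>w\<in>C. u w *\<^sub>R a) = a"
      using scaleR_sum_left[of u C a] that by simp
    finally have "(\<Sum>w\<in>C. u w *\<^sub>R w) - a = (\<Sum>w\<in>C. u w *\<^sub>R (w - a))" ..
    then have "g ((\<Sum>w\<in>C. u w *\<^sub>R w) - a) = (\<Sum>w\<in>C. u w * g (w - a))"
      by (simp only: sum scale real_scaleR_def)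
    also have "\<dots> = (\<Sum>w\<in>C. if w = v then u w else 0)"
      by (intro sum.cong) (auto simp: gw)
    also have "\<dots> = u v"
      using fin assms(2) by simp
    finally show ?thesis .
  qed
  moreover have "continuous_on UNIV (\<lambda>x. g (x - a))"
    by (rule continuous_on_compose2[OF linear_continuous_on[OF linear_conv_bounded_linear[THEN iffD1, OF g(1)]]])
      (auto intro: continuous_intros)
  ultimately show ?thesis
    by (intro exI[of _ "\<lambda>x. g (x - a)"]) simp
qed

text \<open>The barycentric coordinate of \<open>v\<close>, extended continuously to the whole
  space; only its values on the affine hull of \<open>C\<close> are determined.\<close>

definition coord :: "'a::euclidean_space set \<Rightarrow> 'a \<Rightarrow> 'a \<Rightarrow> real" where
  "coord C v = (SOME f. continuous_on UNIV f \<and> (\<forall>u. sum u C = 1 \<longrightarrow> f (\<Sum>w\<in>C. u w *\<^sub>R w) = u v))"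

context
  fixes C :: "'a::euclidean_space set"
  assumes indep: "\<not> affine_dependent C"
begin

lemma continuous_on_coord: "v \<in> C \<Longrightarrow> continuous_on S (coord C v)"
  and coord_sum: "v \<in> C \<Longrightarrow> sum u C = 1 \<Longrightarrow> coord C v (\<Sum>w\<in>C. u w *\<^sub>R w) = u v"
  unfolding coord_def using someI_ex[OF coordinate_function_exists[OF indep]]
  by (blast intro: continuous_on_subset)+

lemma convex_hull_coords:
  assumes "x \<in> convex hull C"
  shows "\<And>v. v \<in> C \<Longrightarrow> 0 \<le> coord C v x" "(\<Sum>v\<in>C. coord C v x) = 1" "x = (\<Sum>v\<in>C. coord C v x *\<^sub>R v)"
proof -
  obtain u where u: "\<forall>v\<in>C. 0 \<le> u v" "sum u C = 1" "(\<Sum>v\<in>C. u v *\<^sub>R v) = x"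
    using assms convex_hull_finite[OF aff_independent_finite[OF indep]] by auto
  then have eq: "coord C v x = u v" if "v \<in> C" for v
    using coord_sum[OF that u(2)] by simp
  show "0 \<le> coord C v x" if "v \<in> C" for v
    using u eq that by simp
  show "(\<Sum>v\<in>C. coord C v x) = 1" "x = (\<Sum>v\<in>C. coord C v x *\<^sub>R v)"
    using u eq by simp_all
qed

lemma coord_vertex: "v \<in> C \<Longrightarrow> w \<in> C \<Longrightarrow> coord C v w = of_bool (v = w)"
  using coord_sum[of v "\<lambda>z. of_bool (z = w)"] aff_independent_finite[OF indep]
  by (simp add: of_bool_def if_distrib[of "\<lambda>c. c *\<^sub>R _"] cong: if_cong)

lemma coord_face_eq_0:
  assumes "c \<in> C" "x \<in> convex hull (C - {c})"
  shows "coord C c x = 0"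
proof -
  obtain u where u: "sum u (C - {c}) = 1" "(\<Sum>v\<in>C - {c}. u v *\<^sub>R v) = x"
    using assms(2) convex_hull_finite[of "C - {c}"] aff_independent_finite[OF indep] by auto
  have fin: "finite C"
    using indep by (rule aff_independent_finite)
  have "sum (u(c := 0)) C = 1" "(\<Sum>v\<in>C. (u(c := 0)) v *\<^sub>R v) = x"
    using u sum.remove[OF fin assms(1), of "u(c := 0)"] sum.remove[OF fin assms(1), of "\<lambda>v. (u(c := 0)) v *\<^sub>R v"]
    by (simp_all cong: sum.cong_simp)
  then show ?thesis
    using coord_sum[OF assms(1), of "u(c := 0)"] by simp
qed

end

text \<open>Since \<open>vertices\<close> is defined by extreme points, this is what makes a face
  pairing carry vertices of a facet to vertices of its partner.\<close>

lemma extreme_point_affine_image: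
  assumes f: "affine_map_on \<tau> f" "inj_on f \<tau>" and "v extreme_point_of \<tau>" "convex \<tau>"
  shows "f v extreme_point_of (f ` \<tau>)"
  unfolding extreme_point_of_def
proof (intro conjI ballI notI)
  have v: "v \<in> \<tau>"
    using assms(3) by (simp add: extreme_point_of_def)
  then show "f v \<in> f ` \<tau>"
    by simp
  fix a b assume "a \<in> f ` \<tau>" "b \<in> f ` \<tau>" and fv: "f v \<in> open_segment a b"
  then obtain x y where xy: "x \<in> \<tau>" "y \<in> \<tau>" "a = f x" "b = f y"
    by blast
  obtain u where u: "0 < u" "u < 1" "f v = (1 - u) *\<^sub>R f x + u *\<^sub>R f y" and "f x \<noteq> f y"
    using fv xy by (auto simp: in_segment)
  then have "f v = f ((1 - u) *\<^sub>R x + u *\<^sub>R y)"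
    using f(1) xy by (auto simp: affine_map_on_def)
  moreover have "(1 - u) *\<^sub>R x + u *\<^sub>R y \<in> \<tau>"
    using assms(4) xy u by (intro convexD) auto
  ultimately have "v = (1 - u) *\<^sub>R x + u *\<^sub>R y"
    using f(2) v by (auto dest: inj_onD)
  then have "v \<in> open_segment x y"
    using u \<open>f x \<noteq> f y\<close> by (auto simp: in_segment)
  then show False
    using assms(3) xy by (auto simp: extreme_point_of_def)
qed

section \<open>Gluings, with facets indexed by their opposite vertices\<close>

locale glued_simplices =
  fixes n :: nat and D :: "'a::euclidean_space gluing"
  assumes gluing: "is_gluing n D" and n: "1 \<le> n"
begin

definition simplex_of :: "'a \<Rightarrow> 'a set" where
  "simplex_of x = (THE \<sigma>. \<sigma> \<in> simplices D \<and> x \<in> \<sigma>)"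

text \<open>The simplices are disjoint, so a vertex determines its simplex and thereby the facet
  opposite to it. From here on facets are addressed by this vertex.\<close>

definition facet :: "'a \<Rightarrow> 'a set" where
  "facet c = convex hull (vertices (simplex_of c) - {c})"

definition verts :: "'a set" where
  "verts = (\<Union>\<sigma>\<in>simplices D. vertices \<sigma>)"

text \<open>The vertex \<open>c\<close> is moved to the vertex opposite to the partner facet. Thus
  \<open>step c c\<close> names the facet on the other side, \<open>simplex_of (step c c)\<close> is
  the neighbour behind \<open>facet c\<close>, and \<open>step (step c c)\<close> is the way
  back.\<close>

definition step :: "'a \<Rightarrow> 'a \<Rightarrow> 'a" where
  "step c v = perspectivity D (facet c) v"

lemma simplex_unique: "\<sigma> \<in> simplices D \<Longrightarrow> \<sigma>' \<in> simplices D \<Longrightarrow> x \<in> \<sigma> \<Longrightarrow> x \<in> \<sigma>' \<Longrightarrow> \<sigma> = \<sigma>'"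
  using gluing unfolding is_gluing_def by (auto dest: pairwiseD simp: disjnt_iff)

lemma simplex_of_eq: "\<sigma> \<in> simplices D \<Longrightarrow> x \<in> \<sigma> \<Longrightarrow> simplex_of x = \<sigma>"
  unfolding simplex_of_def by (rule the_equality) (auto dest: simplex_unique)

lemma vertices_subset: "vertices F \<subseteq> F"
  by (auto simp: vertices_def extreme_point_of_def)

lemma simplex_of_vertex: "\<sigma> \<in> simplices D \<Longrightarrow> v \<in> vertices \<sigma> \<Longrightarrow> simplex_of v = \<sigma>"
  using vertices_subset simplex_of_eq by blast

lemma simplexD:
  assumes "\<sigma> \<in> simplices D"
  shows "\<not> affine_dependent (vertices \<sigma>)" "card (vertices \<sigma>) = n + 1" "convex hull vertices \<sigma> = \<sigma>"
    "finite (vertices \<sigma>)"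
proof -
  have "int n simplex \<sigma>"
    using gluing assms by (simp add: is_gluing_def)
  then obtain C where C: "\<not> affine_dependent C" "int (card C) = int n + 1" "\<sigma> = convex hull C"
    by (auto simp: simplex_def)
  have "vertices \<sigma> = C"
    unfolding vertices_def C(3) using extreme_point_of_convex_hull_affine_independent[OF C(1)] by simp
  then show "\<not> affine_dependent (vertices \<sigma>)" "card (vertices \<sigma>) = n + 1" "convex hull vertices \<sigma> = \<sigma>"
    "finite (vertices \<sigma>)"
    using C aff_independent_finite by auto
qed

lemma simplex_of_verts: "v \<in> verts \<Longrightarrow> simplex_of v \<in> simplices D \<and> v \<in> vertices (simplex_of v)"
  unfolding verts_def using simplex_of_vertex by auto

lemma vertices_facet:
  assumes "c \<in> verts"
  shows "vertices (facet c) = vertices (simplex_of c) - {c}"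
proof -
  have "\<not> affine_dependent (vertices (simplex_of c) - {c})"
    using simplexD(1) simplex_of_verts[OF assms] affine_independent_Diff by blast
  then show ?thesis
    unfolding facet_def vertices_def[of "convex hull _"] by (auto simp: extreme_point_of_convex_hull_affine_independent)
qed

lemma facet_of_simplex_iff:
  assumes "\<sigma> \<in> simplices D"
  shows "\<tau> facet_of \<sigma> \<longleftrightarrow> (\<exists>c\<in>vertices \<sigma>. \<tau> = facet c)"
proof -
  have "\<tau> facet_of (convex hull vertices \<sigma>) \<longleftrightarrow>
      2 \<le> card (vertices \<sigma>) \<and> (\<exists>c. c \<in> vertices \<sigma> \<and> \<tau> = convex hull (vertices \<sigma> - {c}))"
    by (rule facet_of_convex_hull_affine_independent_alt[OF simplexD(1)[OF assms]])
  then show ?thesis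
    using simplexD[OF assms] n simplex_of_vertex[OF assms] by (auto simp: facet_def)
qed

lemma facets_eq: "facets D = facet ` verts"
  unfolding facets_def verts_def using facet_of_simplex_iff by auto

lemma facet_subset: "c \<in> verts \<Longrightarrow> facet c \<subseteq> simplex_of c"
  unfolding facet_def using simplexD(3)[of "simplex_of c"] simplex_of_verts hull_mono[of "vertices (simplex_of c) - {c}" "vertices (simplex_of c)" convex]
  by auto

lemma facet_nonempty:
  assumes "c \<in> verts" shows "facet c \<noteq> {}"
proof
  assume "facet c = {}"
  then have "vertices (simplex_of c) \<subseteq> {c}"
    using vertices_facet[OF assms] by (auto simp: vertices_def extreme_point_of_def)
  then have "card (vertices (simplex_of c)) \<le> 1"
    using card_mono[of "{c}"] by simp
  then show False
    using simplexD(2) simplex_of_verts[OF assms] n by fastforce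
qed

lemma vertex_notin_facet:
  assumes "c \<in> verts" shows "c \<notin> facet c"
proof
  assume "c \<in> facet c"
  then have "coord (vertices (simplex_of c)) c c = 0"
    unfolding facet_def using simplexD(1) simplex_of_verts[OF assms] by (intro coord_face_eq_0) auto
  moreover have "coord (vertices (simplex_of c)) c c = 1"
    using simplexD(1) simplex_of_verts[OF assms] by (subst coord_vertex) auto
  ultimately show False
    by simp
qed

lemma simplex_at_facet:
  assumes "c \<in> verts" shows "simplex_at D (facet c) = simplex_of c"
  unfolding simplex_at_def
proof (rule the_equality)
  show "simplex_of c \<in> simplices D \<and> facet c facet_of simplex_of c"
    using simplex_of_verts[OF assms] facet_of_simplex_iff by blast
  fix \<sigma> assume \<sigma>: "\<sigma> \<in> simplices D \<and> facet c facet_of \<sigma>"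
  obtain x where "x \<in> facet c"
    using facet_nonempty[OF assms] by blast
  moreover have "facet c \<subseteq> \<sigma>"
    using \<sigma> facet_of_imp_subset by blast
  ultimately show "\<sigma> = simplex_of c"
    using facet_subset[OF assms] simplex_unique[of \<sigma> "simplex_of c" x] \<sigma> simplex_of_verts[OF assms] by auto
qed

lemma opposite_facet:
  assumes "c \<in> verts" shows "opposite D (facet c) = c"
  unfolding opposite_def simplex_at_facet[OF assms]
proof (rule the_equality)
  show "c \<in> vertices (simplex_of c) \<and> c \<notin> facet c"
    using simplex_of_verts[OF assms] vertex_notin_facet[OF assms] by simp
  fix v assume "v \<in> vertices (simplex_of c) \<and> v \<notin> facet c"
  then show "v = c"
    using vertices_facet[OF assms] vertices_subset by blast
qed

lemma facetD:
  assumes "c \<in> verts"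
  shows "inj_on (pairing D (facet c)) (facet c)" "affine_map_on (facet c) (pairing D (facet c))"
    "\<And>x. x \<in> facet c \<Longrightarrow> pairing D (partner D (facet c)) (pairing D (facet c) x) = x"
    "orientation_reversing D (facet c)" "partner D (facet c) \<in> facet ` verts"
proof -
  have "facet c \<in> facets D"
    using assms facets_eq by simp
  then show "inj_on (pairing D (facet c)) (facet c)" "affine_map_on (facet c) (pairing D (facet c))"
    "\<And>x. x \<in> facet c \<Longrightarrow> pairing D (partner D (facet c)) (pairing D (facet c) x) = x"
    "orientation_reversing D (facet c)" "partner D (facet c) \<in> facet ` verts"
    using gluing assms by (simp_all add: is_gluing_def facets_eq[symmetric] del: imageI)
qed

lemma partner_facet:
  assumes "c \<in> verts"
  shows "step c c \<in> verts" "partner D (facet c) = facet (step c c)"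
proof -
  obtain c' where c': "c' \<in> verts" "partner D (facet c) = facet c'"
    using facetD(5)[OF assms] by blast
  have "step c c = c'"
    unfolding step_def perspectivity_def using vertex_notin_facet[OF assms] c' opposite_facet by simp
  then show "step c c \<in> verts" "partner D (facet c) = facet (step c c)"
    using c' by simp_all
qed

lemma step_eq_pairing: "x \<in> facet c \<Longrightarrow> step c x = pairing D (facet c) x"
  by (simp add: step_def perspectivity_def)

lemma step_facet:
  assumes "c \<in> verts" "x \<in> facet c"
  shows "step c x \<in> facet (step c c)" "step (step c c) (step c x) = x"
proof -
  show "step c x \<in> facet (step c c)"
    using partner_facet[OF assms(1)] assms(2) by (auto simp: step_eq_pairing partner_def)
  then show "step (step c c) (step c x) = x"
    using facetD(3)[OF assms] partner_facet(2)[OF assms(1)] assms(2) by (simp add: step_eq_pairing)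
qed

lemma step_vertex:
  assumes "c \<in> verts" "v \<in> vertices (simplex_of c)" "v \<noteq> c"
  shows "step c v \<in> vertices (simplex_of (step c c)) - {step c c}"
proof -
  have v: "v \<in> vertices (facet c)"
    using assms vertices_facet by simp
  have "pairing D (facet c) v extreme_point_of (pairing D (facet c) ` facet c)"
    by (rule extreme_point_affine_image[OF facetD(2,1)[OF assms(1)]])
      (use v in \<open>simp_all add: vertices_def facet_def\<close>)
  then have "step c v \<in> vertices (facet (step c c))"
    using partner_facet(2)[OF assms(1)] v vertices_subset[of "facet c"]
    by (auto simp: vertices_def step_eq_pairing partner_def)
  then show ?thesis
    using vertices_facet[OF partner_facet(1)[OF assms(1)]] by simp
qed

lemma step_step_opposite: "c \<in> verts \<Longrightarrow> step (step c c) (step c c) = c"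
proof -
  assume c: "c \<in> verts"
  have "facet (step (step c c) (step c c)) = partner D (partner D (facet c))"
    using partner_facet[OF c] partner_facet(2)[OF partner_facet(1)[OF c]] by simp
  also have "\<dots> = facet c"
    unfolding partner_def[of D "partner D (facet c)"] unfolding partner_def[of D "facet c"]
    using facetD(3)[OF c] by (simp add: partner_def image_image)
  finally show ?thesis
    using opposite_facet[OF c] opposite_facet[OF partner_facet(1)[OF partner_facet(1)[OF c]]] by simp
qed

lemma step_in:
  assumes "c \<in> verts" "v \<in> vertices (simplex_of c)"
  shows "step c v \<in> vertices (simplex_of (step c c))"
  using step_vertex[OF assms] partner_facet(1)[OF assms(1)] simplex_of_verts by (cases "v = c") auto

lemma step_step:
  assumes "c \<in> verts" "v \<in> vertices (simplex_of c)"
  shows "step (step c c) (step c v) = v"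
proof (cases "v = c")
  case False
  then have "v \<in> facet c"
    using assms vertices_facet vertices_subset by blast
  then show ?thesis
    by (rule step_facet(2)[OF assms(1)])
qed (use step_step_opposite assms in simp)

lemma bij_betw_step:
  assumes "c \<in> verts"
  shows "bij_betw (step c) (vertices (simplex_of c)) (vertices (simplex_of (step c c)))"
proof (rule bij_betw_byWitness[where f' = "step (step c c)"])
  show "step (step c c) ` vertices (simplex_of (step c c)) \<subseteq> vertices (simplex_of c)"
    using step_in[OF partner_facet(1)[OF assms]] by (auto simp: step_step_opposite[OF assms])
  show "\<forall>v\<in>vertices (simplex_of (step c c)). step c (step (step c c) v) = v"
    using step_step[OF partner_facet(1)[OF assms]] by (simp add: step_step_opposite[OF assms])
qed (use step_in step_step assms in auto)

text \<open>The pairing is affine on the facet and carries vertices to vertices, so the weights of a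
  convex combination are kept.\<close>

lemma coord_step:
  assumes "c \<in> verts" "x \<in> facet c" "v \<in> vertices (simplex_of c)"
  shows "coord (vertices (simplex_of (step c c))) (step c v) (step c x) = coord (vertices (simplex_of c)) v x"
proof -
  let ?V = "vertices (simplex_of c)" and ?V' = "vertices (simplex_of (step c c))"
  define u where "u w = coord ?V w x" for w
  have \<sigma>: "simplex_of c \<in> simplices D" "c \<in> ?V" "simplex_of (step c c) \<in> simplices D"
    using simplex_of_verts assms(1) partner_facet(1) by auto
  have x: "x \<in> convex hull ?V"
    using facet_subset[OF assms(1)] assms(2) simplexD(3)[OF \<sigma>(1)] by auto
  have u: "u w \<ge> 0" if "w \<in> ?V" for w
    unfolding u_def using convex_hull_coords(1)[OF simplexD(1)[OF \<sigma>(1)] x that] .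
  have usum: "sum u ?V = 1" "x = (\<Sum>w\<in>?V. u w *\<^sub>R w)"
    unfolding u_def using convex_hull_coords(2,3)[OF simplexD(1)[OF \<sigma>(1)] x] .
  have uc: "u c = 0"
    unfolding u_def using coord_face_eq_0[OF simplexD(1)[OF \<sigma>(1)] \<sigma>(2)] assms(2) by (simp add: facet_def)
  \<comment> \<open>The coordinate of \<open>c\<close> vanishes on the facet, so sums over the facet
    and over the simplex are interchangeable. This permits reindexing along the bijection of all
    vertices.\<close>
  have rem: "sum g ?V = sum g (?V - {c})" if "g c = 0" for g :: "'a \<Rightarrow> 'b::comm_monoid_add"
    using sum.remove[OF simplexD(4)[OF \<sigma>(1)] \<sigma>(2), of g] that by simp
  have sub: "?V - {c} \<subseteq> facet c"
    unfolding facet_def by (rule hull_subset)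
  have "step c x = pairing D (facet c) (\<Sum>w\<in>?V - {c}. u w *\<^sub>R w)"
    using assms(2) usum(2) rem[of "\<lambda>w. u w *\<^sub>R w"] uc by (simp add: step_eq_pairing)
  also have "\<dots> = (\<Sum>w\<in>?V - {c}. u w *\<^sub>R pairing D (facet c) w)"
    using u usum(1) uc rem[of u] simplexD(4)[OF \<sigma>(1)] sub
    by (intro affine_map_on_sum[OF facetD(2)[OF assms(1)]]) (auto simp: facet_def)
  also have "\<dots> = (\<Sum>w\<in>?V - {c}. u w *\<^sub>R step c w)"
    using sub by (intro sum.cong) (auto simp: step_eq_pairing)
  also have "\<dots> = (\<Sum>w\<in>?V. u w *\<^sub>R step c w)"
    using rem[of "\<lambda>w. u w *\<^sub>R step c w"] uc by simp
  also have "\<dots> = (\<Sum>w\<in>?V. u (step (step c c) (step c w)) *\<^sub>R step c w)"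
    using step_step[OF assms(1)] by simp
  also have "\<dots> = (\<Sum>w\<in>?V'. u (step (step c c) w) *\<^sub>R w)"
    by (rule sum.reindex_bij_betw[OF bij_betw_step[OF assms(1)]])
  finally have x': "step c x = (\<Sum>w\<in>?V'. u (step (step c c) w) *\<^sub>R w)" .
  have "(\<Sum>w\<in>?V'. u (step (step c c) w)) = (\<Sum>w\<in>?V. u (step (step c c) (step c w)))"
    by (rule sum.reindex_bij_betw[OF bij_betw_step[OF assms(1)], symmetric])
  also have "\<dots> = 1"
    using step_step[OF assms(1)] usum(1) by simp
  finally have "coord ?V' (step c v) (step c x) = u (step (step c c) (step c v))"
    unfolding x' using step_in[OF assms(1,3)] by (intro coord_sum[OF simplexD(1)[OF \<sigma>(3)]])
  then show ?thesis
    using step_step[OF assms(1,3)] by (simp add: u_def)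
qed

end

section \<open>Projectivities along dual walks\<close>

context glued_simplices
begin

lemma perspectivity_facet: "perspectivity D (facet c) = step c"
  by (simp add: fun_eq_iff step_def)

lemma dual_walk_Cons_iff:
  assumes "\<sigma> \<in> simplices D"
  shows "dual_walk D \<sigma> (\<tau> # \<tau>s) \<sigma>' \<longleftrightarrow>
    (\<exists>c\<in>vertices \<sigma>. \<tau> = facet c \<and> dual_walk D (simplex_of (step c c)) \<tau>s \<sigma>')"
proof -
  have "simplex_at D (partner D (facet c)) = simplex_of (step c c)" if "c \<in> vertices \<sigma>" for c
  proof -
    have "c \<in> verts"
      using that assms by (auto simp: verts_def)
    then show ?thesis
      using partner_facet[of c] simplex_at_facet[of "step c c"] by simp
  qed
  then show ?thesis
    using facet_of_simplex_iff[OF assms] by auto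
qed

lemma vertices_in_verts: "\<sigma> \<in> simplices D \<Longrightarrow> v \<in> vertices \<sigma> \<Longrightarrow> v \<in> verts"
  by (auto simp: verts_def)

lemma simplex_of_step: "\<sigma> \<in> simplices D \<Longrightarrow> c \<in> vertices \<sigma> \<Longrightarrow> simplex_of (step c c) \<in> simplices D"
  using partner_facet(1) simplex_of_verts vertices_in_verts by blast

lemma bij_betw_step': "\<sigma> \<in> simplices D \<Longrightarrow> c \<in> vertices \<sigma> \<Longrightarrow>
    bij_betw (step c) (vertices \<sigma>) (vertices (simplex_of (step c c)))"
  using bij_betw_step[of c] simplex_of_vertex[of \<sigma> c] vertices_in_verts[of \<sigma> c] by simp

lemma dual_walk_bij_betw:
  assumes "dual_walk D \<sigma> \<tau>s \<sigma>'" "\<sigma> \<in> simplices D"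
  shows "\<sigma>' \<in> simplices D \<and> bij_betw (walk_projectivity D \<tau>s) (vertices \<sigma>) (vertices \<sigma>')"
  using assms
proof (induction \<tau>s arbitrary: \<sigma>)
  case (Cons \<tau> \<tau>s)
  then obtain c where c: "c \<in> vertices \<sigma>" "\<tau> = facet c" "dual_walk D (simplex_of (step c c)) \<tau>s \<sigma>'"
    using dual_walk_Cons_iff by blast
  have "walk_projectivity D (\<tau> # \<tau>s) = walk_projectivity D \<tau>s \<circ> step c"
    by (simp only: walk_projectivity.simps c(2) perspectivity_facet)
  then show ?case
    using Cons.IH[OF c(3) simplex_of_step[OF Cons.prems(2) c(1)]]
      bij_betw_trans[OF bij_betw_step'[OF Cons.prems(2) c(1)]] by metis
qed simp

lemma dual_walk_append:
  "dual_walk D \<sigma> (\<tau>s @ \<tau>s') \<sigma>'' \<longleftrightarrow> (\<exists>\<sigma>'. dual_walk D \<sigma> \<tau>s \<sigma>' \<and> dual_walk D \<sigma>' \<tau>s' \<sigma>'')"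
  by (induction \<tau>s arbitrary: \<sigma>) auto

lemma walk_projectivity_append:
  "walk_projectivity D (\<tau>s @ \<tau>s') = walk_projectivity D \<tau>s' \<circ> walk_projectivity D \<tau>s"
  by (induction \<tau>s) auto

text \<open>Crossing back through \<open>facet (step c c)\<close> undoes the crossing of
  \<open>facet c\<close>, on the opposite vertices as well.\<close>

lemma dual_walk_reverse:
  assumes "dual_walk D \<sigma> \<tau>s \<sigma>'" "\<sigma> \<in> simplices D"
  obtains \<tau>s' where "dual_walk D \<sigma>' \<tau>s' \<sigma>"
    "\<And>v. v \<in> vertices \<sigma> \<Longrightarrow> walk_projectivity D \<tau>s' (walk_projectivity D \<tau>s v) = v"
proof -
  have "\<exists>\<tau>s'. dual_walk D \<sigma>' \<tau>s' \<sigma> \<and>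
      (\<forall>v\<in>vertices \<sigma>. walk_projectivity D \<tau>s' (walk_projectivity D \<tau>s v) = v)"
    using assms
  proof (induction \<tau>s arbitrary: \<sigma>)
    case Nil
    then show ?case
      by (intro exI[of _ "[]"]) simp
  next
    case (Cons \<tau> \<tau>s)
    then obtain c where c: "c \<in> vertices \<sigma>" "\<tau> = facet c" "dual_walk D (simplex_of (step c c)) \<tau>s \<sigma>'"
      using dual_walk_Cons_iff by blast
    have \<sigma>: "simplex_of (step c c) \<in> simplices D"
      by (rule simplex_of_step[OF Cons.prems(2) c(1)])
    obtain \<tau>s' where \<tau>s': "dual_walk D \<sigma>' \<tau>s' (simplex_of (step c c))"
      "\<forall>v\<in>vertices (simplex_of (step c c)). walk_projectivity D \<tau>s' (walk_projectivity D \<tau>s v) = v"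
      using Cons.IH[OF c(3) \<sigma>] by blast
    have cv: "c \<in> verts"
      using vertices_in_verts[OF Cons.prems(2) c(1)] .
    have sc: "simplex_of c = \<sigma>"
      using simplex_of_vertex[OF Cons.prems(2) c(1)] .
    have "dual_walk D (simplex_of (step c c)) [facet (step c c)] \<sigma>"
      unfolding dual_walk_Cons_iff[OF \<sigma>]
      using step_step_opposite[OF cv] simplex_of_verts[OF partner_facet(1)[OF cv]] sc
      by (intro bexI[of _ "step c c"]) simp_all
    then have "dual_walk D \<sigma>' (\<tau>s' @ [facet (step c c)]) \<sigma>"
      using \<tau>s'(1) dual_walk_append by blast
    moreover have "walk_projectivity D (\<tau>s' @ [facet (step c c)]) (walk_projectivity D (\<tau> # \<tau>s) v) = v"
      if "v \<in> vertices \<sigma>" for v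
      using that \<tau>s'(2) step_in[OF cv, of v] step_step[OF cv, of v] sc
      by (simp add: walk_projectivity_append perspectivity_facet c(2))
    ultimately show ?case
      by blast
  qed
  then show ?thesis
    using that by blast
qed

text \<open>An elementary gluing of a vertex goes through a facet that contains it, where
  perspectivity and pairing agree. Recording these facets turns a chain of gluings into a
  walk.\<close>

lemma glued_vertices_walk:
  assumes "(v, w) \<in> glued D" "v \<in> verts"
  shows "w \<in> verts \<and> (\<exists>\<tau>s. dual_walk D (simplex_of v) \<tau>s (simplex_of w) \<and> walk_projectivity D \<tau>s v = w)"
  using assms(1) unfolding glued_def
proof (induction rule: rtrancl_induct)
  case base
  show ?case
    using assms(2) by (intro conjI exI[of _ "[]"]) simp_all
next
  case (step w z)
  then obtain c where c: "c \<in> verts" "w \<in> facet c" "z = step c w"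
    using facets_eq step_eq_pairing by auto
  obtain \<tau>s where \<tau>s: "dual_walk D (simplex_of v) \<tau>s (simplex_of w)" "walk_projectivity D \<tau>s v = w"
    and w: "w \<in> verts"
    using step.IH by blast
  have cw: "simplex_of w = simplex_of c"
    using facet_subset[OF c(1)] c(2) simplex_of_verts[OF c(1)] simplex_of_eq by blast
  have wc: "w \<in> vertices (simplex_of c)" "simplex_of c \<in> simplices D" "c \<in> vertices (simplex_of c)"
    using simplex_of_verts[OF w] simplex_of_verts[OF c(1)] cw by auto
  have z: "z \<in> vertices (simplex_of (step c c))" "simplex_of (step c c) \<in> simplices D"
    using step_in[OF c(1) wc(1)] simplex_of_step[OF wc(2,3)] c(3) by auto
  then have "dual_walk D (simplex_of w) [facet c] (simplex_of z)"
    unfolding cw dual_walk_Cons_iff[OF wc(2)] using wc(3) simplex_of_vertex[OF z(2,1)]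
    by (intro bexI[of _ c]) simp_all
  then have "dual_walk D (simplex_of v) (\<tau>s @ [facet c]) (simplex_of z)"
    using \<tau>s(1) dual_walk_append by blast
  moreover have "walk_projectivity D (\<tau>s @ [facet c]) v = z"
    by (simp add: walk_projectivity_append perspectivity_facet \<tau>s(2) c(3))
  ultimately show ?case
    using vertices_in_verts[OF z(2,1)] by blast
qed

text \<open>This makes the two halves of \<open>dual_edge\<close> meet in the quotient: the pairing
  matches the vertices of the two facets and, being affine, preserves averages.\<close>

lemma barycentre_facet:
  assumes "c \<in> verts"
  shows "barycentre (facet c) \<in> facet c" "pairing D (facet c) (barycentre (facet c)) = barycentre (partner D (facet c))"
proof -
  have cV: "simplex_of c \<in> simplices D" "c \<in> vertices (simplex_of c)"
    using simplex_of_verts[OF assms] by auto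
  have card: "card (vertices (facet c)) = n" and fin: "finite (vertices (facet c))"
    if "c \<in> verts" for c
    using vertices_facet[OF that] simplexD(2,4) simplex_of_verts[OF that] by auto
  have sum1: "(\<Sum>v\<in>vertices (facet c). 1 / real n) = 1"
    using card[OF assms] n by simp
  have bary: "barycentre (facet c) = (\<Sum>v\<in>vertices (facet c). (1 / real n) *\<^sub>R v)"
    if "c \<in> verts" for c
    using card[OF that] by (simp add: barycentre_def scaleR_sum_right)
  show "barycentre (facet c) \<in> facet c"
    unfolding bary[OF assms] using fin[OF assms] sum1 vertices_subset[of "facet c"]
    by (intro convex_sum) (auto simp: facet_def)
  let ?c = "step c c"
  have "pairing D (facet c) (barycentre (facet c)) = (\<Sum>v\<in>vertices (facet c). (1 / real n) *\<^sub>R pairing D (facet c) v)"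
    unfolding bary[OF assms] using fin[OF assms] sum1 vertices_subset[of "facet c"]
    by (intro affine_map_on_sum[OF facetD(2)[OF assms]]) (auto simp: facet_def)
  also have "\<dots> = (\<Sum>v\<in>vertices (facet c). (1 / real n) *\<^sub>R step c v)"
    using vertices_subset[of "facet c"] by (intro sum.cong) (auto simp: step_eq_pairing)
  also have "\<dots> = (\<Sum>v\<in>vertices (facet ?c). (1 / real n) *\<^sub>R v)"
  proof (rule sum.reindex_bij_betw)
    have "bij_betw (step c) (vertices (simplex_of c) - {c}) (vertices (simplex_of ?c) - {?c})"
      using bij_betw_step[OF assms] cV(2) by (auto simp: bij_betw_def inj_on_def)
    then show "bij_betw (step c) (vertices (facet c)) (vertices (facet ?c))"
      using vertices_facet[OF assms] vertices_facet[OF partner_facet(1)[OF assms]] by simp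
  qed
  also have "\<dots> = barycentre (facet ?c)"
    using bary[OF partner_facet(1)[OF assms]] by simp
  finally show "pairing D (facet c) (barycentre (facet c)) = barycentre (partner D (facet c))"
    using partner_facet(2)[OF assms] by simp
qed

lemma barycentre_simplex:
  assumes "\<sigma> \<in> simplices D"
  shows "barycentre \<sigma> \<in> \<sigma>"
proof -
  have "(\<Sum>v\<in>vertices \<sigma>. (1 / real (card (vertices \<sigma>))) *\<^sub>R v) \<in> \<sigma>"
    using simplexD[OF assms] vertices_subset[of \<sigma>] convex_convex_hull[of "vertices \<sigma>"]
    by (intro convex_sum) auto
  then show ?thesis
    by (simp add: barycentre_def scaleR_sum_right)
qed

end

section \<open>The quotient manifold and the action on partitions\<close>

locale triangulated = glued_simplices +
  fixes M :: "'m topology" and q :: "'a \<Rightarrow> 'm"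
  assumes triangulation: "is_triangulation n M D q"
begin

lemma quotient: "quotient_map (top_of_set (\<Union>(simplices D))) M q"
  and q_eq_iff: "x \<in> \<Union>(simplices D) \<Longrightarrow> y \<in> \<Union>(simplices D) \<Longrightarrow> q x = q y \<longleftrightarrow> (x, y) \<in> glued D"
  using triangulation by (auto simp: is_triangulation_def)

lemma pathin_linepath:
  assumes "\<sigma> \<in> simplices D" "x \<in> \<sigma>" "y \<in> \<sigma>"
  shows "pathin M (q \<circ> linepath x y)"
  unfolding pathin_def
proof (rule continuous_map_compose)
  show "continuous_map (top_of_set (\<Union>(simplices D))) M q"
    by (rule quotient_imp_continuous_map[OF quotient])
  have "convex \<sigma>"
    using simplexD(3)[OF assms(1)] convex_convex_hull by metis
  then have "linepath x y \<in> {0..1} \<rightarrow> \<sigma>"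
    using assms by (auto simp: linepath_def convexD_alt)
  then show "continuous_map (top_of_set {0..1}) (top_of_set (\<Union>(simplices D))) (linepath x y)"
    using assms(1) path_linepath[of x y] by (auto simp: continuous_map_in_subtopology path_def)
qed

lemma dual_edge_path:
  assumes "c \<in> verts"
  shows "pathin M (dual_edge D q (facet c))" "dual_edge D q (facet c) 0 = q (barycentre (simplex_of c))"
    "dual_edge D q (facet c) 1 = q (barycentre (simplex_of (step c c)))"
proof -
  let ?c = "step c c"
  have c: "simplex_of c \<in> simplices D" "simplex_of ?c \<in> simplices D" "?c \<in> verts"
    using simplex_of_verts assms partner_facet(1) by auto
  have eq: "dual_edge D q (facet c) = path_concat
      (q \<circ> linepath (barycentre (simplex_of c)) (barycentre (facet c)))
      (q \<circ> linepath (barycentre (facet ?c)) (barycentre (simplex_of ?c)))"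
    unfolding dual_edge_def using partner_facet(2)[OF assms] simplex_at_facet assms c(3) by simp
  have b: "barycentre (facet c) \<in> simplex_of c" "barycentre (facet ?c) \<in> simplex_of ?c"
    using barycentre_facet(1) facet_subset assms c(3) by blast+
  have "(barycentre (facet c), barycentre (facet ?c)) \<in> glued D"
    unfolding glued_def using barycentre_facet[OF assms] partner_facet(2)[OF assms] facets_eq assms
    by (intro r_into_rtrancl CollectI exI[of _ "barycentre (facet c)"] exI[of _ "facet c"]) auto
  then have "q (barycentre (facet c)) = q (barycentre (facet ?c))"
    using b c(1,2) by (subst q_eq_iff) auto
  then show "pathin M (dual_edge D q (facet c))"
    unfolding eq using b c barycentre_simplex
    by (intro pathin_path_concat pathin_linepath) (auto simp: linepath_def)
  show "dual_edge D q (facet c) 0 = q (barycentre (simplex_of c))"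
    "dual_edge D q (facet c) 1 = q (barycentre (simplex_of ?c))"
    unfolding eq by (simp_all add: path_concat_def linepath_def)
qed

lemma dual_curve_path:
  assumes "dual_walk D \<sigma> \<tau>s \<sigma>'" "\<sigma> \<in> simplices D"
  shows "pathin M (dual_curve D q \<sigma> \<tau>s) \<and> dual_curve D q \<sigma> \<tau>s 0 = q (barycentre \<sigma>) \<and>
    dual_curve D q \<sigma> \<tau>s 1 = q (barycentre \<sigma>')"
  using assms
proof (induction \<tau>s arbitrary: \<sigma>)
  case Nil
  have "q (barycentre \<sigma>) \<in> topspace M"
    using quotient_imp_continuous_map[OF quotient] barycentre_simplex[OF Nil(2)] Nil(2)
    by (auto simp: continuous_map_def)
  then show ?case
    using Nil by (simp add: pathin_def)
next
  case (Cons \<tau> \<tau>s)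
  then obtain c where c: "c \<in> vertices \<sigma>" "\<tau> = facet c" "dual_walk D (simplex_of (step c c)) \<tau>s \<sigma>'"
    using dual_walk_Cons_iff by blast
  have cv: "c \<in> verts"
    using vertices_in_verts[OF Cons.prems(2) c(1)] .
  have eq: "dual_curve D q \<sigma> (\<tau> # \<tau>s) =
      path_concat (dual_edge D q (facet c)) (dual_curve D q (simplex_of (step c c)) \<tau>s)"
    using partner_facet[OF cv] simplex_at_facet by (simp add: c(2))
  show ?case
    unfolding eq
    using Cons.IH[OF c(3) simplex_of_step[OF Cons.prems(2) c(1)]] dual_edge_path[OF cv]
      simplex_of_vertex[OF Cons.prems(2) c(1)]
    by (auto intro!: pathin_path_concat) (auto simp: path_concat_def)
qed

lemma one_vertex_glued:
  assumes "one_vertex D q" "v \<in> verts" "w \<in> verts"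
  shows "q v = q w" "(v, w) \<in> glued D"
proof -
  have "q ` {v} \<in> singlices D q 0" if "v \<in> verts" for v
  proof -
    have "{v} face_of simplex_of v" "simplex_of v \<in> simplices D"
      using simplex_of_verts[OF that] by (auto simp: vertices_def face_of_singleton)
    then have "{v} \<in> faces_of_dim (simplices D) 0"
      unfolding faces_of_dim_def by (auto simp: aff_dim_sing)
    then show ?thesis
      unfolding singlices_def by (rule imageI)
  qed
  then have "q ` {v} \<in> singlices D q 0" "q ` {w} \<in> singlices D q 0"
    using assms by auto
  moreover obtain s where "singlices D q 0 = {s}"
    using assms(1) card_1_singletonE unfolding one_vertex_def by blast
  ultimately show qvw: "q v = q w"
    by auto
  have "x \<in> \<Union>(simplices D)" if "x \<in> verts" for x
    using simplex_of_verts[OF that] vertices_subset[of "simplex_of x"] by auto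
  then show "(v, w) \<in> glued D"
    using assms(2,3) q_eq_iff qvw by simp
qed

text \<open>The dual curve of a closed walk is a loop, so its action on partitions belongs to the
  image and is the identity. As partitions are unordered, the two parts may still be
  exchanged.\<close>

lemma trivial_partition_rep:
  assumes "\<sigma>\<^sub>0 \<in> simplices D"
    and triv: "partition_rep M D q \<sigma>\<^sub>0 k `` carrier (pi1 M q \<sigma>\<^sub>0) = {\<one>\<^bsub>BijGroup (vertex_partitions \<sigma>\<^sub>0 k)\<^esub>}"
    and walk: "dual_walk D \<sigma>\<^sub>0 \<tau>s \<sigma>\<^sub>0" and A: "A \<subseteq> vertices \<sigma>\<^sub>0" "card A = k"
  shows "walk_projectivity D \<tau>s ` A = A \<or> walk_projectivity D \<tau>s ` A = vertices \<sigma>\<^sub>0 - A"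
proof -
  let ?V = "vertices \<sigma>\<^sub>0" and ?p = "restrict (walk_projectivity D \<tau>s) (vertices \<sigma>\<^sub>0)"
  let ?c = "loop_class M (q (barycentre \<sigma>\<^sub>0)) (dual_curve D q \<sigma>\<^sub>0 \<tau>s)"
  have "?c \<in> carrier (pi1 M q \<sigma>\<^sub>0)"
    using dual_curve_path[OF walk assms(1)] by (auto simp: carrier_fundamental_group loop_at_def)
  moreover have "(?c, ?p) \<in> symmetric_rep M D q \<sigma>\<^sub>0"
    unfolding symmetric_rep_def using walk by (intro CollectI exI[of _ \<tau>s]) simp
  then have "(?c, partition_action \<sigma>\<^sub>0 k ?p) \<in> partition_rep M D q \<sigma>\<^sub>0 k"
    unfolding partition_rep_def by (intro CollectI exI[of _ ?c] exI[of _ ?p]) simp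
  ultimately have "partition_action \<sigma>\<^sub>0 k ?p \<in> partition_rep M D q \<sigma>\<^sub>0 k `` carrier (pi1 M q \<sigma>\<^sub>0)"
    by (intro ImageI)
  then have "partition_action \<sigma>\<^sub>0 k ?p = (\<lambda>P\<in>vertex_partitions \<sigma>\<^sub>0 k. P)"
    unfolding triv by (simp add: BijGroup_def)
  then have "partition_action \<sigma>\<^sub>0 k ?p {A, ?V - A} = (\<lambda>P\<in>vertex_partitions \<sigma>\<^sub>0 k. P) {A, ?V - A}"
    by (rule fun_cong)
  moreover have "{A, ?V - A} \<in> vertex_partitions \<sigma>\<^sub>0 k"
    using A by (auto simp: vertex_partitions_def)
  ultimately have "(\<lambda>A. ?p ` A) ` {A, ?V - A} = {A, ?V - A}"
    unfolding partition_action_def by (simp only: restrict_apply if_True)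
  moreover have "?p ` A \<in> (\<lambda>A. ?p ` A) ` {A, ?V - A}"
    by simp
  ultimately have "?p ` A \<in> {A, ?V - A}"
    by simp
  moreover have "?p ` A = walk_projectivity D \<tau>s ` A"
    using A by (intro image_cong) auto
  ultimately show ?thesis
    by auto
qed

end

text \<open>If \<open>g\<close> moves \<open>x\<close>, every \<open>k\<close>-set containing
  \<open>x\<close> but not \<open>g x\<close> must be mapped to its complement. For \<open>k\<close>
  = 2 comparing sizes leaves only four points, where the Klein four-group is a genuine exception.
  For larger \<open>k\<close> there is room to put \<open>y\<close> and \<open>g y\<close> into the
  set as well, for some \<open>y\<close> other than \<open>x\<close> and \<open>g x\<close>; then
  \<open>g y\<close> lies both in the set and in its complement.\<close>

lemma trivial_of_trivial_on_partitions:
  assumes V: "finite V" "bij_betw g V V" and k: "1 < k" "2 * k \<le> card V" "k = 2 \<longrightarrow> card V \<noteq> 4"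
    and g: "\<And>A. A \<subseteq> V \<Longrightarrow> card A = k \<Longrightarrow> g ` A = A \<or> g ` A = V - A"
    and x: "x \<in> V"
  shows "g x = x"
proof (rule ccontr)
  assume ne: "g x \<noteq> x"
  have gV: "g y \<in> V" if "y \<in> V" for y
    using V(2) that by (auto simp: bij_betw_def)
  have inj: "inj_on g V"
    using V(2) by (simp add: bij_betw_def)
  have extend: "\<exists>A. S \<subseteq> A \<and> A \<subseteq> V - {g x} \<and> card A = k" if "S \<subseteq> V - {g x}" "card S \<le> k" for S
  proof -
    have "k \<le> card (V - {g x})"
      using V(1) gV[OF x] k by simp
    then show ?thesis
      using exists_subset_between[OF that(2) _ that(1)] V(1) by simp
  qed
  have other: "g ` A = V - A" if "x \<in> A" "A \<subseteq> V - {g x}" "card A = k" for A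
  proof -
    have "g x \<in> g ` A" "g x \<notin> A"
      using that by auto
    then show ?thesis
      using g[of A] that by blast
  qed
  show False
  proof (cases "k = 2")
    case True
    obtain A where A: "{x} \<subseteq> A" "A \<subseteq> V - {g x}" "card A = k"
      using extend[of "{x}"] x ne k by auto
    have "card (V - A) = k"
      using other[of A] card_image[OF inj_on_subset[OF inj, of A]] A by auto
    moreover have "card (V - A) = card V - k"
      using A V(1) by (subst card_Diff_subset) (auto intro: finite_subset)
    ultimately have "card V = 4"
      using k(2) True by linarith
    then show False
      using k(3) True by blast
  next
    case False
    have "card {x, g x} \<le> 2"
      by (simp add: card_insert_if)
    then have "\<not> V \<subseteq> {x, g x}"
      using card_mono[of "{x, g x}" V] k False by auto
    then obtain y where y: "y \<in> V" "y \<noteq> x" "y \<noteq> g x"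
      by blast
    have "g y \<noteq> g x"
      using inj y x by (auto dest: inj_onD)
    moreover have "card {x, y, g y} \<le> k"
      using k False by (auto simp: card_insert_if)
    ultimately obtain A where A: "{x, y, g y} \<subseteq> A" "A \<subseteq> V - {g x}" "card A = k"
      using extend[of "{x, y, g y}"] x y ne gV[OF y(1)] by auto
    then have "g ` A = V - A" "g y \<in> g ` A"
      using other by auto
    then show False
      using A by auto
  qed
qed

section \<open>Consistent orientations of edges\<close>

definition reachable :: "('s \<Rightarrow> 's) \<Rightarrow> ('s \<Rightarrow> 's) \<Rightarrow> ('s \<times> 's) set" where
  "reachable X Y = {(s, t). t = X s \<or> t = Y s}\<^sup>*"

text \<open>The orbit of \<open>s\<close> is a cycle or a line whose edges are alternately labelled
  \<open>X\<close> and \<open>Y\<close> and whose points are alternately coloured by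
  \<open>p\<close>. A symmetry \<open>J\<close> that exchanges the labels and keeps the colours
  would be a reflection in a point of the orbit, but \<open>J\<close> has no fixed point.\<close>

lemma dihedral_not_reachable:
  fixes p :: "'s \<Rightarrow> bool"
  assumes X: "\<And>s. s \<in> \<Omega> \<Longrightarrow> X s \<in> \<Omega> \<and> X (X s) = s \<and> p (X s) \<noteq> p s"
    and Y: "\<And>s. s \<in> \<Omega> \<Longrightarrow> Y s \<in> \<Omega> \<and> Y (Y s) = s \<and> p (Y s) \<noteq> p s"
    and J: "\<And>s. s \<in> \<Omega> \<Longrightarrow> J s \<in> \<Omega> \<and> J (J s) = s \<and> J s \<noteq> s \<and> p (J s) = p s \<and> X (J s) = J (Y s) \<and> Y (J s) = J (X s)"
    and s: "s \<in> \<Omega>"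
  shows "(s, J s) \<notin> reachable X Y"
proof
  assume reach: "(s, J s) \<in> reachable X Y"
  define Z where "Z s = Y (X s)" for s
  have Z: "Z s \<in> \<Omega> \<and> X (Y (Z s)) = s \<and> Z (X (Y s)) = s \<and> X (Y s) \<in> \<Omega> \<and> p (Z s) = p s"
    if "s \<in> \<Omega>" for s
    using X[OF that] Y[OF that] X[of "Y s"] Y[of "X s"] by (auto simp: Z_def)
  have Zpow: "(Z ^^ r) s \<in> \<Omega> \<and> p ((Z ^^ r) s) = p s" if "s \<in> \<Omega>" for r s
    using that Z by (induction r) auto
  \<comment> \<open>As \<open>J\<close> conjugates \<open>Z\<close> to its inverse,
    \<open>J s\<close> being \<open>r + 2\<close> turns away from \<open>s\<close> makes
    \<open>J (Z s)\<close> only \<open>r\<close> turns away from \<open>Z s\<close>. The descent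
    ends at a fixed point of \<open>J\<close>, namely the current \<open>s\<close> or
    \<open>X s\<close>.\<close>
  have noflip: "(Z ^^ r) s \<noteq> J s" if "s \<in> \<Omega>" for r s
    using that
  proof (induction r arbitrary: s rule: induct_nat_012)
    case 0
    then show ?case
      using J[of s] by auto
  next
    case 1
    show ?case
    proof
      assume "(Z ^^ Suc 0) s = J s"
      then have "X s = J (X s)"
        using X[OF 1] Y[of "X s"] J[OF 1] by (simp add: Z_def)
      then show False
        using X[OF 1] J[of "X s"] by simp
    qed
  next
    case (ge2 r)
    show ?case
    proof
      assume "(Z ^^ Suc (Suc r)) s = J s"
      then have "Z ((Z ^^ r) (Z s)) = J s"
        by (simp add: funpow_swap1)
      then have "X (Y (J s)) = (Z ^^ r) (Z s)"
        using Z[of "(Z ^^ r) (Z s)"] Zpow[of "Z s" r] Z[OF ge2.prems] by simp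
      moreover have "X (Y (J s)) = J (Z s)"
        using J[OF ge2.prems] J[of "X s"] X[OF ge2.prems] by (simp add: Z_def)
      ultimately show False
        using ge2.IH(1)[of "Z s"] Z[OF ge2.prems] by simp
    qed
  qed
  \<comment> \<open>The two-sided orbit of \<open>s\<close> under \<open>Z\<close>, written with
    forward powers only.\<close>
  define E where "E = {t \<in> \<Omega>. \<exists>r. t = (Z ^^ r) s \<or> s = (Z ^^ r) t}"
  have E_p: "p t = p s" if "t \<in> E" for t
    using that Zpow[OF s] Zpow[of t] unfolding E_def by auto
  have E_Z: "Z t \<in> E" if tE: "t \<in> E" for t
  proof -
    have t: "t \<in> \<Omega>"
      using tE by (simp add: E_def)
    obtain r where "t = (Z ^^ r) s \<or> s = (Z ^^ r) t"
      using tE by (auto simp: E_def)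
    \<comment> \<open>If \<open>t\<close> lies ahead of \<open>s\<close>, it moves further ahead; if
      it lies behind, the distance drops by one; for \<open>r\<close> = 0 it is \<open>s\<close>
      itself.\<close>
    then have "Z t = (Z ^^ Suc r) s \<or> Z t = (Z ^^ 1) s \<or> s = (Z ^^ (r - 1)) (Z t)"
      by (cases r) (auto simp: funpow_swap1)
    then show ?thesis
      using Z[OF t] unfolding E_def by blast
  qed
  have E_XY: "X (Y t) \<in> E" if tE: "t \<in> E" for t
  proof -
    have t: "t \<in> \<Omega>"
      using tE by (simp add: E_def)
    obtain r where r: "t = (Z ^^ r) s \<or> s = (Z ^^ r) t"
      using tE by (auto simp: E_def)
    have "X (Y t) = (Z ^^ (r - 1)) s \<or> s = (Z ^^ 1) (X (Y t)) \<or> s = (Z ^^ Suc r) (X (Y t))"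
    proof (cases r)
      case 0
      then show ?thesis
        using r Z[OF t] by auto
    next
      case (Suc r')
      from r show ?thesis
      proof
        assume "t = (Z ^^ r) s"
        then show ?thesis
          using Suc Z[of "(Z ^^ r') s"] Zpow[OF s, of r'] by simp
      next
        assume "s = (Z ^^ r) t"
        then show ?thesis
          using Z[OF t] by (simp del: funpow.simps add: funpow_Suc_right)
      qed
    qed
    then show ?thesis
      using Z[OF t] unfolding E_def by blast
  qed
  \<comment> \<open>A dihedral orbit consists of the orbit of the rotations and its image under
    \<open>X\<close>. The second half has the other colour, so \<open>J s\<close> cannot lie there,
    and \<open>noflip\<close> keeps it out of the first half.\<close>
  have "t \<in> \<Omega> \<and> (t \<in> E \<or> X t \<in> E)" if "(s, t) \<in> reachable X Y" for t
    using that unfolding reachable_def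
  proof (induction rule: rtrancl_induct)
    case base
    have "s = (Z ^^ 0) s"
      by simp
    then show ?case
      using s unfolding E_def by blast
  next
    case (step t u)
    then have t: "t \<in> \<Omega>"
      by simp
    have "u = X t \<or> u = Y t"
      using step.hyps by simp
    then show ?case
    proof
      assume "u = X t"
      then show ?thesis
        using X[OF t] step.IH by auto
    next
      assume u: "u = Y t"
      from step.IH have "t \<in> E \<or> X t \<in> E"
        by simp
      then show ?thesis
      proof
        assume "t \<in> E"
        then show ?thesis
          using E_XY[of t] Y[OF t] u by simp
      next
        assume "X t \<in> E"
        then show ?thesis
          using E_Z[of "X t"] X[OF t] Y[OF t] u by (simp add: Z_def)
      qed
    qed
  qed
  from this[OF reach] have "J s \<in> E \<or> X (J s) \<in> E"
    by simp
  then show False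
  proof
    assume "J s \<in> E"
    then obtain r where "J s = (Z ^^ r) s \<or> s = (Z ^^ r) (J s)"
      by (auto simp: E_def)
    then show False
      using noflip[OF s, of r] noflip[of "J s" r] J[OF s] by auto
  next
    assume "X (J s) \<in> E"
    then have "p (X (J s)) = p s"
      by (rule E_p)
    then show False
      using J[OF s] X[of "J s"] by simp
  qed
qed

text \<open>The entries are distinct, so a unique permutation \<open>p0\<close> takes
  \<open>ls\<close> to the reference list. After permuting by \<open>r\<close> the required one is
  the inverse of \<open>r\<close> composed with \<open>p0\<close>, and signs multiply.\<close>

lemma positive_permute_list:
  assumes or: "distinct (orient D \<sigma>)" "set (orient D \<sigma>) = set ls" and ls: "distinct ls"
    and r: "r permutes {..<length ls}"
  shows "positive D \<sigma> (permute_list r ls) \<longleftrightarrow> (positive D \<sigma> ls \<longleftrightarrow> evenperm r)"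
proof -
  have "mset (orient D \<sigma>) = mset ls"
    using or ls set_eq_iff_mset_eq_distinct[of "orient D \<sigma>" ls] by simp
  then obtain p0 where p0: "p0 permutes {..<length ls}" "permute_list p0 ls = orient D \<sigma>"
    by (rule mset_eq_permutation)
  have perm: "permutation p" if "p permutes {..<length ls}" for p
    using that by (auto simp: permutation_permutes)
  have uniq: "p = p0" if p: "p permutes {..<length ls}" "permute_list p ls = orient D \<sigma>" for p
  proof
    fix i
    show "p i = p0 i"
    proof (cases "i < length ls")
      case True
      then have "ls ! p i = ls ! p0 i"
        using p p0 permute_list_nth[OF p(1) True] permute_list_nth[OF p0(1) True] by simp
      moreover have "p i < length ls" "p0 i < length ls"
        using True permutes_in_image[OF p(1), of i] permutes_in_image[OF p0(1), of i] by auto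
      ultimately show ?thesis
        using ls nth_eq_iff_index_eq by blast
    next
      case False
      then show ?thesis
        using permutes_not_in[OF p(1), of i] permutes_not_in[OF p0(1), of i] by simp
    qed
  qed
  have pos: "positive D \<sigma> ls \<longleftrightarrow> evenperm p0"
  proof
    assume "positive D \<sigma> ls"
    then obtain p where "p permutes {..<length ls}" "evenperm p" "permute_list p ls = orient D \<sigma>"
      by (auto simp: positive_def)
    then show "evenperm p0"
      using uniq by blast
  next
    assume "evenperm p0"
    then show "positive D \<sigma> ls"
      unfolding positive_def using p0 by (intro exI[of _ p0] conjI)
  qed
  have pos': "positive D \<sigma> (permute_list r ls) \<longleftrightarrow> evenperm (Hilbert_Choice.inv r \<circ> p0)"
  proof
    assume "positive D \<sigma> (permute_list r ls)"
    then obtain p where p: "p permutes {..<length ls}" "evenperm p" "permute_list p (permute_list r ls) = orient D \<sigma>"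
      by (auto simp: positive_def)
    then have "permute_list (r \<circ> p) ls = orient D \<sigma>"
      using permute_list_compose[of p ls r] by simp
    then have "r \<circ> p = p0"
      using uniq permutes_compose[OF p(1) r] by simp
    then have "Hilbert_Choice.inv r \<circ> p0 = Hilbert_Choice.inv r \<circ> (r \<circ> p)"
      by (simp only:)
    also have "\<dots> = p"
      using permutes_inverses(2)[OF r] by (simp add: fun_eq_iff)
    finally have "Hilbert_Choice.inv r \<circ> p0 = p" .
    then show "evenperm (Hilbert_Choice.inv r \<circ> p0)"
      using p(2) by simp
  next
    assume ev: "evenperm (Hilbert_Choice.inv r \<circ> p0)"
    have p: "Hilbert_Choice.inv r \<circ> p0 permutes {..<length ls}"
      using permutes_compose[OF p0(1) permutes_inv[OF r]] .
    have "permute_list (Hilbert_Choice.inv r \<circ> p0) (permute_list r ls) = permute_list (r \<circ> (Hilbert_Choice.inv r \<circ> p0)) ls"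
      using permute_list_compose[of "Hilbert_Choice.inv r \<circ> p0" ls r] p by simp
    also have "r \<circ> (Hilbert_Choice.inv r \<circ> p0) = p0"
      using permutes_inverses(1)[OF r] by (simp add: fun_eq_iff)
    also note p0(2)
    finally have eq: "permute_list (Hilbert_Choice.inv r \<circ> p0) (permute_list r ls) = orient D \<sigma>" .
    show "positive D \<sigma> (permute_list r ls)"
      unfolding positive_def
    proof (intro exI conjI)
      show "Hilbert_Choice.inv r \<circ> p0 permutes {..<length (permute_list r ls)}"
        using p by simp
    qed (fact ev eq)+
  qed
  have "evenperm (Hilbert_Choice.inv r \<circ> p0) \<longleftrightarrow> (evenperm r \<longleftrightarrow> evenperm p0)"
    using evenperm_comp[OF permutation_inverse[OF perm[OF r]] perm[OF p0(1)]] evenperm_inv[OF perm[OF r]] by metis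
  then show ?thesis
    unfolding pos pos' by blast
qed

lemma positive_swap_pairs:
  assumes "distinct (orient D \<sigma>)" "set (orient D \<sigma>) = {a, b, c, d}" "distinct [a, b, c, d]"
  shows "positive D \<sigma> [b, a, d, c] \<longleftrightarrow> positive D \<sigma> [a, b, c, d]"
proof -
  let ?r = "Transposition.transpose 0 (Suc 0) \<circ> Transposition.transpose 2 (3::nat)"
  have r: "?r permutes {..<length [a, b, c, d]}"
    by (intro permutes_compose permutes_swap_id) auto
  have "evenperm ?r"
    by (subst evenperm_comp) (auto simp: permutation_swap_id evenperm_swap)
  moreover have "permute_list ?r [a, b, c, d] = [b, a, d, c]"
    by (simp add: permute_list_def upt_rec Transposition.transpose_def numeral_2_eq_2 numeral_3_eq_3)
  ultimately show ?thesis
    using positive_permute_list[OF assms(1) _ assms(3) r] assms(2) by simp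
qed

context glued_simplices
begin

lemma orientD:
  assumes "\<sigma> \<in> simplices D"
  shows "distinct (orient D \<sigma>)" "set (orient D \<sigma>) = vertices \<sigma>"
  using gluing assms by (simp_all add: is_gluing_def)

text \<open>Induced orientations of facets list the opposite vertex first, and \<open>step c\<close>
  matches the opposite vertices. So an orientation-reversing pairing reverses whole simplices, at
  first for lists headed by \<open>c\<close>.\<close>

lemma positive_step:
  assumes n2: "2 \<le> n" and c: "c \<in> verts" and ls: "distinct ls" "set ls = vertices (simplex_of c)"
  shows "positive D (simplex_of (step c c)) (map (step c) ls) \<longleftrightarrow> \<not> positive D (simplex_of c) ls"
proof -
  let ?\<sigma> = "simplex_of c" and ?c = "step c c" and ?f = "step c"
  let ?\<sigma>' = "simplex_of ?c"
  have \<sigma>: "?\<sigma> \<in> simplices D" "c \<in> vertices ?\<sigma>" "?\<sigma>' \<in> simplices D" "?c \<in> verts"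
    using simplex_of_verts c partner_facet(1) by auto
  have bij: "bij_betw ?f (vertices ?\<sigma>) (vertices ?\<sigma>')"
    by (rule bij_betw_step[OF c])
  have lists: "distinct (map ?f ks) \<and> set (map ?f ks) = vertices ?\<sigma>'"
    if "distinct ks" "set ks = vertices ?\<sigma>" for ks
    using that bij by (auto simp: bij_betw_def distinct_map)
  have perm: "positive D ?\<sigma> (permute_list r ks) \<longleftrightarrow> (positive D ?\<sigma> ks \<longleftrightarrow> evenperm r)"
    "positive D ?\<sigma>' (map ?f (permute_list r ks)) \<longleftrightarrow> (positive D ?\<sigma>' (map ?f ks) \<longleftrightarrow> evenperm r)"
    if ks: "distinct ks" "set ks = vertices ?\<sigma>" and r: "r permutes {..<length ks}" for ks r
  proof -
    show "positive D ?\<sigma> (permute_list r ks) \<longleftrightarrow> (positive D ?\<sigma> ks \<longleftrightarrow> evenperm r)"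
      using orientD[OF \<sigma>(1)] ks r by (intro positive_permute_list) auto
    have "positive D ?\<sigma>' (permute_list r (map ?f ks)) \<longleftrightarrow> (positive D ?\<sigma>' (map ?f ks) \<longleftrightarrow> evenperm r)"
      using orientD[OF \<sigma>(3)] lists[OF ks] r by (intro positive_permute_list) auto
    then show "positive D ?\<sigma>' (map ?f (permute_list r ks)) \<longleftrightarrow> (positive D ?\<sigma>' (map ?f ks) \<longleftrightarrow> evenperm r)"
      using permute_list_map[OF r, of ?f] by simp
  qed
  have one: "\<not> positive D ?\<sigma>' (map ?f (c # vs))"
    if "positive D ?\<sigma> (c # vs)" "distinct (c # vs)" "set (c # vs) = vertices ?\<sigma>" for vs
  proof -
    have vs: "distinct vs" "set vs = vertices (facet c)"
      using that(2,3) vertices_facet[OF c] by auto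
    have eq: "map (pairing D (facet c)) vs = map ?f vs"
      using vs(2) vertices_subset[of "facet c"] by (auto simp: step_eq_pairing)
    have "\<not> positive_facet D (facet ?c) (map (pairing D (facet c)) vs)"
      using facetD(4)[OF c] that(1) vs partner_facet(2)[OF c] simplex_at_facet[OF c] opposite_facet[OF c]
      unfolding orientation_reversing_def positive_facet_def[of D "facet c"] by simp
    then show ?thesis
      unfolding eq positive_facet_def simplex_at_facet[OF \<sigma>(4)] opposite_facet[OF \<sigma>(4)] by simp
  qed
  have both: "positive D ?\<sigma>' (map ?f (c # vs)) \<longleftrightarrow> \<not> positive D ?\<sigma> (c # vs)"
    if vs: "distinct (c # vs)" "set (c # vs) = vertices ?\<sigma>" for vs
  proof
    assume "positive D ?\<sigma>' (map ?f (c # vs))"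
    then show "\<not> positive D ?\<sigma> (c # vs)"
      using one vs by blast
  next
    assume neg: "\<not> positive D ?\<sigma> (c # vs)"
    \<comment> \<open>\<open>orientation_reversing\<close> only excludes that both lists are
      positive. To exclude that both are negative, two entries after \<open>c\<close> are exchanged;
      positions 1 and 2 exist as \<open>n\<close> is at least 2.\<close>
    let ?r = "Transposition.transpose 1 (2::nat)"
    have "length (c # vs) = n + 1"
      using distinct_card[OF vs(1)] simplexD(2)[OF \<sigma>(1)] vs(2) by simp
    then have r: "?r permutes {..<length (c # vs)}"
      using n2 by (intro permutes_swap_id) auto
    have odd: "\<not> evenperm ?r"
      by (simp add: evenperm_swap)
    have "permute_list ?r (c # vs) ! 0 = c"
      using permute_list_nth[OF r, of 0] by (simp add: Transposition.transpose_def)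
    moreover have "permute_list ?r (c # vs) \<noteq> []"
      using length_permute_list[of ?r "c # vs"] by (metis list.size(3) length_Cons nat.distinct(1))
    ultimately obtain us where us: "permute_list ?r (c # vs) = c # us"
      by (cases "permute_list ?r (c # vs)") simp_all
    have "positive D ?\<sigma> (c # us)"
      using perm(1)[OF vs r] odd neg us by simp
    moreover have "distinct (c # us)" "set (c # us) = vertices ?\<sigma>"
      using vs distinct_permute_list[OF r] set_permute_list[OF r] unfolding us by simp_all
    ultimately have "\<not> positive D ?\<sigma>' (map ?f (c # us))"
      by (rule one)
    then show "positive D ?\<sigma>' (map ?f (c # vs))"
      using perm(2)[OF vs r] odd us by simp
  qed
  \<comment> \<open>A general list is reduced to one headed by \<open>c\<close>; the reordering
    affects both sides of the claim by the same sign.\<close>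
  have "mset (c # remove1 c ls) = mset ls"
    using \<sigma>(2) ls by simp
  then obtain r where r: "r permutes {..<length ls}" "permute_list r ls = c # remove1 c ls"
    by (rule mset_eq_permutation)
  have "distinct (c # remove1 c ls)" "set (c # remove1 c ls) = vertices ?\<sigma>"
    using ls distinct_permute_list[OF r(1)] set_permute_list[OF r(1)] unfolding r(2) by simp_all
  from both[OF this] show ?thesis
    using perm[OF ls r(1)] unfolding r(2) by argo
qed

end

section \<open>Signs on vertices and the gluing classes of directed edges\<close>

locale balanced_gluing = glued_simplices 3 D for D :: "'a::euclidean_space gluing" +
  fixes \<zeta> :: "'a \<Rightarrow> real"
  assumes sign: "v \<in> verts \<Longrightarrow> \<zeta> v = 1 \<or> \<zeta> v = - 1"
    and balanced: "\<sigma> \<in> simplices D \<Longrightarrow> card {v \<in> vertices \<sigma>. \<zeta> v = 1} = 2"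
    and sign_step: "c \<in> verts \<Longrightarrow> \<exists>\<epsilon>\<in>{1, - 1}. \<forall>v\<in>vertices (simplex_of c). \<zeta> (step c v) = \<epsilon> * \<zeta> v"
begin

text \<open>A state is a tetrahedron with its vertices listed, of which the first two span a
  distinguished edge; \<open>across2\<close> and \<open>across3\<close> cross the two facets that contain this edge.\<close>

definition states :: "'a list set" where
  "states = {[a, b, c, d] | a b c d. distinct [a, b, c, d] \<and> a \<in> verts \<and> vertices (simplex_of a) = {a, b, c, d}}"

definition across2 :: "'a list \<Rightarrow> 'a list" where
  "across2 s = map (step (s ! 2)) s"

definition across3 :: "'a list \<Rightarrow> 'a list" where
  "across3 s = map (step (s ! 3)) s"

text \<open>Requiring \<open>c\<close> to differ from both ends puts the edge inside the facet that
  is crossed, so these steps are actual identifications and not values of perspectivities at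
  opposite vertices.\<close>

definition edges :: "(('a \<times> 'a) \<times> ('a \<times> 'a)) set" where
  "edges = {((a, b), (step c a, step c b)) | a b c. c \<in> verts \<and> a \<in> vertices (simplex_of c) \<and>
     b \<in> vertices (simplex_of c) \<and> a \<noteq> b \<and> c \<noteq> a \<and> c \<noteq> b}"

text \<open>One of the two orientations of each class of edges is selected by choice.\<close>

definition oriented :: "('a \<times> 'a) set" where
  "oriented = {(a, b). edges\<^sup>* `` {(a, b)} = (SOME E. E \<in> {edges\<^sup>* `` {(a, b)}, edges\<^sup>* `` {(b, a)}})}"

lemma statesD:
  assumes "s \<in> states"
  shows "distinct s" "hd s \<in> verts" "vertices (simplex_of (hd s)) = set s" "length s = 4"
    and "\<And>c. c \<in> set s \<Longrightarrow> c \<in> verts \<and> simplex_of c = simplex_of (hd s)"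
proof -
  show s: "distinct s" "hd s \<in> verts" "vertices (simplex_of (hd s)) = set s" "length s = 4"
    using assms by (auto simp: states_def)
  show "c \<in> verts \<and> simplex_of c = simplex_of (hd s)" if "c \<in> set s" for c
    using that s(3) simplex_of_verts[OF s(2)] vertices_in_verts simplex_of_vertex by auto
qed

lemma statesI:
  assumes "distinct s" "hd s \<in> verts" "vertices (simplex_of (hd s)) = set s" "length s = 4"
  shows "s \<in> states"
proof -
  obtain a b c d where "s = [a, b, c, d]"
    using assms(4) by (auto simp: numeral_eq_Suc length_Suc_conv)
  then show ?thesis
    using assms unfolding states_def by auto
qed

lemma map_step_states:
  assumes s: "s \<in> states" and c: "c \<in> set s"
  shows "map (step c) s \<in> states" "map (step (step c c)) (map (step c) s) = s"
    "positive D (simplex_of (hd (map (step c) s))) (map (step c) s) \<noteq> positive D (simplex_of (hd s)) s"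
proof -
  note sD = statesD[OF s]
  have cv: "c \<in> verts" "simplex_of c = simplex_of (hd s)"
    using sD(5)[OF c] by auto
  have bij: "bij_betw (step c) (set s) (vertices (simplex_of (step c c)))"
    using bij_betw_step[OF cv(1)] sD(3) cv(2) by simp
  have "s \<noteq> []"
    using sD(4) by auto
  then have hd: "hd (map (step c) s) = step c (hd s)" "hd s \<in> set s"
    by (simp_all add: hd_map)
  have \<sigma>: "simplex_of (step c c) \<in> simplices D"
    using simplex_of_verts[OF partner_facet(1)[OF cv(1)]] by simp
  have "step c (hd s) \<in> vertices (simplex_of (step c c))"
    using bij hd(2) by (auto simp: bij_betw_def)
  then have hd': "step c (hd s) \<in> verts" "simplex_of (step c (hd s)) = simplex_of (step c c)"
    using simplex_of_vertex[OF \<sigma>] vertices_in_verts[OF \<sigma>] by auto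
  show "map (step c) s \<in> states"
  proof (rule statesI)
    show "distinct (map (step c) s)"
      using sD(1) bij by (simp add: distinct_map bij_betw_def)
    show "vertices (simplex_of (hd (map (step c) s))) = set (map (step c) s)"
      using bij unfolding hd(1) hd'(2) by (simp add: bij_betw_def)
  qed (simp_all add: hd(1) hd'(1) sD(4))
  have "step (step c c) (step c v) = v" if "v \<in> set s" for v
    using step_step[OF cv(1)] that sD(3) cv(2) by simp
  then show "map (step (step c c)) (map (step c) s) = s"
    by (simp add: map_idI)
  show "positive D (simplex_of (hd (map (step c) s))) (map (step c) s) \<noteq> positive D (simplex_of (hd s)) s"
    using positive_step[OF _ cv(1) sD(1)] sD(3) cv(2) unfolding hd(1) hd'(2) by simp
qed

text \<open>A facet through the edge is opposite to one of the two remaining vertices, so each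
  identification of edges is a move \<open>across2\<close> or \<open>across3\<close> of the
  state.\<close>

lemma edge_path_reachable:
  assumes "((a, b), (a', b')) \<in> edges\<^sup>*" "[a, b, c, d] \<in> states"
  shows "\<exists>c' d'. [a', b', c', d'] \<in> states \<and> ([a, b, c, d], [a', b', c', d']) \<in> reachable across2 across3"
  using assms(1)
proof (induction "(a', b')" arbitrary: a' b' rule: rtrancl_induct)
  case base
  then show ?case
    using assms(2) unfolding reachable_def by blast
next
  case (step p)
  obtain a1 b1 e where e: "p = (a1, b1)" "a' = step e a1" "b' = step e b1" "e \<in> verts"
    "a1 \<in> vertices (simplex_of e)" "e \<noteq> a1" "e \<noteq> b1"
    using step.hyps(2) by (auto simp: edges_def)
  obtain c1 d1 where s: "[a1, b1, c1, d1] \<in> states"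
    and reach: "([a, b, c, d], [a1, b1, c1, d1]) \<in> reachable across2 across3"
    using step.hyps(3)[OF e(1)] by blast
  have "simplex_of a1 = simplex_of e"
    using simplex_of_vertex e(5) simplex_of_verts[OF e(4)] by blast
  then have "e \<in> set [a1, b1, c1, d1]"
    using statesD(3)[OF s] simplex_of_verts[OF e(4)] by simp
  then consider "e = c1" | "e = d1"
    using e(6,7) by auto
  then have "map (step e) [a1, b1, c1, d1] = across2 [a1, b1, c1, d1] \<or>
      map (step e) [a1, b1, c1, d1] = across3 [a1, b1, c1, d1]"
    by cases (simp_all add: across2_def across3_def)
  then have "([a, b, c, d], map (step e) [a1, b1, c1, d1]) \<in> reachable across2 across3"
    using reach unfolding reachable_def by (auto intro: rtrancl_into_rtrancl)
  moreover have "map (step e) [a1, b1, c1, d1] \<in> states"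
    by (rule map_step_states(1)[OF s]) fact
  ultimately show ?case
    using e(2,3) by auto
qed

lemma sign_reachable:
  assumes "(s, t) \<in> reachable across2 across3" "s \<in> states"
  shows "t \<in> states \<and> (\<exists>\<epsilon>\<in>{1, - 1}. map \<zeta> t = map (\<lambda>v. \<epsilon> * \<zeta> v) s)"
  using assms(1) unfolding reachable_def
proof (induction rule: rtrancl_induct)
  case base
  show ?case
    using assms(2) by (intro conjI bexI[of _ 1]) auto
next
  case (step t u)
  then have t: "t \<in> states"
    by blast
  have "t ! 2 \<in> set t" "t ! 3 \<in> set t"
    using statesD(4)[OF t] by simp_all
  moreover have "u = map (step (t ! 2)) t \<or> u = map (step (t ! 3)) t"
    using step.hyps(2) by (simp add: across2_def across3_def)
  ultimately obtain e where e: "e \<in> set t" "u = map (step e) t"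
    by blast
  obtain \<epsilon> where \<epsilon>: "\<epsilon> \<in> {1, - 1}" "map \<zeta> t = map (\<lambda>v. \<epsilon> * \<zeta> v) s"
    using step.IH by blast
  obtain \<epsilon>' where \<epsilon>': "\<epsilon>' \<in> {1, - 1}" "\<forall>v\<in>set t. \<zeta> (step e v) = \<epsilon>' * \<zeta> v"
    using sign_step[of e] statesD(3)[OF t] statesD(5)[OF t e(1)] by metis
  have "map \<zeta> u = map ((*) \<epsilon>') (map \<zeta> t)"
    using \<epsilon>'(2) by (simp add: e(2))
  also have "\<dots> = map (\<lambda>v. (\<epsilon>' * \<epsilon>) * \<zeta> v) s"
    unfolding \<epsilon>(2) by (simp add: mult.assoc)
  finally show ?case
    using map_step_states(1)[OF t e(1)] \<epsilon>(1) \<epsilon>'(1) unfolding e(2)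
    by (intro conjI bexI[of _ "\<epsilon>' * \<epsilon>"]) auto
qed

lemma states_exist:
  assumes "a \<in> verts" "b \<in> vertices (simplex_of a)" "a \<noteq> b"
  obtains c d where "[a, b, c, d] \<in> states"
proof -
  have \<sigma>: "simplex_of a \<in> simplices D" "a \<in> vertices (simplex_of a)"
    using simplex_of_verts[OF assms(1)] by auto
  have "card (vertices (simplex_of a) - {a, b}) = 2"
    using simplexD(2,4)[OF \<sigma>(1)] assms \<sigma>(2) by (simp add: card_Diff_subset)
  then obtain c d where "vertices (simplex_of a) - {a, b} = {c, d}" "c \<noteq> d"
    by (auto simp: card_2_iff)
  then have "distinct [a, b, c, d]" "vertices (simplex_of a) = {a, b, c, d}"
    using assms(2,3) \<sigma>(2) by auto
  then show ?thesis
    using that assms(1) unfolding states_def by blast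
qed

text \<open>The orientation is used here: crossing a facet reverses it, while the double transposition
  of the vertices that reverses an edge preserves it.\<close>

lemma edge_not_reversed:
  assumes "a \<in> verts" "b \<in> vertices (simplex_of a)" "\<zeta> a \<noteq> \<zeta> b"
  shows "((a, b), (b, a)) \<notin> edges\<^sup>*"
proof
  assume rev: "((a, b), (b, a)) \<in> edges\<^sup>*"
  have "a \<noteq> b"
    using assms(3) by auto
  then obtain c d where s: "[a, b, c, d] \<in> states"
    using states_exist assms(1,2) by blast
  define J where "J s = [s ! 1, s ! 0, s ! 3, s ! 2]" for s :: "'a list"
  obtain c' d' where t: "[b, a, c', d'] \<in> states"
    and reach: "([a, b, c, d], [b, a, c', d']) \<in> reachable across2 across3"
    using edge_path_reachable[OF rev s] by blast
  obtain \<epsilon> where "\<epsilon> \<in> {1, - 1}"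
    and "map \<zeta> [b, a, c', d'] = map (\<lambda>v. \<epsilon> * \<zeta> v) [a, b, c, d]"
    using conjunct2[OF sign_reachable[OF reach s]] by (rule bexE)
  then have \<epsilon>: "\<epsilon> \<in> {1, - 1}" "\<zeta> b = \<epsilon> * \<zeta> a" "\<zeta> c' = \<epsilon> * \<zeta> c"
    unfolding list.map list.inject by blast+
  \<comment> \<open>Exchanging ends of different signs negates all signs along the walk. So
    \<open>c'\<close> cannot be \<open>c\<close>, must be \<open>d\<close>, and the walk realizes
    the double transposition \<open>J\<close>.\<close>
  have "\<epsilon> = - 1"
    using \<epsilon>(1,2) assms(3) by auto
  then have "\<zeta> c' = - \<zeta> c"
    using \<epsilon>(3) by simp
  moreover have "\<zeta> c = 1 \<or> \<zeta> c = - 1"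
    by (rule sign) (use statesD(5)[OF s, of c] in simp)
  ultimately have "c' \<noteq> c"
    by auto
  moreover have "{b, a, c', d'} = {a, b, c, d}"
    using statesD(3)[OF s] statesD(3)[OF t] statesD(5)[OF s, of b] by simp
  then have "{c', d'} = {c, d}"
  proof -
    assume eq: "{b, a, c', d'} = {a, b, c, d}"
    have "{c', d'} = {b, a, c', d'} - {a, b}" "{c, d} = {a, b, c, d} - {a, b}"
      using statesD(1)[OF s] statesD(1)[OF t] by auto
    then show ?thesis
      unfolding eq by simp
  qed
  ultimately have "[b, a, c', d'] = J [a, b, c, d]"
    by (auto simp: J_def doubleton_eq_iff)
  \<comment> \<open>The colour is the orientation of the list. \<open>J\<close> exchanges the last
    two entries and with them the two kinds of crossing.\<close>
  moreover have "([a, b, c, d], J [a, b, c, d]) \<notin> reachable across2 across3"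
  proof (rule dihedral_not_reachable[where \<Omega> = states and p = "\<lambda>s. positive D (simplex_of (hd s)) s"])
    fix s assume s: "s \<in> states"
    obtain a b c d where eq: "s = [a, b, c, d]"
      using s by (auto simp: states_def)
    have "step c c = across2 s ! 2" "step d d = across3 s ! 3"
      by (simp_all add: eq across2_def across3_def)
    then show "across2 s \<in> states \<and> across2 (across2 s) = s \<and>
        positive D (simplex_of (hd (across2 s))) (across2 s) \<noteq> positive D (simplex_of (hd s)) s"
      "across3 s \<in> states \<and> across3 (across3 s) = s \<and>
        positive D (simplex_of (hd (across3 s))) (across3 s) \<noteq> positive D (simplex_of (hd s)) s"
      using map_step_states[OF s, of c] map_step_states[OF s, of d]
      unfolding across2_def across3_def by (simp_all add: eq)
    have sD: "distinct [a, b, c, d]" "vertices (simplex_of a) = {a, b, c, d}" "a \<in> verts"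
      "b \<in> verts" "simplex_of b = simplex_of a" "simplex_of a \<in> simplices D"
      using statesD(1-3)[OF s] statesD(5)[OF s, of b] simplex_of_verts[of a] by (simp_all add: eq)
    have Js: "J s = [b, a, d, c]"
      by (simp add: J_def eq)
    have "J s \<in> states"
      unfolding Js by (rule statesI) (use sD in auto)
    moreover have "positive D (simplex_of b) [b, a, d, c] = positive D (simplex_of a) [a, b, c, d]"
      unfolding sD(5) by (rule positive_swap_pairs) (use sD orientD[OF sD(6)] in auto)
    ultimately show "J s \<in> states \<and> J (J s) = s \<and> J s \<noteq> s \<and>
        positive D (simplex_of (hd (J s))) (J s) = positive D (simplex_of (hd s)) s \<and>
        across2 (J s) = J (across3 s) \<and> across3 (J s) = J (across2 s)"
      using sD(1) unfolding Js by (simp add: eq J_def across2_def across3_def)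
  qed (rule s)
  ultimately show False
    using reach by simp
qed

lemma edges_symmetric:
  assumes "(p, p') \<in> edges"
  shows "(p', p) \<in> edges"
proof -
  obtain a b c where p: "p = (a, b)" "p' = (step c a, step c b)" "c \<in> verts" "a \<in> vertices (simplex_of c)"
    "b \<in> vertices (simplex_of c)" "a \<noteq> b" "c \<noteq> a" "c \<noteq> b"
    using assms by (auto simp: edges_def)
  have "inj_on (step c) (vertices (simplex_of c))" "c \<in> vertices (simplex_of c)"
    using bij_betw_step[OF p(3)] simplex_of_verts[OF p(3)] by (auto simp: bij_betw_def)
  then have "step c a \<noteq> step c b" "step c c \<noteq> step c a" "step c c \<noteq> step c b"
    using p by (auto dest: inj_onD)
  moreover have "p = (step (step c c) (step c a), step (step c c) (step c b))"
    using p step_step[OF p(3)] by simp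
  ultimately show ?thesis
    unfolding edges_def using p(2) step_in[OF p(3) p(4)] step_in[OF p(3) p(5)] partner_facet(1)[OF p(3)]
    by blast
qed

lemma edge_class_eq:
  assumes "(p, p') \<in> edges"
  shows "edges\<^sup>* `` {p} = edges\<^sup>* `` {p'}"
  using assms edges_symmetric[OF assms] by (auto intro: converse_rtrancl_into_rtrancl)

lemma oriented_step:
  assumes "c \<in> verts" "a \<in> vertices (simplex_of c)" "b \<in> vertices (simplex_of c)" "a \<noteq> b" "c \<noteq> a" "c \<noteq> b"
  shows "(step c a, step c b) \<in> oriented \<longleftrightarrow> (a, b) \<in> oriented"
proof -
  have "((a, b), (step c a, step c b)) \<in> edges" "((b, a), (step c b, step c a)) \<in> edges"
    using assms unfolding edges_def by blast+
  from this[THEN edge_class_eq] show ?thesis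
    unfolding oriented_def by simp
qed

text \<open>Both directions of an edge offer the same two-element set to the choice operator, so
  exactly one is selected once the two classes are known to differ.\<close>

lemma oriented_swap:
  assumes "a \<in> verts" "b \<in> vertices (simplex_of a)" "\<zeta> a \<noteq> \<zeta> b"
  shows "(b, a) \<in> oriented \<longleftrightarrow> (a, b) \<notin> oriented"
proof -
  let ?E = "\<lambda>p. edges\<^sup>* `` {p}"
  have "(b, a) \<in> ?E (b, a)" "(b, a) \<notin> ?E (a, b)"
    using edge_not_reversed[OF assms] by auto
  then have ne: "?E (a, b) \<noteq> ?E (b, a)"
    by blast
  define S where "S = (SOME E. E \<in> {?E (a, b), ?E (b, a)})"
  have "S \<in> {?E (a, b), ?E (b, a)}"
    unfolding S_def by (rule someI_ex) blast
  moreover have "(a, b) \<in> oriented \<longleftrightarrow> ?E (a, b) = S"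
    by (simp add: oriented_def S_def)
  moreover have "(b, a) \<in> oriented \<longleftrightarrow> ?E (b, a) = S"
    unfolding oriented_def S_def by (simp add: disj_commute)
  ultimately show ?thesis
    using ne by auto
qed

end

section \<open>The map to projective space\<close>

context balanced_gluing
begin

text \<open>The index type merely supplies four components. On a facet the third function reduces to
  the sign of the opposite vertex times the product of the coordinates of the facet. The fourth
  carries no sign, which is consistent with the ambiguity because it vanishes on all facets.\<close>

definition section_poly :: "'a set \<Rightarrow> ('a \<Rightarrow> real) \<Rightarrow> real^(bool \<times> bool)" where
  "section_poly V u = vec_lambda (\<lambda>(i, j).
     if i \<and> j then \<Sum>v\<in>V. \<zeta> v * u v
     else if i then \<Sum>a\<in>V. \<Sum>b\<in>V. of_bool (a \<noteq> b \<and> (a, b) \<in> oriented) * \<zeta> a * u a * u b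
     else if j then \<Sum>c\<in>V. \<zeta> c * (\<Prod>v\<in>V - {c}. u v)
     else \<Prod>v\<in>V. u v)"

definition sect :: "'a \<Rightarrow> real^(bool \<times> bool)" where
  "sect x = section_poly (vertices (simplex_of x)) (\<lambda>v. coord (vertices (simplex_of x)) v x)"

lemma section_poly_nth:
  "section_poly V u $ (True, True) = (\<Sum>v\<in>V. \<zeta> v * u v)"
  "section_poly V u $ (True, False) = (\<Sum>a\<in>V. \<Sum>b\<in>V. of_bool (a \<noteq> b \<and> (a, b) \<in> oriented) * \<zeta> a * u a * u b)"
  "section_poly V u $ (False, True) = (\<Sum>c\<in>V. \<zeta> c * (\<Prod>v\<in>V - {c}. u v))"
  "section_poly V u $ (False, False) = (\<Prod>v\<in>V. u v)"
  by (simp_all add: section_poly_def)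

lemma vec_bool_pair_eqI:
  assumes "\<And>i j. x $ (i, j) = y $ (i, j)"
  shows "x = (y :: real^(bool \<times> bool))"
  using assms by (simp add: vec_eq_iff)

text \<open>Terms of the second function that involve \<open>c\<close> vanish with
  \<open>u c\<close>, and the others concern edges in the facet, where \<open>oriented\<close> is
  invariant. The product of all coordinates is zero on both sides.\<close>

lemma section_poly_step:
  assumes c: "c \<in> verts" and uc: "u c = 0"
    and u': "\<And>v. v \<in> vertices (simplex_of c) \<Longrightarrow> u' (step c v) = u v"
    and \<epsilon>: "\<And>v. v \<in> vertices (simplex_of c) \<Longrightarrow> \<zeta> (step c v) = \<epsilon> * \<zeta> v"
  shows "section_poly (vertices (simplex_of (step c c))) u' = \<epsilon> *\<^sub>R section_poly (vertices (simplex_of c)) u"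
proof -
  let ?V = "vertices (simplex_of c)" and ?V' = "vertices (simplex_of (step c c))"
  have bij: "bij_betw (step c) ?V ?V'"
    by (rule bij_betw_step[OF c])
  have fin: "finite ?V" "c \<in> ?V"
    using simplexD(4) simplex_of_verts[OF c] by auto
  have inj: "step c v = step c w \<longleftrightarrow> v = w" if "v \<in> ?V" "w \<in> ?V" for v w
    using bij that by (auto simp: bij_betw_def dest: inj_onD)
  note re = sum.reindex_bij_betw[OF bij, symmetric]
  have "section_poly ?V' u' $ (True, True) = \<epsilon> * section_poly ?V u $ (True, True)"
    unfolding section_poly_nth re sum_distrib_left by (intro sum.cong refl) (simp add: u' \<epsilon>)
  moreover have "section_poly ?V' u' $ (True, False) = \<epsilon> * section_poly ?V u $ (True, False)"
    unfolding section_poly_nth re sum_distrib_left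
  proof (intro sum.cong refl)
    fix a b assume ab: "a \<in> ?V" "b \<in> ?V"
    show "of_bool (step c a \<noteq> step c b \<and> (step c a, step c b) \<in> oriented) * \<zeta> (step c a) * u' (step c a) * u' (step c b)
        = \<epsilon> * (of_bool (a \<noteq> b \<and> (a, b) \<in> oriented) * \<zeta> a * u a * u b)"
    proof (cases "a = c \<or> b = c \<or> a = b")
      case True
      then show ?thesis
        using ab uc u' by auto
    next
      case False
      then show ?thesis
        using oriented_step[OF c ab] inj[OF ab] u'[OF ab(1)] u'[OF ab(2)] \<epsilon>[OF ab(1)] by auto
    qed
  qed
  moreover have "section_poly ?V' u' $ (False, True) = \<epsilon> * section_poly ?V u $ (False, True)"
    unfolding section_poly_nth re sum_distrib_left
  proof (intro sum.cong refl)
    fix w assume w: "w \<in> ?V"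
    have "bij_betw (step c) (?V - {w}) (?V' - {step c w})"
      using bij w by (auto simp: bij_betw_def inj_on_def)
    then have "(\<Prod>v\<in>?V' - {step c w}. u' v) = (\<Prod>v\<in>?V - {w}. u' (step c v))"
      by (rule prod.reindex_bij_betw[symmetric])
    also have "\<dots> = (\<Prod>v\<in>?V - {w}. u v)"
      by (intro prod.cong refl) (simp add: u')
    finally show "\<zeta> (step c w) * (\<Prod>v\<in>?V' - {step c w}. u' v) = \<epsilon> * (\<zeta> w * (\<Prod>v\<in>?V - {w}. u v))"
      using \<epsilon>[OF w] by simp
  qed
  moreover have "section_poly ?V' u' $ (False, False) = \<epsilon> * section_poly ?V u $ (False, False)"
  proof -
    have "(\<Prod>v\<in>?V'. u' v) = (\<Prod>v\<in>?V. u' (step c v))"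
      by (rule prod.reindex_bij_betw[OF bij, symmetric])
    also have "\<dots> = (\<Prod>v\<in>?V. u v)"
      by (intro prod.cong refl) (simp add: u')
    also have "\<dots> = 0"
      using fin uc by (intro prod_zero) auto
    finally show ?thesis
      using fin uc by (auto simp: section_poly_nth)
  qed
  ultimately have "section_poly ?V' u' $ (i, j) = \<epsilon> * section_poly ?V u $ (i, j)" for i j
    by (cases i; cases j) (simp_all only:)
  then show ?thesis
    by (intro vec_bool_pair_eqI) simp
qed

text \<open>On the zero set of the first component, a point lies in the interior of a simplex, of a
  facet, or of an edge whose ends have different signs; these are detected by the other components.\<close>

lemma section_poly_nonzero:
  assumes \<sigma>: "\<sigma> \<in> simplices D" and usum: "sum u (vertices \<sigma>) = 1"
  shows "section_poly (vertices \<sigma>) u \<noteq> 0"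
proof
  let ?V = "vertices \<sigma>"
  assume "section_poly ?V u = 0"
  then have z: "section_poly ?V u $ i = 0" for i
    by simp
  note zero = z[of "(True, True)", unfolded section_poly_nth] z[of "(True, False)", unfolded section_poly_nth]
    z[of "(False, True)", unfolded section_poly_nth] z[of "(False, False)", unfolded section_poly_nth]
  have fin: "finite ?V" "card ?V = 4"
    using simplexD(2,4)[OF \<sigma>] by simp_all
  have sgn: "\<zeta> v = 1 \<or> \<zeta> v = - 1" "\<zeta> v \<noteq> 0" if "v \<in> ?V" for v
    using sign[OF vertices_in_verts[OF \<sigma> that]] by auto
  obtain d where d: "d \<in> ?V" "u d = 0"
    using zero(4) fin(1) by auto
  \<comment> \<open>Every summand that does not omit \<open>d\<close> contains the factor
    \<open>u d\<close> = 0.\<close>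
  have "(\<Sum>c\<in>?V. \<zeta> c * (\<Prod>v\<in>?V - {c}. u v)) = (\<Sum>c\<in>?V. if c = d then \<zeta> d * (\<Prod>v\<in>?V - {d}. u v) else 0)"
  proof (intro sum.cong refl)
    fix c assume "c \<in> ?V"
    have "(\<Prod>v\<in>?V - {c}. u v) = 0" if "c \<noteq> d"
      using that d fin(1) by (intro prod_zero) auto
    then show "\<zeta> c * (\<Prod>v\<in>?V - {c}. u v) = (if c = d then \<zeta> d * (\<Prod>v\<in>?V - {d}. u v) else 0)"
      by auto
  qed
  then have "\<zeta> d * (\<Prod>v\<in>?V - {d}. u v) = 0"
    using zero(3) fin(1) d(1) by simp
  then have "(\<Prod>v\<in>?V - {d}. u v) = 0"
    using sgn(2)[OF d(1)] by simp
  then obtain c where c: "c \<in> ?V" "c \<noteq> d" "u c = 0"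
    using fin(1) by (auto simp: prod_zero_iff)
  have "card (?V - {c, d}) = 2"
    using fin c d by (simp add: card_Diff_subset)
  then obtain a b where ab: "?V - {c, d} = {a, b}" "a \<noteq> b"
    by (auto simp: card_2_iff)
  then have V: "?V = {a, b, c, d}" "distinct [a, b, c, d]"
    using c d by auto
  have abV: "a \<in> ?V" "b \<in> ?V"
    using V by auto
  have one: "u a + u b = 1"
    using usum c d V(2) unfolding V(1) by simp
  have two: "\<zeta> a * u a + \<zeta> b * u b = 0"
    using zero(1) c d V(2) unfolding V(1) by simp
  \<comment> \<open>All weight is now on one edge. Equal signs there would make the first function
    plus or minus the total weight 1.\<close>
  have "\<zeta> a \<noteq> \<zeta> b"
  proof
    assume "\<zeta> a = \<zeta> b"
    then have "\<zeta> b * (u a + u b) = 0"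
      using two by (simp add: distrib_left)
    then show False
      using one sgn(2)[OF abV(2)] by simp
  qed
  moreover have "a \<in> verts" "b \<in> vertices (simplex_of a)"
    using vertices_in_verts[OF \<sigma> abV(1)] simplex_of_vertex[OF \<sigma> abV(1)] abV(2) by simp_all
  ultimately have swap: "(b, a) \<in> oriented \<longleftrightarrow> (a, b) \<notin> oriented"
    by (intro oriented_swap)
  have "of_bool ((a, b) \<in> oriented) * \<zeta> a * u a * u b + of_bool ((b, a) \<in> oriented) * \<zeta> b * u b * u a = 0"
    using zero(2) c d V(2) ab(2)[THEN not_sym] unfolding V(1) by simp
  then have "u a = 0 \<or> u b = 0"
    using swap sgn(2)[OF abV(1)] sgn(2)[OF abV(2)] by (cases "(a, b) \<in> oriented") auto
  then show False
  proof
    assume "u a = 0"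
    then show False
      using one two sgn(2)[OF abV(2)] by simp
  next
    assume "u b = 0"
    then show False
      using one two sgn(2)[OF abV(1)] by simp
  qed
qed

lemma sect_nonzero:
  assumes "\<sigma> \<in> simplices D" "x \<in> \<sigma>"
  shows "sect x \<noteq> 0"
proof -
  have "x \<in> convex hull vertices \<sigma>"
    using simplexD(3)[OF assms(1)] assms(2) by simp
  then show ?thesis
    unfolding sect_def simplex_of_eq[OF assms]
    by (intro section_poly_nonzero[OF assms(1)] convex_hull_coords(2)[OF simplexD(1)[OF assms(1)]])
qed

text \<open>Each facet pairing multiplies the section by a sign, which \<open>outer\<close> forgets;
  this is why the map descends to the quotient.\<close>

lemma sect_glued:
  assumes "(x, y) \<in> glued D"
  shows "outer (sect y) = outer (sect x)"
  using assms unfolding glued_def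
proof (induction rule: rtrancl_induct)
  case (step y z)
  then obtain c where c: "c \<in> verts" "y \<in> facet c" "z = step c y"
    using facets_eq step_eq_pairing by auto
  let ?V = "vertices (simplex_of c)" and ?V' = "vertices (simplex_of (step c c))"
  have \<sigma>: "simplex_of c \<in> simplices D" "c \<in> ?V" "simplex_of (step c c) \<in> simplices D"
    using simplex_of_verts[OF c(1)] simplex_of_verts[OF partner_facet(1)[OF c(1)]] by auto
  have y: "y \<in> simplex_of c"
    using facet_subset[OF c(1)] c(2) by (rule subsetD)
  have z: "z \<in> simplex_of (step c c)"
    unfolding c(3) using facet_subset[OF partner_facet(1)[OF c(1)]] step_facet(1)[OF c(1,2)] by (rule subsetD)
  note yz = simplex_of_eq[OF \<sigma>(1) y] simplex_of_eq[OF \<sigma>(3) z]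
  obtain \<epsilon> where \<epsilon>: "\<epsilon> \<in> {1, - 1}" "\<forall>v\<in>?V. \<zeta> (step c v) = \<epsilon> * \<zeta> v"
    using sign_step[OF c(1)] by (rule bexE)
  have "sect z = \<epsilon> *\<^sub>R sect y"
    unfolding sect_def yz
  proof (rule section_poly_step[OF c(1)])
    show "coord ?V c y = 0"
      using coord_face_eq_0[OF simplexD(1)[OF \<sigma>(1)] \<sigma>(2)] c(2) by (simp add: facet_def)
    show "coord ?V' (step c v) z = coord ?V v y" if "v \<in> ?V" for v
      unfolding c(3) by (rule coord_step[OF c(1,2) that])
    show "\<zeta> (step c v) = \<epsilon> * \<zeta> v" if "v \<in> ?V" for v
      using \<epsilon>(2) that by simp
  qed
  then have "sect z = sect y \<or> sect z = - sect y"
    using \<epsilon>(1) by auto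
  then show ?case
    using step.IH unfolding outer_eq_iff[symmetric] by simp
qed simp

lemma continuous_on_sect: "continuous_on (\<Union>(simplices D)) sect"
proof (rule continuous_on_closed_Union[where U = "\<lambda>\<sigma>. \<sigma>", unfolded image_ident])
  show "finite (simplices D)"
    using gluing by (simp add: is_gluing_def)
  fix \<sigma> assume \<sigma>: "\<sigma> \<in> simplices D"
  have "compact (convex hull vertices \<sigma>)"
    by (rule finite_imp_compact_convex_hull[OF simplexD(4)[OF \<sigma>]])
  then show "closed \<sigma>"
    unfolding simplexD(3)[OF \<sigma>] by (rule compact_imp_closed)
  have coord: "continuous_on \<sigma> (\<lambda>x. coord (vertices \<sigma>) v x)" if "v \<in> vertices \<sigma>" for v
    using continuous_on_coord[OF simplexD(1)[OF \<sigma>] that] .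
  have "continuous_on \<sigma> (\<lambda>x. section_poly (vertices \<sigma>) (\<lambda>v. coord (vertices \<sigma>) v x) $ (i, j))" for i j
    by (cases i; cases j; simp only: section_poly_nth; intro continuous_intros coord) auto
  then have "continuous_on \<sigma> (\<lambda>x. section_poly (vertices \<sigma>) (\<lambda>v. coord (vertices \<sigma>) v x))"
    by (subst vec_lambda_eta[symmetric], intro continuous_on_vec_lambda) auto
  then show "continuous_on \<sigma> sect"
    by (rule continuous_on_eq) (simp add: sect_def simplex_of_eq[OF \<sigma>])
qed

text \<open>At a vertex only the linear function survives. All vertices thus lie over the same
  projective point, and their signs can be compared through one fixed vector.\<close>

lemma sect_vertex:
  assumes "\<sigma> \<in> simplices D" "a \<in> vertices \<sigma>"
  shows "sect a = \<zeta> a *\<^sub>R axis (True, True) 1"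
proof -
  let ?V = "vertices \<sigma>"
  have fin: "finite ?V" "card ?V = 4"
    using simplexD(2,4)[OF assms(1)] by simp_all
  have "sect a = section_poly ?V (\<lambda>v. of_bool (v = a))"
    unfolding sect_def simplex_of_vertex[OF assms]
    by (rule vec_bool_pair_eqI)
      (auto simp: section_poly_def coord_vertex[OF simplexD(1)[OF assms(1)] _ assms(2)] intro!: sum.cong prod.cong)
  also have "\<dots> = \<zeta> a *\<^sub>R axis (True, True) 1"
  proof (rule vec_bool_pair_eqI)
    fix i j
    have prod0: "(\<Prod>v\<in>W. of_bool (v = a)) = (0::real)" if W: "W \<subseteq> ?V" "1 < card W" for W
    proof -
      have "\<not> W \<subseteq> {a}"
        using card_mono[of "{a}" W] W(2) by auto
      then obtain w where "w \<in> W" "w \<noteq> a"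
        by blast
      then show ?thesis
        using finite_subset[OF W(1) fin(1)] by (intro prod_zero) auto
    qed
    let ?u = "\<lambda>v. of_bool (v = a)"
    have "section_poly ?V ?u $ (True, True) = (\<Sum>v\<in>?V. if v = a then \<zeta> a else 0)"
      unfolding section_poly_nth by (intro sum.cong) auto
    then have "section_poly ?V ?u $ (True, True) = \<zeta> a"
      using fin(1) assms(2) by simp
    moreover have "section_poly ?V ?u $ (True, False) = 0"
      unfolding section_poly_nth by (intro sum.neutral ballI) auto
    moreover have "(\<Prod>v\<in>?V - {c}. ?u v) = (0::real)" for c
      using fin by (intro prod0) (auto simp: card_Diff_singleton_if)
    then have "section_poly ?V ?u $ (False, True) = 0"
      unfolding section_poly_nth by (intro sum.neutral ballI) simp
    moreover have "section_poly ?V ?u $ (False, False) = 0"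
      unfolding section_poly_nth using fin by (intro prod0) simp_all
    ultimately show "section_poly ?V ?u $ (i, j) = (\<zeta> a *\<^sub>R axis (True, True) 1) $ (i, j)"
      by (cases i; cases j) (simp_all add: axis_def)
  qed
  finally show ?thesis .
qed

end

text \<open>The loop consists of two segments inside \<sigma>, and along a segment in one simplex
  the section itself is a lift. Its parity therefore compares the sections at \<open>a\<close> and
  \<open>b\<close>, which are \<zeta>(a) and \<zeta>(b) times the same vector.\<close>

lemma line_field_of_signs:
  fixes D :: "'a::euclidean_space gluing" and M :: "'m topology" and q :: "'a \<Rightarrow> 'm"
  assumes "triangulated 3 D M q" "balanced_gluing D \<zeta>"
  obtains F :: "'m \<Rightarrow> real^(bool \<times> bool)^(bool \<times> bool)" where "line_field M F"
    "\<And>\<sigma> a b. \<sigma> \<in> simplices D \<Longrightarrow> a \<in> vertices \<sigma> \<Longrightarrow> b \<in> vertices \<sigma> \<Longrightarrow> q a = q b \<Longrightarrow>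
      line_field.parity F (path_concat (q \<circ> linepath (barycentre \<sigma>) a) (q \<circ> linepath b (barycentre \<sigma>)))
      \<longleftrightarrow> \<zeta> a \<noteq> \<zeta> b"
proof -
  interpret T: triangulated 3 D M q by fact
  interpret B: balanced_gluing D \<zeta> by fact
  let ?U = "\<Union>(simplices D)"
  define F where "F y = outer (B.sect (SOME x. x \<in> ?U \<and> q x = y))" for y
  have F: "F (q x) = outer (B.sect x)" if "x \<in> ?U" for x
  proof -
    define x' where "x' = (SOME z. z \<in> ?U \<and> q z = q x)"
    have "x' \<in> ?U \<and> q x' = q x"
      unfolding x'_def by (rule someI[of _ x]) (use that in simp)
    then have "(x, x') \<in> glued D"
      using T.q_eq_iff[OF that, of x'] by simp
    then show ?thesis
      unfolding F_def x'_def[symmetric] by (rule B.sect_glued)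
  qed
  have "continuous_on ?U (outer \<circ> B.sect)"
    by (rule continuous_on_compose[OF B.continuous_on_sect continuous_on_outer])
  then have "continuous_on ?U (F \<circ> q)"
    by (rule continuous_on_eq) (simp add: F)
  then have "continuous_map M euclidean F"
    using continuous_compose_quotient_map_eq[OF T.quotient, of euclidean F] by simp
  moreover have "\<exists>w. w \<noteq> 0 \<and> outer w = F y" if y: "y \<in> topspace M" for y
  proof -
    have "q ` ?U = topspace M"
      using quotient_imp_surjective_map[OF T.quotient] by simp
    then obtain x where x: "x \<in> ?U" "y = q x"
      using y by blast
    then show ?thesis
      using F[OF x(1)] B.sect_nonzero by (intro exI[of _ "B.sect x"]) auto
  qed
  ultimately interpret L: line_field M F
    by unfold_locales
  \<comment> \<open>Both barycentre contributions of the two segments will cancel, so neither the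
    section nor \<open>ref\<close> needs to be known there.\<close>
  have lift: "L.parity (q \<circ> linepath x y) \<longleftrightarrow> (B.sect x = L.ref (q x)) \<noteq> (B.sect y = L.ref (q y))"
    if \<sigma>: "\<sigma> \<in> simplices D" "x \<in> \<sigma>" "y \<in> \<sigma>" for \<sigma> x y
  proof -
    have "convex \<sigma>"
      using T.simplexD(3)[OF \<sigma>(1)] convex_convex_hull by metis
    then have im: "linepath x y ` {0..1} \<subseteq> \<sigma>"
      using \<sigma> by (auto simp: linepath_def convexD_alt)
    have "continuous_on {0..1} (B.sect \<circ> linepath x y)"
    proof (rule continuous_on_compose)
      show "continuous_on (linepath x y ` {0..1}) B.sect"
        using continuous_on_subset[OF B.continuous_on_sect] im \<sigma>(1) by blast
    qed (rule continuous_on_linepath)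
    moreover have "outer (B.sect (linepath x y t)) = F (q (linepath x y t))" if "t \<in> {0..1}" for t
      using im \<sigma>(1) that by (intro F[symmetric]) blast
    ultimately have "L.lifts {0..1} (q \<circ> linepath x y) (B.sect \<circ> linepath x y)"
      by (simp add: L.lifts_def)
    from L.parity_lift[OF T.pathin_linepath[OF \<sigma>] this] show ?thesis
      by (simp add: linepath_def)
  qed
  have "L.parity (path_concat (q \<circ> linepath (barycentre \<sigma>) a) (q \<circ> linepath b (barycentre \<sigma>))) \<longleftrightarrow> \<zeta> a \<noteq> \<zeta> b"
    if \<sigma>: "\<sigma> \<in> simplices D" and ab: "a \<in> vertices \<sigma>" "b \<in> vertices \<sigma>" "q a = q b" for \<sigma> a b
  proof -
    note x0 = T.barycentre_simplex[OF \<sigma>]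
    have in\<sigma>: "a \<in> \<sigma>" "b \<in> \<sigma>"
      using ab T.vertices_subset by blast+
    have par: "L.parity (path_concat (q \<circ> linepath (barycentre \<sigma>) a) (q \<circ> linepath b (barycentre \<sigma>)))
        \<longleftrightarrow> (B.sect a = L.ref (q a)) \<noteq> (B.sect b = L.ref (q a))"
      using L.parity_path_concat[OF T.pathin_linepath[OF \<sigma> x0 in\<sigma>(1)] T.pathin_linepath[OF \<sigma> in\<sigma>(2) x0]]
        lift[OF \<sigma> x0 in\<sigma>(1)] lift[OF \<sigma> in\<sigma>(2) x0] ab(3)
      by (auto simp: linepath_def)
    let ?e = "axis (True, True) 1 :: real^(bool \<times> bool)"
    have sect: "B.sect a = \<zeta> a *\<^sub>R ?e" "B.sect b = \<zeta> b *\<^sub>R ?e"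
      using B.sect_vertex[OF \<sigma>] ab by auto
    have sgn: "\<zeta> a = 1 \<or> \<zeta> a = - 1" "\<zeta> b = 1 \<or> \<zeta> b = - 1"
      using B.sign T.vertices_in_verts[OF \<sigma>] ab by auto
    have "q a \<in> topspace M"
      using quotient_imp_surjective_map[OF T.quotient] in\<sigma>(1) \<sigma> by auto
    then have "outer (L.ref (q a)) = outer (B.sect a)"
      using L.outer_ref F[of a] in\<sigma>(1) \<sigma> by auto
    then have ref: "L.ref (q a) = ?e \<or> L.ref (q a) = - ?e"
      using sgn(1) unfolding outer_eq_iff sect by auto
    have ne: "?e \<noteq> - ?e"
      by (auto simp: vec_eq_iff axis_def)
    show ?thesis
      unfolding par sect using sgn ref ne ne[symmetric] by auto
  qed
  with that[OF L.line_field_axioms] show ?thesis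
    by blast
qed

section \<open>Transporting an invariant partition to all tetrahedra\<close>

context triangulated
begin

text \<open>With one vertex class, any vertex of the first simplex is glued to any vertex of the
  second, and the chain of gluings is a walk.\<close>

lemma walk_from:
  assumes "one_vertex D q" "\<sigma> \<in> simplices D" "\<sigma>' \<in> simplices D"
  obtains \<tau>s where "dual_walk D \<sigma> \<tau>s \<sigma>'"
proof -
  have "vertices \<sigma> \<noteq> {}" "vertices \<sigma>' \<noteq> {}"
    using simplexD(2)[OF assms(2)] simplexD(2)[OF assms(3)] by auto
  then obtain v w where vw: "v \<in> vertices \<sigma>" "w \<in> vertices \<sigma>'"
    by blast
  then have "(v, w) \<in> glued D" "v \<in> verts"
    using one_vertex_glued(2)[OF assms(1)] vertices_in_verts assms(2,3) by auto
  from glued_vertices_walk[OF this] show ?thesis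
    using that simplex_of_vertex[OF assms(2) vw(1)] simplex_of_vertex[OF assms(3) vw(2)] by auto
qed

lemma closed_walk_transitive:
  assumes "one_vertex D q" "\<sigma> \<in> simplices D" "v \<in> vertices \<sigma>" "w \<in> vertices \<sigma>"
  obtains \<tau>s where "dual_walk D \<sigma> \<tau>s \<sigma>" "walk_projectivity D \<tau>s v = w"
proof -
  have "v \<in> verts" "w \<in> verts"
    using vertices_in_verts[OF assms(2)] assms(3,4) by auto
  then have "\<exists>\<tau>s. dual_walk D (simplex_of v) \<tau>s (simplex_of w) \<and> walk_projectivity D \<tau>s v = w"
    using glued_vertices_walk[OF one_vertex_glued(2)[OF assms(1)]] by blast
  then show ?thesis
    using that unfolding simplex_of_vertex[OF assms(2,3)] simplex_of_vertex[OF assms(2,4)] by blast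
qed

text \<open>The set \<open>A\<close> is carried to every tetrahedron along a chosen walk. Another
  walk differs from it by a closed walk at \<open>\<sigma>\<^sub>0\<close>, which can at most
  exchange \<open>A\<close> with its complement, so the signs are canonical up to one global sign
  per tetrahedron.\<close>

lemma signs_exist:
  assumes n3: "n = 3" and ov: "one_vertex D q" and \<sigma>\<^sub>0: "\<sigma>\<^sub>0 \<in> simplices D"
    and A: "A \<subseteq> vertices \<sigma>\<^sub>0" "card A = 2"
    and inv: "\<And>\<tau>s. dual_walk D \<sigma>\<^sub>0 \<tau>s \<sigma>\<^sub>0 \<Longrightarrow>
      walk_projectivity D \<tau>s ` A = A \<or> walk_projectivity D \<tau>s ` A = vertices \<sigma>\<^sub>0 - A"
  obtains \<zeta> where "balanced_gluing D \<zeta>"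
    "\<And>a b. a \<in> vertices \<sigma>\<^sub>0 \<Longrightarrow> b \<in> vertices \<sigma>\<^sub>0 \<Longrightarrow> \<zeta> a = \<zeta> b \<longleftrightarrow> (a \<in> A \<longleftrightarrow> b \<in> A)"
proof -
  let ?V\<^sub>0 = "vertices \<sigma>\<^sub>0"
  define w where "w \<sigma> = (SOME \<tau>s. dual_walk D \<sigma>\<^sub>0 \<tau>s \<sigma>)" for \<sigma>
  define g where "g \<sigma> = walk_projectivity D (w \<sigma>)" for \<sigma>
  define \<zeta> :: "'a \<Rightarrow> real" where "\<zeta> v = (if v \<in> g (simplex_of v) ` A then 1 else - 1)" for v
  have w: "dual_walk D \<sigma>\<^sub>0 (w \<sigma>) \<sigma>" if \<sigma>: "\<sigma> \<in> simplices D" for \<sigma>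
  proof -
    obtain \<tau>s where "dual_walk D \<sigma>\<^sub>0 \<tau>s \<sigma>"
      by (rule walk_from[OF ov \<sigma>\<^sub>0 \<sigma>])
    then show ?thesis
      unfolding w_def by (rule someI)
  qed
  have g: "bij_betw (g \<sigma>) ?V\<^sub>0 (vertices \<sigma>)" if "\<sigma> \<in> simplices D" for \<sigma>
    unfolding g_def using dual_walk_bij_betw[OF w[OF that] \<sigma>\<^sub>0] by simp
  have \<zeta>_eq: "\<zeta> v = (if v \<in> g \<sigma> ` A then 1 else - 1)" if "\<sigma> \<in> simplices D" "v \<in> vertices \<sigma>" for \<sigma> v
    using simplex_of_vertex[OF that] by (simp add: \<zeta>_def)
  have "balanced_gluing D \<zeta>"
  proof (unfold_locales)
    show "is_gluing 3 D" "(1::nat) \<le> 3"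
      using gluing n3 by simp_all
    show "\<zeta> v = 1 \<or> \<zeta> v = - 1" for v
      by (simp add: \<zeta>_def)
    show "card {v \<in> vertices \<sigma>. \<zeta> v = 1} = 2" if "\<sigma> \<in> simplices D" for \<sigma>
    proof -
      have "g \<sigma> ` A \<subseteq> vertices \<sigma>" "inj_on (g \<sigma>) A"
        using g[OF that] A(1) by (auto simp: bij_betw_def intro: inj_on_subset)
      moreover have "{v \<in> vertices \<sigma>. \<zeta> v = 1} = vertices \<sigma> \<inter> g \<sigma> ` A"
        using \<zeta>_eq[OF that] by (auto split: if_splits)
      ultimately show ?thesis
        using A(2) by (simp add: Int_absorb1 card_image)
    qed
  next
    fix c assume "c \<in> glued_simplices.verts D"
    then have c: "c \<in> verts" .
    let ?\<sigma> = "simplex_of c" and ?\<sigma>' = "simplex_of (step c c)"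
    have \<sigma>: "?\<sigma> \<in> simplices D" "c \<in> vertices ?\<sigma>" "?\<sigma>' \<in> simplices D"
      using simplex_of_verts[OF c] simplex_of_verts[OF partner_facet(1)[OF c]] by auto
    obtain us where us: "dual_walk D ?\<sigma>' us \<sigma>\<^sub>0"
      "\<And>v. v \<in> ?V\<^sub>0 \<Longrightarrow> walk_projectivity D us (g ?\<sigma>' v) = v"
      using dual_walk_reverse[OF w[OF \<sigma>(3)] \<sigma>\<^sub>0] unfolding g_def by blast
    let ?p = "walk_projectivity D us"
    have "dual_walk D ?\<sigma> [facet c] ?\<sigma>'"
      unfolding dual_walk_Cons_iff[OF \<sigma>(1)] using \<sigma>(2) by (intro bexI[of _ c]) simp_all
    then have "dual_walk D \<sigma>\<^sub>0 (w ?\<sigma> @ [facet c] @ us) \<sigma>\<^sub>0"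
      using w[OF \<sigma>(1)] us(1) unfolding dual_walk_append by blast
    then have walk: "(?p \<circ> step c \<circ> g ?\<sigma>) ` A = A \<or> (?p \<circ> step c \<circ> g ?\<sigma>) ` A = ?V\<^sub>0 - A"
      using inv[of "w ?\<sigma> @ [facet c] @ us"] by (simp add: walk_projectivity_append perspectivity_facet g_def comp_assoc)
    \<comment> \<open>The projectivity of the closed walk that goes to the simplex of
      \<open>c\<close>, crosses the facet and returns along the walk chosen for the
      neighbour.\<close>
    define h where "h = ?p \<circ> step c \<circ> g ?\<sigma>"
    have "bij_betw ?p (vertices ?\<sigma>') ?V\<^sub>0"
      using dual_walk_bij_betw[OF us(1) \<sigma>(3)] by simp
    then have h: "bij_betw h ?V\<^sub>0 ?V\<^sub>0"
      unfolding h_def using g[OF \<sigma>(1)] bij_betw_step[OF c] by (intro bij_betw_trans)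
    have g_in: "g \<sigma> x \<in> g \<sigma> ` A \<longleftrightarrow> x \<in> A" if "\<sigma> \<in> simplices D" "x \<in> ?V\<^sub>0" for \<sigma> x
      using inj_on_image_mem_iff[OF bij_betw_imp_inj_on[OF g[OF that(1)]] that(2) A(1)] .
    have transport: "step c (g ?\<sigma> x) \<in> g ?\<sigma>' ` A \<longleftrightarrow> h x \<in> A" if x: "x \<in> ?V\<^sub>0" for x
    proof -
      have "step c (g ?\<sigma> x) \<in> vertices ?\<sigma>'"
        using step_in[OF c] g[OF \<sigma>(1)] x by (auto simp: bij_betw_def)
      then obtain y where y: "y \<in> ?V\<^sub>0" "step c (g ?\<sigma> x) = g ?\<sigma>' y"
        using g[OF \<sigma>(3)] by (auto simp: bij_betw_def)
      have "h x = y"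
        using us(2)[OF y(1)] y(2) by (simp add: h_def)
      then show ?thesis
        unfolding y(2) using g_in[OF \<sigma>(3) y(1)] by simp
    qed
    have h_in: "h x \<in> h ` A \<longleftrightarrow> x \<in> A" "h x \<in> ?V\<^sub>0" if "x \<in> ?V\<^sub>0" for x
      using inj_on_image_mem_iff[OF bij_betw_imp_inj_on[OF h] that A(1)] h that by (auto simp: bij_betw_def)
    \<comment> \<open>The crossing changes the sign exactly if the closed walk exchanges the two
      parts.\<close>
    define \<epsilon> :: real where "\<epsilon> = (if h ` A = A then 1 else - 1)"
    have "\<zeta> (step c v) = \<epsilon> * \<zeta> v" if v: "v \<in> vertices ?\<sigma>" for v
    proof -
      obtain x where x: "x \<in> ?V\<^sub>0" "v = g ?\<sigma> x"
        using g[OF \<sigma>(1)] v by (auto simp: bij_betw_def)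
      have "\<zeta> (step c v) = (if h x \<in> A then 1 else - 1)"
        using \<zeta>_eq[OF \<sigma>(3) step_in[OF c v]] transport[OF x(1)] x(2) by simp
      moreover have "\<zeta> v = (if x \<in> A then 1 else - 1)"
        using \<zeta>_eq[OF \<sigma>(1) v] g_in[OF \<sigma>(1) x(1)] x(2) by simp
      moreover have "h x \<in> A \<longleftrightarrow> (x \<in> A \<longleftrightarrow> h ` A = A)"
      proof (cases "h ` A = A")
        case True
        then show ?thesis
          using h_in(1)[OF x(1)] by simp
      next
        case False
        then have "h ` A = ?V\<^sub>0 - A"
          using walk by (simp add: h_def)
        then show ?thesis
          using h_in[OF x(1)] False by blast
      qed
      ultimately show ?thesis
        by (simp add: \<epsilon>_def)
    qed
    then show "\<exists>\<epsilon>\<in>{1, - 1}. \<forall>v\<in>vertices (simplex_of c). \<zeta> (step c v) = \<epsilon> * \<zeta> v"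
      by (intro bexI[of _ \<epsilon>]) (auto simp: \<epsilon>_def)
  qed
  moreover have "\<zeta> a = \<zeta> b \<longleftrightarrow> (a \<in> A \<longleftrightarrow> b \<in> A)" if ab: "a \<in> ?V\<^sub>0" "b \<in> ?V\<^sub>0" for a b
  proof -
    \<comment> \<open>The walk chosen from \<open>\<sigma>\<^sub>0\<close> to itself may be nonempty
      and exchange the parts; comparing two signs is insensitive to this.\<close>
    have "g \<sigma>\<^sub>0 ` A = A \<or> g \<sigma>\<^sub>0 ` A = ?V\<^sub>0 - A"
      unfolding g_def by (rule inv[OF w[OF \<sigma>\<^sub>0]])
    then show ?thesis
      unfolding \<zeta>_eq[OF \<sigma>\<^sub>0 ab(1)] \<zeta>_eq[OF \<sigma>\<^sub>0 ab(2)] using ab by auto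
  qed
  ultimately show ?thesis
    using that by blast
qed

end

section \<open>Two loops told apart by two partitions\<close>

theorem corollary21:
  fixes M :: "'m topology"
    and D :: "'a::euclidean_space gluing"
    and q :: "'a \<Rightarrow> 'm"
    and \<sigma>\<^sub>0 :: "'a set"
    and n k :: nat
  assumes "n \<ge> 3"
    and "closed_manifold n M"
    and "is_triangulation n M D q"
    and "even_triangulation n D q"
    and "one_vertex D q"
    and "\<sigma>\<^sub>0 \<in> simplices D"
    and "1 < k" and "real k \<le> (real n + 1) / 2"
    and "partition_rep M D q \<sigma>\<^sub>0 k `` carrier (pi1 M q \<sigma>\<^sub>0)
           = {\<one>\<^bsub>BijGroup (vertex_partitions \<sigma>\<^sub>0 k)\<^esub>}"
  shows "enat k \<le> mod2_rank (mod2_homology_group 1 M) \<and> \<not> cyclic_group (pi1 M q \<sigma>\<^sub>0)"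
proof -
  interpret triangulated n D M q
    using assms(1,3) by unfold_locales (auto simp: is_triangulation_def)
  let ?V = "vertices \<sigma>\<^sub>0" and ?x = "q (barycentre \<sigma>\<^sub>0)"
  have V: "finite ?V" "card ?V = n + 1"
    using simplexD[OF assms(6)] by auto
  have "real (2 * k) \<le> real (n + 1)"
    using assms(8) by simp
  then have k: "2 * k \<le> card ?V"
    unfolding V(2) by (simp only: of_nat_le_iff)
  note triv = trivial_partition_rep[OF assms(6,9)]
  have nk: "n = 3" "k = 2"
  proof -
    have "?V \<noteq> {}"
      using V(2) by auto
    then obtain v where v: "v \<in> ?V"
      by blast
    have "\<not> ?V \<subseteq> {v}"
      using card_mono[of "{v}" ?V] V(2) assms(1) by auto
    then obtain w where w: "w \<in> ?V" "w \<noteq> v"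
      by blast
    obtain \<tau>s where \<tau>s: "dual_walk D \<sigma>\<^sub>0 \<tau>s \<sigma>\<^sub>0" "walk_projectivity D \<tau>s v = w"
      by (rule closed_walk_transitive[OF assms(5,6) v w(1)])
    \<comment> \<open>Outside the exceptional case every closed walk would fix \<open>v\<close>,
      although this one moves it to \<open>w\<close>.\<close>
    have "\<not> (k = 2 \<longrightarrow> card ?V \<noteq> 4)"
    proof
      assume "k = 2 \<longrightarrow> card ?V \<noteq> 4"
      then have "walk_projectivity D \<tau>s v = v"
        using trivial_of_trivial_on_partitions[OF V(1) _ assms(7) k _ triv[OF \<tau>s(1)] v]
          dual_walk_bij_betw[OF \<tau>s(1) assms(6)] by blast
      then show False
        using \<tau>s(2) w(2) by simp
    qed
    then show "n = 3" "k = 2"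
      using V(2) by auto
  qed
  have tri: "triangulated 3 D M q"
    using triangulated_axioms nk(1) by simp
  obtain s where "?V = set s" "distinct s" "length s = 4"
    using finite_distinct_list[OF V(1)] V(2) nk(1) distinct_card by fastforce
  then obtain a b c d where abcd: "?V = {a, b, c, d}" "distinct [a, b, c, d]"
    by (auto simp: numeral_eq_Suc length_Suc_conv)
  have in_V: "a \<in> ?V" "b \<in> ?V" "c \<in> ?V"
    using abcd(1) by auto
  have qeq: "q a = q v" if "v \<in> ?V" for v
    using one_vertex_glued(1)[OF assms(5)] vertices_in_verts[OF assms(6)] in_V(1) that by blast
  define \<gamma> where "\<gamma> v = path_concat (q \<circ> linepath (barycentre \<sigma>\<^sub>0) a) (q \<circ> linepath v (barycentre \<sigma>\<^sub>0))" for v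
  have loop: "loop_at M ?x (\<gamma> v)" if "v \<in> ?V" for v
  proof -
    have "pathin M (\<gamma> v)"
      unfolding \<gamma>_def using barycentre_simplex[OF assms(6)] vertices_subset[of \<sigma>\<^sub>0] in_V(1) that qeq[OF that]
      by (intro pathin_path_concat pathin_linepath[OF assms(6)]) (auto simp: linepath_def)
    then show ?thesis
      by (simp add: loop_at_def \<gamma>_def path_concat_def linepath_def)
  qed
  have parity: "\<exists>F :: 'm \<Rightarrow> real^(bool \<times> bool)^(bool \<times> bool). line_field M F \<and>
      (\<forall>v\<in>?V. line_field.parity F (\<gamma> v) \<longleftrightarrow> v \<notin> A)" if A: "A \<subseteq> ?V" "card A = 2" "a \<in> A" for A
  proof -
    have "walk_projectivity D \<tau>s ` A = A \<or> walk_projectivity D \<tau>s ` A = ?V - A"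
      if "dual_walk D \<sigma>\<^sub>0 \<tau>s \<sigma>\<^sub>0" for \<tau>s
      using triv[OF that A(1)] A(2) nk(2) by simp
    from signs_exist[OF nk(1) assms(5,6) A(1,2) this] obtain \<zeta> where \<zeta>: "balanced_gluing D \<zeta>"
      "\<And>u v. u \<in> ?V \<Longrightarrow> v \<in> ?V \<Longrightarrow> \<zeta> u = \<zeta> v \<longleftrightarrow> (u \<in> A \<longleftrightarrow> v \<in> A)"
      by blast
    obtain F :: "'m \<Rightarrow> real^(bool \<times> bool)^(bool \<times> bool)" where F: "line_field M F"
      "\<And>\<sigma> u v. \<sigma> \<in> simplices D \<Longrightarrow> u \<in> vertices \<sigma> \<Longrightarrow> v \<in> vertices \<sigma> \<Longrightarrow> q u = q v \<Longrightarrow>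
        line_field.parity F (path_concat (q \<circ> linepath (barycentre \<sigma>) u) (q \<circ> linepath v (barycentre \<sigma>)))
        \<longleftrightarrow> \<zeta> u \<noteq> \<zeta> v"
      by (rule line_field_of_signs[OF tri \<zeta>(1)]) blast
    have "line_field.parity F (\<gamma> v) \<longleftrightarrow> v \<notin> A" if "v \<in> ?V" for v
      unfolding \<gamma>_def F(2)[OF assms(6) in_V(1) that qeq[OF that]] using \<zeta>(2)[OF in_V(1) that] A(3) by simp
    with F(1) show ?thesis
      by blast
  qed
  \<comment> \<open>With respect to \<open>a\<close>, the vertex \<open>b\<close> changes sides only
    in the first partition and \<open>c\<close> only in the second, so the loops to \<open>a\<close>
    and back from \<open>b\<close> or \<open>c\<close> have parities (1, 0) and (0, 1).\<close>
  obtain F F' :: "'m \<Rightarrow> real^(bool \<times> bool)^(bool \<times> bool)"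
    where F: "line_field M F" "\<forall>v\<in>?V. line_field.parity F (\<gamma> v) \<longleftrightarrow> v \<notin> {a, c}"
    and F': "line_field M F'" "\<forall>v\<in>?V. line_field.parity F' (\<gamma> v) \<longleftrightarrow> v \<notin> {a, b}"
    using parity[of "{a, c}"] parity[of "{a, b}"] abcd by auto
  have par: "line_field.parity F (\<gamma> b)" "\<not> line_field.parity F' (\<gamma> b)"
    "\<not> line_field.parity F (\<gamma> c)" "line_field.parity F' (\<gamma> c)"
    using F(2) F'(2) in_V abcd(2) by auto
  note loops = F(1) F'(1) loop[OF in_V(2)] loop[OF in_V(3)] par
  show ?thesis
    using mod2_rank_ge_2[OF loops] not_cyclic_fundamental_group[OF loops] nk(2) by simp
qed

end
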